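(* The problem $k$-Product with Repetitions is $\mathsf{W}[1]$-hard when parameterized by $k$.
   Context: $k$-Product with Repetitions: given a set $A$ of rational numbers and a parameter $k$, decide whether one can choose $k$ numbers from $A$ (possibly with repetitions) whose product equals $1$. *)

theory Defs
  imports Complex_Main "HOL-Library.Log_Nat"
begin

section \<open>A model of computation with a time measure\<close>

text \<open>
  Instances and intermediate results are binary trees with integer leaves. Their size is the
  number of bits needed to write them down (up to a constant factor), so integers are measured
  in binary.
\<close>

datatype val = Atom int | Node val val

fun vsize :: "val \<Rightarrow> nat" where
  "vsize (Atom n) = Suc (floorlog 2 (nat \<bar>n\<bar>))"
| "vsize (Node a b) = Suc (vsize a + vsize b)"

datatype prim = Ident | Const val | Left | Right | IsAtom | Equal | Less | Add | Sub | Mul | Quot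

fun truth :: "bool \<Rightarrow> val" where
  "truth b = Atom (if b then 1 else 0)"

fun arith :: "(int \<Rightarrow> int \<Rightarrow> int) \<Rightarrow> val \<Rightarrow> val" where
  "arith f (Node (Atom a) (Atom b)) = Atom (f a b)"
| "arith f _ = Atom 0"

fun apply_prim :: "prim \<Rightarrow> val \<Rightarrow> val" where
  "apply_prim Ident x = x"
| "apply_prim (Const c) x = c"
| "apply_prim Left x = (case x of Atom n \<Rightarrow> Atom 0 | Node a b \<Rightarrow> a)"
| "apply_prim Right x = (case x of Atom n \<Rightarrow> Atom 0 | Node a b \<Rightarrow> b)"
| "apply_prim IsAtom x = (case x of Atom n \<Rightarrow> truth True | Node a b \<Rightarrow> truth False)"
| "apply_prim Equal x = (case x of Atom n \<Rightarrow> truth False | Node a b \<Rightarrow> truth (a = b))"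
| "apply_prim Less x = arith (\<lambda>a b. if a < b then 1 else 0) x"
| "apply_prim Add x = arith (+) x"
| "apply_prim Sub x = arith (-) x"
| "apply_prim Mul x = arith (*) x"
| "apply_prim Quot x = arith (div) x"

text \<open>
  Programs are variable-free: each one transforms a single value, and local variables are kept
  as components of that value. \<open>run p x t y\<close> means that \<open>p\<close>, started on \<open>x\<close>, halts
  after \<open>t\<close> time units with result \<open>y\<close>. A primitive operation is charged the sizes of
  its argument and of its result, and every construct that uses its argument twice is charged
  the size of that argument. Each primitive operation is computable in polynomial time on a
  Turing machine, and no value ever exceeds the input size plus the time spent so far (lemma
  \<open>run_vsize\<close>), so this time measure and Turing machine time bound each other
  polynomially. In tests, \<open>Atom 0\<close> is false and every other value is true.
\<close>

datatype prog =
    Prim prim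
  | Seq prog prog
  | Fork prog prog
  | Branch prog prog prog
  | Loop prog prog

inductive run :: "prog \<Rightarrow> val \<Rightarrow> nat \<Rightarrow> val \<Rightarrow> bool" where
  prim: "run (Prim f) x (vsize x + vsize (apply_prim f x)) (apply_prim f x)"
| seq: "run p x s y \<Longrightarrow> run q y t z \<Longrightarrow> run (Seq p q) x (s + t) z"
| fork: "run p x s y \<Longrightarrow> run q x t z \<Longrightarrow> run (Fork p q) x (Suc (vsize x) + s + t) (Node y z)"
| branch_true:
    "run c x s b \<Longrightarrow> b \<noteq> Atom 0 \<Longrightarrow> run p x t y \<Longrightarrow>
     run (Branch c p q) x (Suc (vsize x) + s + t) y"
| branch_false:
    "run c x s b \<Longrightarrow> b = Atom 0 \<Longrightarrow> run q x t y \<Longrightarrow>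
     run (Branch c p q) x (Suc (vsize x) + s + t) y"
| loop_end:
    "run c x s b \<Longrightarrow> b = Atom 0 \<Longrightarrow> run (Loop c p) x (Suc (vsize x) + s) x"
| loop_step:
    "run c x s b \<Longrightarrow> b \<noteq> Atom 0 \<Longrightarrow> run p x t y \<Longrightarrow> run (Loop c p) y u z \<Longrightarrow>
     run (Loop c p) x (Suc (vsize x) + s + t + u) z"

inductive_cases run_PrimE: "run (Prim f) x t y"
inductive_cases run_SeqE: "run (Seq p q) x t y"
inductive_cases run_ForkE: "run (Fork p q) x t y"
inductive_cases run_BranchE: "run (Branch c p q) x t y"
inductive_cases run_LoopE: "run (Loop c p) x t y"

lemma run_deterministic:
  "run p x t y \<Longrightarrow> run p x t' y' \<Longrightarrow> t' = t \<and> y' = y"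
proof (induction arbitrary: t' y' rule: run.induct)
  case prim
  from prim.prems show ?case by (rule run_PrimE) simp
next
  case seq
  from seq.prems show ?case by (rule run_SeqE) (metis seq.IH)
next
  case fork
  from fork.prems show ?case by (rule run_ForkE) (auto dest!: fork.IH)
next
  case branch_true
  from branch_true.prems show ?case
    by (rule run_BranchE) (use branch_true.hyps in \<open>auto dest!: branch_true.IH\<close>)+
next
  case branch_false
  from branch_false.prems show ?case
    by (rule run_BranchE) (use branch_false.hyps in \<open>auto dest!: branch_false.IH\<close>)+
next
  case loop_end
  from loop_end.prems show ?case
    by (rule run_LoopE) (use loop_end.hyps in \<open>auto dest!: loop_end.IH\<close>)+
next
  case loop_step
  from loop_step.prems show ?case
    by (rule run_LoopE) (use loop_step.hyps in \<open>fastforce dest!: loop_step.IH\<close>)+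
qed

lemma run_vsize: "run p x t y \<Longrightarrow> vsize y \<le> vsize x + t"
  by (induction rule: run.induct) auto

definition computable :: "(nat \<Rightarrow> nat) \<Rightarrow> bool" where
  "computable f \<longleftrightarrow> (\<exists>p. \<forall>n. \<exists>t. run p (Atom (int n)) t (Atom (int (f n))))"


section \<open>Parameterized problems and fpt-reductions\<close>

text \<open>A parameterized problem is the set of its yes-instances (instance, parameter).\<close>

type_synonym problem = "(val \<times> nat) set"

definition fpt_reducible :: "problem \<Rightarrow> problem \<Rightarrow> bool" where
  "fpt_reducible P Q \<longleftrightarrow>
     (\<exists>p f g c. computable f \<and> computable g \<and>
       (\<forall>x k. \<exists>t x' k'.
          run p (Node x (Atom (int k))) t (Node x' (Atom (int k'))) \<and>
          t \<le> f k * vsize x ^ c \<and>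
          k' \<le> g k \<and>
          ((x, k) \<in> P \<longleftrightarrow> (x', k') \<in> Q)))"

fun enc_list :: "('a \<Rightarrow> val) \<Rightarrow> 'a list \<Rightarrow> val" where
  "enc_list e [] = Atom 0"
| "enc_list e (a # as) = Node (e a) (enc_list e as)"

lemma inj_enc_list:
  assumes "inj e"
  shows "inj (enc_list e)"
proof (rule injI)
  fix xs ys
  assume "enc_list e xs = enc_list e ys"
  then show "xs = ys"
  proof (induction xs arbitrary: ys)
    case Nil
    then show ?case by (cases ys) auto
  next
    case (Cons x xs)
    then show ?case using injD[OF assms] by (cases ys) auto
  qed
qed


section \<open>Boolean circuits and the W-hierarchy\<close>

text \<open>
  A circuit is a list of gates in topological order; a gate refers to its in-neighbours by their
  positions in the list. The last gate is the output.
\<close>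

datatype gate = Input | Neg nat | And "nat list" | Or "nat list"

type_synonym circuit = "gate list"

fun args :: "gate \<Rightarrow> nat list" where
  "args Input = []"
| "args (Neg j) = [j]"
| "args (And js) = js"
| "args (Or js) = js"

fun fan_in_ok :: "gate \<Rightarrow> bool" where
  "fan_in_ok (And js) \<longleftrightarrow> length js \<ge> 2 \<and> distinct js"
| "fan_in_ok (Or js) \<longleftrightarrow> length js \<ge> 2 \<and> distinct js"
| "fan_in_ok _ \<longleftrightarrow> True"

definition circuit :: "circuit \<Rightarrow> bool" where
  "circuit C \<longleftrightarrow> C \<noteq> [] \<and>
     (\<forall>i < length C. fan_in_ok (C ! i) \<and> (\<forall>j \<in> set (args (C ! i)). j < i))"

fun gate_value :: "(nat \<Rightarrow> bool) \<Rightarrow> nat \<Rightarrow> gate \<Rightarrow> bool" where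
  "gate_value v i Input \<longleftrightarrow> v i"
| "gate_value v i (Neg j) \<longleftrightarrow> \<not> v j"
| "gate_value v i (And js) \<longleftrightarrow> (\<forall>j \<in> set js. v j)"
| "gate_value v i (Or js) \<longleftrightarrow> (\<exists>j \<in> set js. v j)"

text \<open>
  Since a circuit is acyclic, the values of all gates are determined by those of the input
  gates, so a valuation of the gates amounts to an assignment to the inputs.
\<close>

definition valuation :: "circuit \<Rightarrow> (nat \<Rightarrow> bool) \<Rightarrow> bool" where
  "valuation C v \<longleftrightarrow> (\<forall>i < length C. v i = gate_value v i (C ! i))"

definition weight :: "circuit \<Rightarrow> (nat \<Rightarrow> bool) \<Rightarrow> nat" where
  "weight C v = card {i. i < length C \<and> C ! i = Input \<and> v i}"

definition satisfiable_with_weight :: "circuit \<Rightarrow> nat \<Rightarrow> bool" where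
  "satisfiable_with_weight C k \<longleftrightarrow>
     (\<exists>v. valuation C v \<and> v (length C - 1) \<and> weight C v = k)"

definition input_output_path :: "circuit \<Rightarrow> nat list \<Rightarrow> bool" where
  "input_output_path C ns \<longleftrightarrow> ns \<noteq> [] \<and> set ns \<subseteq> {..<length C} \<and>
     C ! hd ns = Input \<and> last ns = length C - 1 \<and>
     successively (\<lambda>j i. j \<in> set (args (C ! i))) ns"

definition large :: "gate \<Rightarrow> bool" where
  "large g \<longleftrightarrow> length (args g) > 2"

definition depth_le :: "circuit \<Rightarrow> nat \<Rightarrow> bool" where
  "depth_le C d \<longleftrightarrow> (\<forall>ns. input_output_path C ns \<longrightarrow> length ns - 1 \<le> d)"

definition weft_le :: "circuit \<Rightarrow> nat \<Rightarrow> bool" where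
  "weft_le C w \<longleftrightarrow>
     (\<forall>ns. input_output_path C ns \<longrightarrow> length (filter (\<lambda>i. large (C ! i)) ns) \<le> w)"

fun enc_gate :: "gate \<Rightarrow> val" where
  "enc_gate Input = Node (Atom 0) (Atom 0)"
| "enc_gate (Neg j) = Node (Atom 1) (Atom (int j))"
| "enc_gate (And js) = Node (Atom 2) (enc_list (\<lambda>j. Atom (int j)) js)"
| "enc_gate (Or js) = Node (Atom 3) (enc_list (\<lambda>j. Atom (int j)) js)"

lemma inj_enc_gate: "inj enc_gate"
proof (rule injI)
  fix g h
  have "inj (enc_list (\<lambda>j. Atom (int j)))"
    by (intro inj_enc_list injI) simp
  moreover assume "enc_gate g = enc_gate h"
  ultimately show "g = h"
    by (cases g; cases h) (auto dest: injD)
qed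

definition weighted_circuit_sat :: "nat \<Rightarrow> nat \<Rightarrow> problem" where
  "weighted_circuit_sat w d =
     {(enc_list enc_gate C, k) | C k.
        circuit C \<and> weft_le C w \<and> depth_le C d \<and> satisfiable_with_weight C k}"

definition W :: "nat \<Rightarrow> problem set" where
  "W t = {P. \<exists>d \<ge> 1. fpt_reducible P (weighted_circuit_sat t d)}"

definition W_hard :: "nat \<Rightarrow> problem \<Rightarrow> bool" where
  "W_hard t Q \<longleftrightarrow> (\<forall>P \<in> W t. fpt_reducible P Q)"


section \<open>Product with repetitions\<close>

definition has_product_with_repetitions :: "rat set \<Rightarrow> nat \<Rightarrow> bool" where
  "has_product_with_repetitions A k \<longleftrightarrow>
     (\<exists>bs. length bs = k \<and> set bs \<subseteq> A \<and> prod_list bs = 1)"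

text \<open>A rational number is given by numerator and denominator of its reduced fraction.\<close>

definition enc_rat :: "rat \<Rightarrow> val" where
  "enc_rat r = (case quotient_of r of (p, q) \<Rightarrow> Node (Atom p) (Atom q))"

lemma inj_enc_rat: "inj enc_rat"
  by (rule injI) (auto simp: enc_rat_def quotient_of_inject split: prod.splits)

definition k_product_with_repetitions :: problem where
  "k_product_with_repetitions =
     {(enc_list enc_rat as, k) | as k. has_product_with_repetitions (set as) k}"

end

(*
  A weft 1 circuit of depth d is refuted locally. Besides the k selected inputs in increasing order,
  guess for each of the boundedly many large existential gates near the output the argument that
  decides it. If this guess does not make the output true, then some r(d) of the guessed values
  already show it; a pair of consecutive selected inputs certifies that every input between them is
  unselected. Satisfiability is thus a constraint problem with k + 2^(d+1) variables, values below
  the size of the circuit, and constraints on r(d)-tuples.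

  Constraint problems become product problems: there is one class of rationals per tuple of
  variables, with one rational per admissible assignment to the tuple. Its factors are powers of the
  pairwise coprime numbers i L! + 1 (Goedel's beta function), so that a product is 1 iff every
  exponent sum vanishes. One family of bases makes all classes be used equally often, hence once
  each, and a second family makes the values that different classes give to a variable agree. The
  exponents are at most the size of the circuit, so the reduction takes polynomial time.
*)

theory Submission
  imports Defs "HOL-Computational_Algebra.Factorial_Ring"
begin

section \<open>Polynomial-time functions on values\<close>

text \<open>Refutations stay small because a universal demand fails at one argument and a small
  existential gate at two. A large existential gate can fail only at all of its arguments; once its
  deciding argument is guessed, refuting that one suffices. Weft 1 means that no guess is consulted
  below a large gate, so the guesses sit in a binary tree of depth d. The obstacle on the product
  side is that a number may be repeated. Counting removes it: there are as many factors as classes,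
  so classes that are used equally often are used once each. Coprime bases do the work of primes
  without a search for primes. With c the number of variables and q =
  \<open>refutation_size d\<close>, there are c ^ q classes with q + 1 bases each, so L = c ^ q * (q
  + 1). The parameter is written in binary, hence may be exponential in the input length; testing
  \<open>k <= length C\<close> first makes L, and with it the bit length of \<open>fact L\<close>,
  polynomial.\<close>

text \<open>Since \<open>vsize x + 2\<close> is at least 2, constants, sums and products are
  absorbed by a larger exponent, so one exponent can stand for a polynomial.\<close>

definition poly_bounded :: "(val \<Rightarrow> nat) \<Rightarrow> bool" where
  "poly_bounded b \<longleftrightarrow> (\<exists>c. \<forall>x. b x \<le> (vsize x + 2) ^ c)"

lemma poly_boundedI: "(\<And>x. b x \<le> (vsize x + 2) ^ c) \<Longrightarrow> poly_bounded b"
  by (auto simp: poly_bounded_def)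

lemma poly_bounded_le:
  assumes "poly_bounded b" "\<And>x. a x \<le> b x"
  shows "poly_bounded a"
  using assms unfolding poly_bounded_def by (meson le_trans)

lemma poly_bounded_const: "poly_bounded (\<lambda>_. n)"
proof (rule poly_boundedI)
  fix x
  have "n \<le> 2 ^ n" by (simp add: less_imp_le)
  also have "\<dots> \<le> (vsize x + 2) ^ n" by (rule power_mono) auto
  finally show "n \<le> (vsize x + 2) ^ n" .
qed

lemma poly_bounded_vsize: "poly_bounded vsize"
  by (rule poly_boundedI[where c = 1]) simp

lemma poly_bounded_mult:
  assumes "poly_bounded a" "poly_bounded b"
  shows "poly_bounded (\<lambda>x. a x * b x)"
proof -
  obtain c d where "\<And>x. a x \<le> (vsize x + 2) ^ c" "\<And>x. b x \<le> (vsize x + 2) ^ d"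
    using assms unfolding poly_bounded_def by blast
  then have "a x * b x \<le> (vsize x + 2) ^ (c + d)" for x
    by (simp add: power_add mult_le_mono)
  then show ?thesis by (rule poly_boundedI)
qed

text \<open>Reduced to products by a + b <= (a + 1) * (b + 1); only adding 1 needs its own
  estimate.\<close>

lemma poly_bounded_add:
  assumes "poly_bounded a" "poly_bounded b"
  shows "poly_bounded (\<lambda>x. a x + b x)"
proof -
  have "poly_bounded (\<lambda>x. (a x + 1) * (b x + 1))" if "poly_bounded (\<lambda>x. a x + 1)" "poly_bounded (\<lambda>x. b x + 1)"
    using that by (rule poly_bounded_mult)
  moreover have "poly_bounded (\<lambda>x. f x + 1)" if f: "poly_bounded f" for f
  proof -
    obtain c where c: "\<And>x. f x \<le> (vsize x + 2) ^ c" using f unfolding poly_bounded_def by blast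
    have "f x + 1 \<le> (vsize x + 2) ^ Suc c" for x
    proof -
      have "f x + 1 \<le> (vsize x + 2) ^ c + (vsize x + 2) ^ c"
        by (rule add_mono) (use c in auto)
      also have "\<dots> \<le> (vsize x + 2) * (vsize x + 2) ^ c" by simp
      finally show ?thesis by simp
    qed
    then show ?thesis by (rule poly_boundedI)
  qed
  ultimately have "poly_bounded (\<lambda>x. (a x + 1) * (b x + 1))" using assms by blast
  then show ?thesis by (rule poly_bounded_le) simp
qed

lemma poly_bounded_power:
  assumes "poly_bounded a"
  shows "poly_bounded (\<lambda>x. a x ^ n)"
  by (induction n) (auto intro: poly_bounded_const poly_bounded_mult[OF assms])

lemma poly_bounded_comp:
  assumes "poly_bounded b" "poly_bounded (\<lambda>x. vsize (f x))"
  shows "poly_bounded (\<lambda>x. b (f x))"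
proof -
  obtain c where c: "\<And>x. b x \<le> (vsize x + 2) ^ c" using assms unfolding poly_bounded_def by blast
  have "poly_bounded (\<lambda>x. (vsize (f x) + 2) ^ c)"
    by (intro poly_bounded_power poly_bounded_add poly_bounded_const assms)
  then show ?thesis by (rule poly_bounded_le) (rule c)
qed

lemmas poly_bounded_intros =
  poly_bounded_const poly_bounded_vsize poly_bounded_mult poly_bounded_add poly_bounded_power

text \<open>Totality on all values, including those that encode nothing, keeps the closure rules
  free of side conditions.\<close>

definition ptime :: "(val \<Rightarrow> val) \<Rightarrow> bool" where
  "ptime f \<longleftrightarrow> (\<exists>p t. poly_bounded t \<and> (\<forall>x. run p x (t x) (f x)))"

lemma ptimeE:
  assumes "ptime f"
  obtains p t where "poly_bounded t" "\<And>x. run p x (t x) (f x)"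
  using assms unfolding ptime_def by blast

lemma ptimeI: "poly_bounded t \<Longrightarrow> (\<And>x. run p x (t x) (f x)) \<Longrightarrow> ptime f"
  unfolding ptime_def by blast

text \<open>By \<open>run_vsize\<close> a result exceeds its input by at most the time spent. This
  is what makes composition stay polynomial.\<close>

lemma ptime_poly_size: "ptime f \<Longrightarrow> poly_bounded (\<lambda>x. vsize (f x))"
  by (erule ptimeE, rule poly_bounded_le[OF poly_bounded_add[OF poly_bounded_vsize]])
     (auto dest: run_vsize)

lemma ptime_prim:
  assumes "poly_bounded (\<lambda>x. vsize (apply_prim f x))"
  shows "ptime (apply_prim f)"
  by (rule ptimeI[OF _ run.prim]) (intro poly_bounded_intros assms)

lemma ptime_comp:
  assumes "ptime f" "ptime g"
  shows "ptime (\<lambda>x. f (g x))"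
proof -
  obtain p s where p: "poly_bounded s" "\<And>x. run p x (s x) (f x)" using assms(1) unfolding ptime_def by blast
  obtain q t where q: "poly_bounded t" "\<And>x. run q x (t x) (g x)" using assms(2) unfolding ptime_def by blast
  show ?thesis
  proof (rule ptimeI)
    show "run (Seq q p) x (t x + s (g x)) (f (g x))" for x
      by (rule run.seq[OF q(2) p(2)])
    show "poly_bounded (\<lambda>x. t x + s (g x))"
      by (intro poly_bounded_add q(1) poly_bounded_comp[OF p(1)] ptime_poly_size assms(2))
  qed
qed

lemma ptime_Node:
  assumes "ptime f" "ptime g"
  shows "ptime (\<lambda>x. Node (f x) (g x))"
proof -
  obtain p s where p: "poly_bounded s" "\<And>x. run p x (s x) (f x)" using assms(1) unfolding ptime_def by blast
  obtain q t where q: "poly_bounded t" "\<And>x. run q x (t x) (g x)" using assms(2) unfolding ptime_def by blast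
  show ?thesis
  proof (rule ptimeI)
    show "run (Fork p q) x (Suc (vsize x) + s x + t x) (Node (f x) (g x))" for x
      by (rule run.fork[OF p(2) q(2)])
    show "poly_bounded (\<lambda>x. Suc (vsize x) + s x + t x)"
      using poly_bounded_add[OF poly_bounded_add[OF poly_bounded_add[OF poly_bounded_vsize poly_bounded_const[of 1]] p(1)] q(1)]
      by simp
  qed
qed

lemma ptime_branch:
  assumes "ptime c" "ptime f" "ptime g"
  shows "ptime (\<lambda>x. if c x \<noteq> Atom 0 then f x else g x)"
proof -
  obtain r u where r: "poly_bounded u" "\<And>x. run r x (u x) (c x)" using assms(1) unfolding ptime_def by blast
  obtain p s where p: "poly_bounded s" "\<And>x. run p x (s x) (f x)" using assms(2) unfolding ptime_def by blast
  obtain q t where q: "poly_bounded t" "\<And>x. run q x (t x) (g x)" using assms(3) unfolding ptime_def by blast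
  let ?t = "\<lambda>x. Suc (vsize x) + u x + (if c x \<noteq> Atom 0 then s x else t x)"
  show ?thesis
  proof (rule ptimeI)
    show "run (Branch r p q) x (?t x) (if c x \<noteq> Atom 0 then f x else g x)" for x
      using run.branch_true[OF r(2) _ p(2)] run.branch_false[OF r(2) _ q(2)] by auto
    have "poly_bounded (\<lambda>x. vsize x + 1 + u x + (s x + t x))"
      by (intro poly_bounded_intros p q r)
    then show "poly_bounded ?t" by (rule poly_bounded_le) auto
  qed
qed

section \<open>Decoding values, and closure under the primitive operations\<close>

definition vleft :: "val \<Rightarrow> val" where "vleft = apply_prim Left"
definition vright :: "val \<Rightarrow> val" where "vright = apply_prim Right"

lemma vleft_simps [simp]: "vleft (Atom n) = Atom 0" "vleft (Node a b) = a"
  and vright_simps [simp]: "vright (Atom n) = Atom 0" "vright (Node a b) = b"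
  by (simp_all add: vleft_def vright_def)

fun is_atom :: "val \<Rightarrow> bool" where
  "is_atom (Atom n) = True" | "is_atom (Node a b) = False"

fun ival :: "val \<Rightarrow> int" where
  "ival (Atom n) = n" | "ival (Node a b) = 0"

text \<open>The atom that ends the list is ignored, so \<open>elist (dlist v) = v\<close> later
  serves as the test that \<open>v\<close> is a proper list encoding.\<close>

fun dlist :: "val \<Rightarrow> val list" where
  "dlist (Atom n) = []" | "dlist (Node a b) = a # dlist b"

abbreviation elist :: "val list \<Rightarrow> val" where "elist \<equiv> enc_list (\<lambda>v. v)"

lemma dlist_enc_list [simp]: "dlist (enc_list e xs) = map e xs"
  by (induction xs) auto

lemma elist_map: "elist (map e xs) = enc_list e xs"
  by (induction xs) auto

lemma vsize_pos [simp]: "0 < vsize x" by (cases x) auto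

lemma vsize_vleft_le: "vsize (vleft x) \<le> vsize x"
  and vsize_vright_le: "vsize (vright x) \<le> vsize x"
  using vsize_pos[of x] by (cases x; simp add: floorlog_def)+

text \<open>One notion per result type (list, integer, truth value), so that closure rules can be
  selected by the shape of the goal.\<close>

definition plist :: "(val \<Rightarrow> val list) \<Rightarrow> bool" where
  "plist l \<longleftrightarrow> ptime (\<lambda>x. elist (l x))"

definition pint :: "(val \<Rightarrow> int) \<Rightarrow> bool" where
  "pint i \<longleftrightarrow> ptime (\<lambda>x. Atom (i x))"

definition pdec :: "(val \<Rightarrow> bool) \<Rightarrow> bool" where
  "pdec P \<longleftrightarrow> ptime (\<lambda>x. truth (P x))"

lemma ptime_id: "ptime (\<lambda>x. x)"
proof -
  have "apply_prim Ident = (\<lambda>x. x)" by (rule ext) simp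
  then show ?thesis using ptime_prim[of Ident] poly_bounded_vsize by simp
qed

lemma ptime_const: "ptime (\<lambda>_. c)"
proof -
  have "apply_prim (Const c) = (\<lambda>_. c)" by (rule ext) simp
  then show ?thesis using ptime_prim[of "Const c"] poly_bounded_const by simp
qed

lemma ptime_vleft: "ptime f \<Longrightarrow> ptime (\<lambda>x. vleft (f x))"
  using ptime_comp[OF ptime_prim[of Left]] poly_bounded_le[OF poly_bounded_vsize]
  by (simp add: vleft_def[symmetric] vsize_vleft_le)

lemma ptime_vright: "ptime f \<Longrightarrow> ptime (\<lambda>x. vright (f x))"
  using ptime_comp[OF ptime_prim[of Right]] poly_bounded_le[OF poly_bounded_vsize]
  by (simp add: vright_def[symmetric] vsize_vright_le)

lemma ptime_truth_prim:
  assumes "\<And>x. \<exists>b. apply_prim f x = truth b"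
  shows "ptime (apply_prim f)"
proof (rule ptime_prim, rule poly_bounded_le[OF poly_bounded_const])
  fix x
  show "vsize (apply_prim f x) \<le> 3"
    using assms[of x] by (auto simp: floorlog_def)
qed

lemma pdec_is_atom: "ptime f \<Longrightarrow> pdec (\<lambda>x. is_atom (f x))"
proof -
  assume f: "ptime f"
  have eq: "apply_prim IsAtom y = truth (is_atom y)" for y by (cases y) auto
  have "ptime (apply_prim IsAtom)" by (rule ptime_truth_prim) (use eq in blast)
  from ptime_comp[OF this f] show ?thesis unfolding pdec_def eq .
qed

lemma pdec_eq: "ptime f \<Longrightarrow> ptime g \<Longrightarrow> pdec (\<lambda>x. f x = g x)"
proof -
  assume f: "ptime f" and g: "ptime g"
  have eq: "apply_prim Equal (Node a b) = truth (a = b)" for a b by auto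
  have "\<exists>b. apply_prim Equal x = truth b" for x by (cases x) auto
  then have "ptime (apply_prim Equal)" by (rule ptime_truth_prim)
  from ptime_comp[OF this ptime_Node[OF f g]] show ?thesis unfolding pdec_def eq .
qed

lemma pdec_less: "pint i \<Longrightarrow> pint j \<Longrightarrow> pdec (\<lambda>x. i x < j x)"
proof -
  assume f: "pint i" and g: "pint j"
  have eq: "apply_prim Less (Node (Atom a) (Atom b)) = truth (a < b)" for a b by auto
  have "\<exists>b. apply_prim Less x = truth b" for x
    by (cases "(\<lambda>a b. if (a::int) < b then 1 else 0 :: int, x)" rule: arith.cases)
       (auto intro: exI[of _ "True"] exI[of _ "False"])
  then have "ptime (apply_prim Less)" by (rule ptime_truth_prim)
  from ptime_comp[OF this ptime_Node[OF f[unfolded pint_def] g[unfolded pint_def]]]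
  show ?thesis unfolding pdec_def eq .
qed

lemma ptime_if:
  assumes "pdec P" "ptime f" "ptime g"
  shows "ptime (\<lambda>x. if P x then f x else g x)"
proof -
  have "(truth b \<noteq> Atom 0) = b" for b by simp
  then show ?thesis using ptime_branch[OF assms[unfolded pdec_def]] by (simp only:)
qed

lemma pdec_if: "pdec P \<Longrightarrow> pdec Q \<Longrightarrow> pdec R \<Longrightarrow> pdec (\<lambda>x. if P x then Q x else R x)"
  using ptime_if[of P "\<lambda>x. truth (Q x)" "\<lambda>x. truth (R x)"] unfolding pdec_def
  by (simp add: if_distrib)

lemma pdec_const: "pdec (\<lambda>_. b)"
  unfolding pdec_def by (rule ptime_const)

lemma pdec_not: "pdec P \<Longrightarrow> pdec (\<lambda>x. \<not> P x)"
proof -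
  assume "pdec P"
  moreover have "(\<not> P x) = (if P x then False else True)" for x by simp
  ultimately show ?thesis using pdec_if[OF _ pdec_const[of False] pdec_const[of True], of P] by presburger
qed

lemma pdec_conj: "pdec P \<Longrightarrow> pdec Q \<Longrightarrow> pdec (\<lambda>x. P x \<and> Q x)"
proof -
  assume "pdec P" "pdec Q"
  moreover have "(P x \<and> Q x) = (if P x then Q x else False)" for x by simp
  ultimately show ?thesis using pdec_if[OF _ _ pdec_const[of False], of P Q] by presburger
qed

lemma pdec_disj: "pdec P \<Longrightarrow> pdec Q \<Longrightarrow> pdec (\<lambda>x. P x \<or> Q x)"
proof -
  assume "pdec P" "pdec Q"
  then have "pdec (\<lambda>x. \<not> (\<not> P x \<and> \<not> Q x))" by (intro pdec_not pdec_conj)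
  then show ?thesis by simp
qed

lemma pdec_imp: "pdec P \<Longrightarrow> pdec Q \<Longrightarrow> pdec (\<lambda>x. P x \<longrightarrow> Q x)"
  unfolding imp_conv_disj by (intro pdec_disj pdec_not)

lemma pdec_comp: "pdec P \<Longrightarrow> ptime f \<Longrightarrow> pdec (\<lambda>x. P (f x))"
  unfolding pdec_def by (rule ptime_comp)

lemma plist_comp: "plist l \<Longrightarrow> ptime f \<Longrightarrow> plist (\<lambda>x. l (f x))"
  unfolding plist_def by (rule ptime_comp)

lemma pint_comp: "pint i \<Longrightarrow> ptime f \<Longrightarrow> pint (\<lambda>x. i (f x))"
  unfolding pint_def by (rule ptime_comp)

lemma pint_const: "pint (\<lambda>_. n)"
  unfolding pint_def by (rule ptime_const)

lemma plist_const: "plist (\<lambda>_. l)"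
  unfolding plist_def by (rule ptime_const)

lemma ptime_Atom: "pint i \<Longrightarrow> ptime (\<lambda>x. Atom (i x))"
  unfolding pint_def .

lemma ptime_elist: "plist l \<Longrightarrow> ptime (\<lambda>x. elist (l x))"
  unfolding plist_def .

lemma plist_if: "pdec P \<Longrightarrow> plist k \<Longrightarrow> plist l \<Longrightarrow> plist (\<lambda>x. if P x then k x else l x)"
  using ptime_if[of P "\<lambda>x. elist (k x)" "\<lambda>x. elist (l x)"] unfolding plist_def
  by (simp add: if_distrib)

lemma pint_if: "pdec P \<Longrightarrow> pint i \<Longrightarrow> pint j \<Longrightarrow> pint (\<lambda>x. if P x then i x else j x)"
  using ptime_if[of P "\<lambda>x. Atom (i x)" "\<lambda>x. Atom (j x)"] unfolding pint_def
  by (simp add: if_distrib)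

lemma pint_ival: "ptime f \<Longrightarrow> pint (\<lambda>x. ival (f x))"
proof -
  assume f: "ptime f"
  have "Atom (ival y) = (if is_atom y then y else Atom 0)" for y by (cases y) auto
  then show ?thesis
    unfolding pint_def by (simp add: ptime_if pdec_is_atom f ptime_const)
qed

section \<open>Bit lengths of sums and products\<close>

lemma floorlog_mult_le: "floorlog 2 (a * b) \<le> floorlog 2 a + floorlog 2 b"
proof (cases "a = 0 \<or> b = 0")
  case False
  have "a < 2 ^ floorlog 2 a" "b < 2 ^ floorlog 2 b"
    using floorlog_bounds[of a 2] floorlog_bounds[of b 2] False by auto
  then have "a * b < 2 ^ (floorlog 2 a + floorlog 2 b)"
    by (simp add: power_add mult_strict_mono)
  then show ?thesis by (rule floorlog_leI) auto
qed (auto simp: floorlog_def)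

lemma floorlog_add_le: "floorlog 2 (a + b) \<le> Suc (floorlog 2 a + floorlog 2 b)"
proof -
  have bound: "x < 2 ^ floorlog 2 x" for x :: nat
    using floorlog_bounds[of x 2] by (cases "x = 0") auto
  have "a + b < 2 ^ (floorlog 2 a + floorlog 2 b) + 2 ^ (floorlog 2 a + floorlog 2 b)"
    by (intro add_strict_mono less_le_trans[OF bound] power_increasing) auto
  then have "a + b < 2 ^ Suc (floorlog 2 a + floorlog 2 b)" by simp
  then show ?thesis by (rule floorlog_leI) auto
qed

lemma vsize_Atom_mult: "vsize (Atom (a * b)) \<le> vsize (Atom a) + vsize (Atom b)"
  using floorlog_mult_le[of "nat \<bar>a\<bar>" "nat \<bar>b\<bar>"] by (simp add: abs_mult nat_mult_distrib)

text \<open>The carry is absorbed by the extra unit that \<open>vsize\<close> charges for each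
  atom.\<close>

lemma vsize_Atom_add: "vsize (Atom (a + b)) \<le> vsize (Atom a) + vsize (Atom b)"
proof -
  have "floorlog 2 (nat \<bar>a + b\<bar>) \<le> floorlog 2 (nat \<bar>a\<bar> + nat \<bar>b\<bar>)"
    by (rule floorlog_mono) linarith
  then show ?thesis using floorlog_add_le[of "nat \<bar>a\<bar>" "nat \<bar>b\<bar>"] by simp
qed

lemma vsize_Atom_le: "vsize (Atom n) \<le> Suc (nat \<bar>n\<bar>)"
  by (simp add: floorlog_leI less_exp)

lemma ptime_arith:
  assumes "\<And>a b. vsize (Atom (f a b)) \<le> vsize (Atom a) + vsize (Atom b)"
    and "\<And>x. apply_prim p x = arith f x" and "pint i" "pint j"
  shows "pint (\<lambda>x. f (i x) (j x))"
proof -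
  have "ptime (apply_prim p)"
  proof (rule ptime_prim, rule poly_bounded_le[OF poly_bounded_vsize])
    fix x
    show "vsize (apply_prim p x) \<le> vsize x"
    proof (cases "\<exists>a b. x = Node (Atom a) (Atom b)")
      case True
      then show ?thesis
        unfolding assms(2) using le_SucI[OF assms(1)] by (auto simp del: vsize.simps(1))
    next
      case False
      then have "apply_prim p x = Atom 0"
        unfolding assms(2) by (cases "(f, x)" rule: arith.cases) auto
      then show ?thesis using vsize_pos[of x] by (simp add: floorlog_def Suc_leI)
    qed
  qed
  from ptime_comp[OF this ptime_Node[OF assms(3,4)[unfolded pint_def]]]
  show ?thesis unfolding pint_def assms(2) by simp
qed

lemma pint_add: "pint i \<Longrightarrow> pint j \<Longrightarrow> pint (\<lambda>x. i x + j x)"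
  by (rule ptime_arith[of "(+)" Add]) (use vsize_Atom_add in auto)

lemma pint_diff: "pint i \<Longrightarrow> pint j \<Longrightarrow> pint (\<lambda>x. i x - j x)"
proof (rule ptime_arith[of "(-)" Sub])
  show "vsize (Atom (a - b)) \<le> vsize (Atom a) + vsize (Atom b)" for a b
    using vsize_Atom_add[of a "- b"] by simp
qed auto

lemma pint_mult: "pint i \<Longrightarrow> pint j \<Longrightarrow> pint (\<lambda>x. i x * j x)"
  by (rule ptime_arith[of "(*)" Mul]) (use vsize_Atom_mult in auto)

lemma pint_minus: "pint i \<Longrightarrow> pint (\<lambda>x. - i x)"
  using pint_diff[OF pint_const[of 0]] by simp

lemma pdec_int_eq: "pint i \<Longrightarrow> pint j \<Longrightarrow> pdec (\<lambda>x. i x = j x)"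
  using pdec_eq[of "\<lambda>x. Atom (i x)" "\<lambda>x. Atom (j x)"] by (simp add: pint_def)

lemma pdec_le: "pint i \<Longrightarrow> pint j \<Longrightarrow> pdec (\<lambda>x. i x \<le> j x)"
  unfolding not_less[symmetric] by (intro pdec_not pdec_less)

section \<open>Folding over a list by a loop\<close>

text \<open>A loop state holds the remaining list, the accumulator and the untouched input
  \<open>x\<close>. \<open>B\<close> bounds the cost of a round for every prefix already folded,
  hence the total time by the number of rounds; \<open>z\<close> is the atom left over from the
  list.\<close>

lemma run_fold_loop:
  assumes "\<And>st. run pc st (tc st) (truth (\<not> is_atom (vleft st)))"
    and "\<And>st. run pb st (tb st) (step st)"
    and "\<And>a r acc. step (Node (Node a r) (Node acc x)) = Node r (Node (g a acc) x)"
    and "\<And>ys zs r. dlist l = ys @ zs \<Longrightarrow> vsize r \<le> vsize l \<Longrightarrow>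
      Suc (vsize (Node r (Node (fold g ys acc) x))) + tc (Node r (Node (fold g ys acc) x))
        + tb (Node r (Node (fold g ys acc) x)) \<le> B"
  shows "\<exists>t z. run (Loop pc pb) (Node l (Node acc x)) t (Node z (Node (fold g (dlist l) acc) x)) \<and>
    t \<le> Suc (length (dlist l)) * B \<and> vsize z \<le> vsize l"
  using assms(4)
proof (induction l arbitrary: acc)
  case (Atom n)
  let ?st = "Node (Atom n) (Node acc x)"
  have "run (Loop pc pb) ?st (Suc (vsize ?st) + tc ?st) ?st"
    by (rule run.loop_end[OF assms(1)]) simp
  moreover have "Suc (vsize ?st) + tc ?st \<le> B"
    using Atom.prems[of "[]" "[]" "Atom n"] by simp
  ultimately show ?case by fastforce
next
  case (Node a l)
  let ?st = "Node (Node a l) (Node acc x)"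
  have "\<exists>t z. run (Loop pc pb) (Node l (Node (g a acc) x)) t (Node z (Node (fold g (dlist l) (g a acc)) x)) \<and>
    t \<le> Suc (length (dlist l)) * B \<and> vsize z \<le> vsize l"
  proof (rule Node.IH)
    fix ys zs r
    assume "dlist l = ys @ zs" "vsize r \<le> vsize l"
    then show "Suc (vsize (Node r (Node (fold g ys (g a acc)) x))) + tc (Node r (Node (fold g ys (g a acc)) x))
        + tb (Node r (Node (fold g ys (g a acc)) x)) \<le> B"
      using Node.prems[of "a # ys" zs r] by simp
  qed
  then obtain t z where t: "run (Loop pc pb) (Node l (Node (g a acc) x)) t (Node z (Node (fold g (dlist l) (g a acc)) x))"
    "t \<le> Suc (length (dlist l)) * B" "vsize z \<le> vsize l" by blast
  have "run (Loop pc pb) ?st (Suc (vsize ?st) + tc ?st + tb ?st + t) (Node z (Node (fold g (dlist l) (g a acc)) x))"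
    using run.loop_step[OF assms(1)[of ?st] _ assms(2)[of ?st], unfolded assms(3), OF _ t(1)] by simp
  moreover have "Suc (vsize ?st) + tc ?st + tb ?st \<le> B"
    using Node.prems[of "[]" "a # dlist l" "Node a l"] by simp
  then have "Suc (vsize ?st) + tc ?st + tb ?st + t \<le> Suc (length (dlist (Node a l))) * B"
    using t(2) by simp
  moreover have "vsize z \<le> vsize (Node a l)" using t(3) by simp
  ultimately show ?case by (metis dlist.simps(2) fold_simps(2))
qed

lemma length_dlist_le: "length (dlist x) \<le> vsize x"
  by (induction x) auto

lemma vsize_dlist_le: "a \<in> set (dlist x) \<Longrightarrow> vsize a \<le> vsize x"
  by (induction x) auto

text \<open>A polynomial-time step such as squaring can double the bit length in every round, so
  iteration need not stay polynomial; hence the bound \<open>b\<close> on all intermediate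
  accumulators. The step reads entry, accumulator and input from one value
  \<open>Node a (Node acc x)\<close>.\<close>

lemma ptime_fold:
  assumes L: "ptime L" and I: "ptime I"
    and g: "ptime (\<lambda>p. g (vright (vright p)) (vleft p) (vleft (vright p)))"
    and b: "poly_bounded b"
    and bound: "\<And>x ys zs. dlist (L x) = ys @ zs \<Longrightarrow> vsize (fold (g x) ys (I x)) \<le> b x"
  shows "ptime (\<lambda>x. fold (g x) (dlist (L x)) (I x))"
proof -
  let ?step = "\<lambda>s. Node (vright (vleft s))
    (Node (g (vright (vright s)) (vleft (vleft s)) (vleft (vright s))) (vright (vright s)))"
  have "pdec (\<lambda>s. \<not> is_atom (vleft s))"
    by (intro pdec_not pdec_is_atom ptime_vleft ptime_id)
  then obtain pc tc where pc: "\<And>s. run pc s (tc s) (truth (\<not> is_atom (vleft s)))" "poly_bounded tc"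
    unfolding pdec_def ptime_def by blast
  have "ptime (\<lambda>s. g (vright (vright s)) (vleft (vleft s)) (vleft (vright s)))"
    using ptime_comp[OF g, of "\<lambda>s. Node (vleft (vleft s)) (vright s)"]
    by (simp add: ptime_Node ptime_vleft ptime_vright ptime_id)
  then have "ptime ?step"
    by (intro ptime_Node ptime_vright ptime_vleft ptime_id)
  then obtain pb tb where pb: "\<And>s. run pb s (tb s) (?step s)" "poly_bounded tb"
    unfolding ptime_def by blast
  have "ptime (\<lambda>x. Node (L x) (Node (I x) x))"
    by (intro ptime_Node L I ptime_id)
  then obtain p0 t0 where p0: "\<And>x. run p0 x (t0 x) (Node (L x) (Node (I x) x))" "poly_bounded t0"
    unfolding ptime_def by blast
  have "ptime (\<lambda>s. vleft (vright s))" by (intro ptime_vright ptime_vleft ptime_id)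
  then obtain p2 t2 where p2: "\<And>s. run p2 s (t2 s) (vleft (vright s))" "poly_bounded t2"
    unfolding ptime_def by blast
  have "poly_bounded (\<lambda>s. vsize s + 1 + tc s + tb s)"
    by (intro poly_bounded_intros pc pb)
  then obtain c where c: "\<And>s. vsize s + 1 + tc s + tb s \<le> (vsize s + 2) ^ c"
    unfolding poly_bounded_def by blast
  obtain d where d: "\<And>s. t2 s \<le> (vsize s + 2) ^ d"
    using p2(2) unfolding poly_bounded_def by blast
  \<comment> \<open>Bounds \<open>vsize s + 2\<close> for every loop state \<open>s\<close>: the 4
    is the two \<open>Node\<close>s of the state plus that 2.\<close>
  define m where "m = (\<lambda>x. vsize (L x) + b x + vsize x + 4)"
  have m: "poly_bounded m"
    unfolding m_def by (intro poly_bounded_intros b ptime_poly_size L)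
  have "\<exists>t z. run (Loop pc pb) (Node (L x) (Node (I x) x)) t (Node z (Node (fold (g x) (dlist (L x)) (I x)) x)) \<and>
    t \<le> Suc (length (dlist (L x))) * m x ^ c \<and> vsize z \<le> vsize (L x)" for x
  proof (rule run_fold_loop[OF pc(1) pb(1)])
    fix ys zs r
    assume *: "dlist (L x) = ys @ zs" "vsize r \<le> vsize (L x)"
    let ?s = "Node r (Node (fold (g x) ys (I x)) x)"
    have "Suc (vsize ?s) + tc ?s + tb ?s \<le> (vsize ?s + 2) ^ c"
      using c[of ?s] by simp
    also have "\<dots> \<le> m x ^ c"
      by (rule power_mono) (use bound[OF *(1)] *(2) in \<open>auto simp: m_def\<close>)
    finally show "Suc (vsize ?s) + tc ?s + tb ?s \<le> m x ^ c" .
  qed auto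
  then obtain T Z where T:
    "\<And>x. run (Loop pc pb) (Node (L x) (Node (I x) x)) (T x) (Node (Z x) (Node (fold (g x) (dlist (L x)) (I x)) x))"
    "\<And>x. T x \<le> Suc (length (dlist (L x))) * m x ^ c" "\<And>x. vsize (Z x) \<le> vsize (L x)"
    by metis
  let ?t = "\<lambda>x. t0 x + (T x + t2 (Node (Z x) (Node (fold (g x) (dlist (L x)) (I x)) x)))"
  show ?thesis
  proof (rule ptimeI)
    show "run (Seq p0 (Seq (Loop pc pb) p2)) x (?t x) (fold (g x) (dlist (L x)) (I x))" for x
      using run.seq[OF p0(1) run.seq[OF T(1) p2(1)], of x] by simp
    have "poly_bounded (\<lambda>x. t0 x + ((vsize (L x) + 1) * m x ^ c + m x ^ d))"
      by (intro poly_bounded_intros p0 m ptime_poly_size L)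
    then show "poly_bounded ?t"
    proof (rule poly_bounded_le)
      fix x
      let ?s = "Node (Z x) (Node (fold (g x) (dlist (L x)) (I x)) x)"
      have "t2 ?s \<le> (vsize ?s + 2) ^ d" by (rule d)
      also have "\<dots> \<le> m x ^ d"
        by (rule power_mono) (use bound[of x "dlist (L x)" "[]"] T(3)[of x] in \<open>auto simp: m_def\<close>)
      finally have "t2 ?s \<le> m x ^ d" .
      moreover have "T x \<le> (vsize (L x) + 1) * m x ^ c"
        by (rule le_trans[OF T(2)]) (simp add: length_dlist_le)
      ultimately show "?t x \<le> t0 x + ((vsize (L x) + 1) * m x ^ c + m x ^ d)" by simp
    qed
  qed
qed

section \<open>List operations, bounded quantifiers and tuples\<close>

lemma vsize_enc_list: "vsize (enc_list e xs) = 1 + (\<Sum>x\<leftarrow>xs. 1 + vsize (e x))"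
  by (induction xs) (auto simp: floorlog_def)

lemma sum_list_dlist_le: "(\<Sum>a\<leftarrow>dlist x. 1 + vsize a) \<le> vsize x"
  by (induction x) auto

lemma vsize_elist_le: "length l \<le> m \<Longrightarrow> (\<And>a. a \<in> set l \<Longrightarrow> vsize a \<le> n) \<Longrightarrow> vsize (elist l) \<le> 1 + m * (1 + n)"
proof -
  assume "length l \<le> m" and *: "\<And>a. a \<in> set l \<Longrightarrow> vsize a \<le> n"
  have "(\<Sum>a\<leftarrow>l. 1 + vsize a) \<le> length l * (1 + n)"
    using *
  proof (induction l)
    case (Cons a l)
    then have "vsize a \<le> n" "(\<Sum>a\<leftarrow>l. 1 + vsize a) \<le> length l * (1 + n)" by auto
    then show ?case by simp
  qed simp
  also have "\<dots> \<le> m * (1 + n)" using \<open>length l \<le> m\<close> by (rule mult_right_mono) simp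
  finally show ?thesis unfolding vsize_enc_list by simp
qed

lemma fold_Node: "fold Node xs (elist ys) = elist (rev xs @ ys)"
proof (induction xs arbitrary: ys)
  case (Cons x xs)
  from Cons[of "x # ys"] show ?case by simp
qed simp

lemma fold_Node_Atom: "fold Node xs (Atom 0) = elist (rev xs)"
  using fold_Node[of xs "[]"] by simp

lemma plist_rev_dlist: "ptime L \<Longrightarrow> plist (\<lambda>x. rev (dlist (L x)))"
proof -
  assume L: "ptime L"
  have "ptime (\<lambda>x. fold (\<lambda>a acc. Node a acc) (dlist (L x)) (Atom 0))"
  proof (rule ptime_fold[OF L ptime_const])
    show "poly_bounded (\<lambda>x. 1 + vsize (L x))"
      by (intro poly_bounded_intros ptime_poly_size L)
    show "vsize (fold Node ys (Atom 0)) \<le> 1 + vsize (L x)" if "dlist (L x) = ys @ zs" for x ys zs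
      using sum_list_dlist_le[of "L x"]
      by (simp add: that fold_Node_Atom vsize_enc_list rev_map[symmetric] del: sum_list_Suc)
  qed (intro ptime_Node ptime_vleft ptime_vright ptime_id)
  then show ?thesis unfolding plist_def fold_Node_Atom .
qed

text \<open>Not the identity: reversing twice replaces the atom that ended the list by
  \<open>Atom 0\<close>.\<close>

lemma plist_dlist: "ptime L \<Longrightarrow> plist (\<lambda>x. dlist (L x))"
  using plist_rev_dlist[OF ptime_elist[OF plist_rev_dlist]] by simp

lemma plist_fold:
  assumes "plist l" "ptime I"
    and "ptime (\<lambda>p. g (vright (vright p)) (vleft p) (vleft (vright p)))"
    and "poly_bounded b"
    and "\<And>x ys zs. l x = ys @ zs \<Longrightarrow> vsize (fold (g x) ys (I x)) \<le> b x"
  shows "ptime (\<lambda>x. fold (g x) (l x) (I x))"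
  using ptime_fold[of "\<lambda>x. elist (l x)" I g b] assms by (simp add: plist_def)

lemma poly_bounded_length: "plist l \<Longrightarrow> poly_bounded (\<lambda>x. length (l x))"
  using poly_bounded_le[OF ptime_poly_size[of "\<lambda>x. elist (l x)"]] length_dlist_le[of "elist (l _)"]
  by (simp add: plist_def)

lemma plist_append: 
  assumes k: "plist k" and l: "plist l"
  shows "plist (\<lambda>x. k x @ l x)"
proof -
  have "ptime (\<lambda>x. fold (\<lambda>a acc. Node a acc) (rev (k x)) (elist (l x)))"
  proof (rule plist_fold[OF _ ptime_elist[OF l]])
    show "plist (\<lambda>x. rev (k x))" using plist_rev_dlist[OF ptime_elist[OF k]] by simp
    show "poly_bounded (\<lambda>x. vsize (elist (k x)) + vsize (elist (l x)))"
      by (intro poly_bounded_intros ptime_poly_size ptime_elist k l)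
    show "vsize (fold Node ys (elist (l x))) \<le> vsize (elist (k x)) + vsize (elist (l x))"
      if "rev (k x) = ys @ zs" for x ys zs
    proof -
      have "k x = rev zs @ rev ys" using that by (metis rev_append rev_rev_ident)
      then show ?thesis by (simp add: fold_Node vsize_enc_list)
    qed
  qed (intro ptime_Node ptime_vleft ptime_vright ptime_id)
  then show ?thesis by (simp add: plist_def fold_Node)
qed

text \<open>A member is no larger than its list, so a polynomial bound at the pair of
  \<open>a\<close> and \<open>x\<close> becomes a bound in \<open>x\<close> alone, uniform over the
  list.\<close>

lemma poly_bounded_members:
  assumes "plist l" "ptime (\<lambda>p. f (vright p) (vleft p))"
  obtains b where "poly_bounded b" "\<And>x a. a \<in> set (l x) \<Longrightarrow> vsize (f x a) \<le> b x"
proof -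
  obtain c where c: "\<And>p. vsize (f (vright p) (vleft p)) \<le> (vsize p + 2) ^ c"
    using ptime_poly_size[OF assms(2)] unfolding poly_bounded_def by blast
  show ?thesis
  proof
    show "poly_bounded (\<lambda>x. (vsize (elist (l x)) + vsize x + 3) ^ c)"
      by (intro poly_bounded_intros ptime_poly_size ptime_elist assms(1))
    fix x a
    assume "a \<in> set (l x)"
    then have "vsize a \<le> vsize (elist (l x))" by (intro vsize_dlist_le) simp
    have "vsize (f x a) \<le> (vsize (Node a x) + 2) ^ c"
      using c[of "Node a x"] by simp
    also have "\<dots> \<le> (vsize (elist (l x)) + vsize x + 3) ^ c"
      by (rule power_mono) (use \<open>vsize a \<le> _\<close> in auto)
    finally show "vsize (f x a) \<le> (vsize (elist (l x)) + vsize x + 3) ^ c" .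
  qed
qed

lemma plist_concat_map:
  assumes l: "plist l" and f: "plist (\<lambda>p. f (vleft p) (vright p))"
  shows "plist (\<lambda>x. concat (map (\<lambda>a. f a x) (l x)))"
proof -
  obtain b where b: "poly_bounded b" "\<And>x a. a \<in> set (l x) \<Longrightarrow> vsize (elist (f a x)) \<le> b x"
    using poly_bounded_members[OF l, of "\<lambda>x a. elist (f a x)"] ptime_elist[OF f] by blast
  have eq: "fold (\<lambda>a acc. elist (f a x @ dlist acc)) ys (elist us) =
      elist (concat (map (\<lambda>a. f a x) (rev ys)) @ us)" for x ys us
    by (induction ys arbitrary: us) auto
  have "ptime (\<lambda>x. fold (\<lambda>a acc. elist (f a x @ dlist acc)) (rev (l x)) (Atom 0))"
  proof (rule plist_fold[OF _ ptime_const])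
    show "plist (\<lambda>x. rev (l x))" using plist_rev_dlist[OF ptime_elist[OF l]] by simp
    have "plist (\<lambda>p. f (vleft p) (vright (vright p)))"
      using plist_comp[OF f, of "\<lambda>p. Node (vleft p) (vright (vright p))"]
      by (simp add: ptime_Node ptime_vleft ptime_vright ptime_id)
    then show "ptime (\<lambda>p. elist (f (vleft p) (vright (vright p)) @ dlist (vleft (vright p))))"
      by (intro ptime_elist plist_append plist_dlist ptime_vleft ptime_vright ptime_id)
    show "poly_bounded (\<lambda>x. 1 + length (l x) * b x)"
      by (intro poly_bounded_intros poly_bounded_length l b)
    show "vsize (fold (\<lambda>a acc. elist (f a x @ dlist acc)) ys (Atom 0)) \<le> 1 + length (l x) * b x"
      if "rev (l x) = ys @ zs" for x ys zs
    proof -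
      have "vsize (elist (concat (map (\<lambda>a. f a x) us))) \<le> 1 + length us * b x" if "set us \<subseteq> set (l x)" for us
        using that
      proof (induction us)
        case (Cons u us)
        then show ?case using b(2)[of u x] by (simp add: vsize_enc_list)
      qed (simp add: floorlog_def)
      moreover have "set (rev ys) \<subseteq> set (l x)" "length (rev ys) \<le> length (l x)"
        using arg_cong[OF that, of set] arg_cong[OF that, of length] by auto
      ultimately have "vsize (elist (concat (map (\<lambda>a. f a x) (rev ys)))) \<le> 1 + length (rev ys) * b x"
        by blast
      also have "\<dots> \<le> 1 + length (l x) * b x"
        using \<open>length (rev ys) \<le> _\<close> by simp
      finally show ?thesis using eq[of x ys "[]"] by simp
    qed
  qed
  then show ?thesis unfolding plist_def using eq[of _ "rev (l _)" "[]"] by simp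
qed

lemma plist_Nil: "plist (\<lambda>_. [])" by (rule plist_const)

lemma plist_Cons: "ptime f \<Longrightarrow> plist l \<Longrightarrow> plist (\<lambda>x. f x # l x)"
  unfolding plist_def by (simp add: ptime_Node)

lemma plist_map:
  assumes "plist l" "ptime (\<lambda>p. f (vleft p) (vright p))"
  shows "plist (\<lambda>x. map (\<lambda>a. f a x) (l x))"
proof -
  have "plist (\<lambda>x. concat (map (\<lambda>a. [f a x]) (l x)))"
    by (intro plist_concat_map plist_Cons plist_Nil assms)
  then show ?thesis by (simp add: map_concat concat_map_singleton)
qed

lemma plist_filter:
  assumes "plist l" "pdec (\<lambda>p. P (vleft p) (vright p))"
  shows "plist (\<lambda>x. filter (\<lambda>a. P a x) (l x))"
proof -
  have "plist (\<lambda>x. concat (map (\<lambda>a. if P a x then [a] else []) (l x)))"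
    by (intro plist_concat_map plist_if plist_Cons plist_Nil assms ptime_vleft ptime_id)
  moreover have "concat (map (\<lambda>a. if P a x then [a] else []) xs) = filter (\<lambda>a. P a x) xs" for x xs
    by (induction xs) auto
  ultimately show ?thesis by simp
qed

lemma pdec_Ball:
  assumes "plist l" "pdec (\<lambda>p. P (vleft p) (vright p))"
  shows "pdec (\<lambda>x. \<forall>a \<in> set (l x). P a x)"
proof -
  have "pdec (\<lambda>x. elist (filter (\<lambda>a. \<not> P a x) (l x)) = Atom 0)"
    by (intro pdec_eq ptime_const ptime_elist plist_filter pdec_not assms)
  moreover have "elist xs = Atom 0 \<longleftrightarrow> xs = []" for xs by (cases xs) auto
  ultimately show ?thesis by (simp add: filter_empty_conv)
qed

lemma pdec_Bex:
  assumes "plist l" "pdec (\<lambda>p. P (vleft p) (vright p))"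
  shows "pdec (\<lambda>x. \<exists>a \<in> set (l x). P a x)"
  using pdec_not[OF pdec_Ball[OF assms(1) pdec_not[OF assms(2)]]] by simp

lemma pint_length:
  assumes l: "plist l"
  shows "pint (\<lambda>x. int (length (l x)))"
proof -
  have eq: "fold (\<lambda>a acc. Atom (ival acc + 1)) ys (Atom n) = Atom (n + int (length ys))" for ys n
    by (induction ys arbitrary: n) auto
  have "ptime (\<lambda>x. fold (\<lambda>a acc. Atom (ival acc + 1)) (l x) (Atom 0))"
  proof (rule plist_fold[OF l ptime_const])
    show "ptime (\<lambda>p. Atom (ival (vleft (vright p)) + 1))"
      by (intro ptime_Atom pint_add pint_ival pint_const ptime_vleft ptime_vright ptime_id)
    show "poly_bounded (\<lambda>x. length (l x) + 1)"
      by (intro poly_bounded_intros poly_bounded_length l)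
    show "vsize (fold (\<lambda>a acc. Atom (ival acc + 1)) ys (Atom 0)) \<le> length (l x) + 1"
      if "l x = ys @ zs" for x ys zs
      unfolding eq using vsize_Atom_le[of "int (length ys)"] that by (simp del: vsize.simps)
  qed
  then show ?thesis by (simp add: eq pint_def)
qed

lemma pint_prod_list:
  assumes l: "plist l" and f: "pint (\<lambda>p. f (vleft p) (vright p))"
  shows "pint (\<lambda>x. \<Prod>a\<leftarrow>l x. f a x)"
proof -
  have eq: "fold (\<lambda>a acc. Atom (f a x * ival acc)) ys (Atom n) = Atom (prod_list (map (\<lambda>a. f a x) ys) * n)" for x ys n
    by (induction ys arbitrary: n) (auto simp: mult_ac)
  obtain b where b: "poly_bounded b" "\<And>x a. a \<in> set (l x) \<Longrightarrow> vsize (Atom (f a x)) \<le> b x"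
    using poly_bounded_members[OF l, of "\<lambda>x a. Atom (f a x)"] ptime_Atom[OF f] by blast
  have "ptime (\<lambda>x. fold (\<lambda>a acc. Atom (f a x * ival acc)) (l x) (Atom 1))"
  proof (rule plist_fold[OF l ptime_const])
    have "pint (\<lambda>p. f (vleft p) (vright (vright p)))"
      using pint_comp[OF f, of "\<lambda>p. Node (vleft p) (vright (vright p))"]
      by (simp add: ptime_Node ptime_vleft ptime_vright ptime_id)
    then show "ptime (\<lambda>p. Atom (f (vleft p) (vright (vright p)) * ival (vleft (vright p))))"
      by (intro ptime_Atom pint_mult pint_ival ptime_vleft ptime_vright ptime_id)
    show "poly_bounded (\<lambda>x. 2 + length (l x) * b x)"
      by (intro poly_bounded_intros poly_bounded_length l b)
    show "vsize (fold (\<lambda>a acc. Atom (f a x * ival acc)) ys (Atom 1)) \<le> 2 + length (l x) * b x"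
      if "l x = ys @ zs" for x ys zs
    proof -
      have "vsize (Atom (\<Prod>a\<leftarrow>ys. f a x)) \<le> 2 + length ys * b x"
        using that
      proof (induction ys arbitrary: zs rule: rev_induct)
        case (snoc y ys)
        have "vsize (Atom ((\<Prod>a\<leftarrow>ys. f a x) * f y x)) \<le> vsize (Atom (\<Prod>a\<leftarrow>ys. f a x)) + vsize (Atom (f y x))"
          by (rule vsize_Atom_mult)
        moreover have "vsize (Atom (\<Prod>a\<leftarrow>ys. f a x)) \<le> 2 + length ys * b x"
          by (rule snoc.IH) (use snoc.prems in simp)
        moreover have "vsize (Atom (f y x)) \<le> b x"
          by (rule b(2)) (use snoc.prems in simp)
        ultimately show ?case by (simp del: vsize.simps)
      qed (simp add: floorlog_def)
      also have "\<dots> \<le> 2 + length (l x) * b x" using that by simp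
      finally show ?thesis unfolding eq by simp
    qed
  qed
  then show ?thesis by (simp add: eq pint_def)
qed

text \<open>Encoded lists have no random access. Attaching the index to each entry lets bounded
  quantifiers address an entry by its number.\<close>

definition indexed :: "val list \<Rightarrow> val list" where
  "indexed l = map (\<lambda>i. Node (Atom (int i)) (l ! i)) [0..<length l]"

lemma plist_indexed:
  assumes l: "plist l"
  shows "plist (\<lambda>x. indexed (l x))"
proof -
  let ?g = "\<lambda>a acc. Node (Node (Atom (int (length (dlist acc)))) a) acc"
  have eq: "fold ?g ys (Atom 0) = elist (rev (indexed ys))" for ys
  proof (induction ys rule: rev_induct)
    case (snoc y ys)
    have "indexed (ys @ [y]) = indexed ys @ [Node (Atom (int (length ys))) y]"
      by (simp add: indexed_def nth_append)
    moreover have "length (indexed ys) = length ys" by (simp add: indexed_def)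
    ultimately show ?case using snoc by simp
  qed (simp add: indexed_def)
  have "ptime (\<lambda>x. fold ?g (l x) (Atom 0))"
  proof (rule plist_fold[OF l ptime_const])
    show "ptime (\<lambda>p. ?g (vleft p) (vleft (vright p)))"
      by (intro ptime_Node ptime_Atom pint_length plist_dlist ptime_vleft ptime_vright ptime_id)
    show "poly_bounded (\<lambda>x. 1 + length (l x) * (1 + (length (l x) + vsize (elist (l x)) + 2)))"
      by (intro poly_bounded_intros poly_bounded_length l ptime_poly_size ptime_elist)
    show "vsize (fold ?g ys (Atom 0)) \<le> 1 + length (l x) * (1 + (length (l x) + vsize (elist (l x)) + 2))"
      if "l x = ys @ zs" for x ys zs
      unfolding eq
    proof (rule vsize_elist_le)
      show "length (rev (indexed ys)) \<le> length (l x)" using that by (simp add: indexed_def)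
      fix a
      assume "a \<in> set (rev (indexed ys))"
      then obtain i where i: "i < length ys" "a = Node (Atom (int i)) (ys ! i)"
        by (auto simp: indexed_def)
      have "ys ! i \<in> set (dlist (elist (l x)))" using i that by simp
      then have "vsize (ys ! i) \<le> vsize (elist (l x))" by (rule vsize_dlist_le)
      moreover have "vsize (Atom (int i)) \<le> Suc (length (l x))"
        using vsize_Atom_le[of "int i"] i that by simp
      ultimately show "vsize a \<le> length (l x) + vsize (elist (l x)) + 2"
        using i by simp
    qed
  qed
  then have "plist (\<lambda>x. rev (indexed (l x)))" unfolding eq plist_def .
  then show ?thesis using plist_rev_dlist[OF ptime_elist] by fastforce
qed

lemma in_set_indexed: "e \<in> set (indexed l) \<longleftrightarrow> (\<exists>i < length l. e = Node (Atom (int i)) (l ! i))"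
  by (auto simp: indexed_def)

lemma Ball_indexed: "(\<forall>e \<in> set (indexed l). P e) \<longleftrightarrow> (\<forall>i < length l. P (Node (Atom (int i)) (l ! i)))"
  by (auto simp: in_set_indexed)

text \<open>There are \<open>length l ^ n\<close> tuples, which is polynomial because
  \<open>n\<close> is fixed outside the program.\<close>

lemma plist_n_lists:
  assumes "plist l"
  shows "plist (\<lambda>x. map elist (List.n_lists n (l x)))"
proof (induction n)
  case 0
  show ?case using plist_const[of "[Atom 0]"] by simp
next
  case (Suc n)
  have "plist (\<lambda>x. concat (map (\<lambda>ys. map (\<lambda>y. Node y ys) (l x)) (map elist (List.n_lists n (l x)))))"
    by (intro plist_concat_map plist_map plist_comp[OF assms] Suc ptime_Node ptime_vleft ptime_vright ptime_id)
  then show ?case by (simp add: map_concat comp_def)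
qed

lemma pint_prod:
  fixes n :: nat
  assumes "\<And>i. i < n \<Longrightarrow> pint (f i)"
  shows "pint (\<lambda>x. \<Prod>i<n. f i x)"
  using assms by (induction n) (auto intro: pint_const pint_mult)

lemmas ptime_intros =
  ptime_id ptime_const ptime_vleft ptime_vright ptime_Node ptime_Atom ptime_elist ptime_if
  plist_const plist_dlist plist_Cons plist_append plist_map plist_filter plist_indexed plist_if plist_n_lists
  pint_const pint_ival pint_add pint_diff pint_mult pint_minus pint_if pint_length pint_prod_list
  pdec_const pdec_not pdec_conj pdec_disj pdec_imp pdec_if pdec_is_atom pdec_eq pdec_int_eq
  pdec_less pdec_le pdec_Ball pdec_Bex

section \<open>Depth and weft by recursion on the gates\<close>

text \<open>Replaces the quantification over all paths in \<open>weft_le\<close> and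
  \<open>depth_le\<close>. As \<open>d\<close> is a constant of the reduction, the recursion unfolds
  to a fixed nesting of bounded quantifiers, which a program can evaluate.\<close>

fun shallow :: "circuit \<Rightarrow> nat \<Rightarrow> nat \<Rightarrow> nat \<Rightarrow> bool" where
  "shallow C 0 w i \<longleftrightarrow> C ! i = Input"
| "shallow C (Suc d) w i \<longleftrightarrow> (large (C ! i) \<longrightarrow> 0 < w) \<and>
     (\<forall>j \<in> set (args (C ! i)). shallow C d (if large (C ! i) then w - 1 else w) j)"

text \<open>\<open>input_output_path\<close> with an arbitrary last gate, as induction along a path
  requires.\<close>

definition path_to :: "circuit \<Rightarrow> nat \<Rightarrow> nat list \<Rightarrow> bool" where
  "path_to C i ns \<longleftrightarrow> ns \<noteq> [] \<and> set ns \<subseteq> {..<length C} \<and>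
     C ! hd ns = Input \<and> last ns = i \<and> successively (\<lambda>j i. j \<in> set (args (C ! i))) ns"

lemma circuit_args_less: "circuit C \<Longrightarrow> i < length C \<Longrightarrow> j \<in> set (args (C ! i)) \<Longrightarrow> j < i"
  by (auto simp: circuit_def)

lemma circuit_args_nonempty:
  assumes "circuit C" "i < length C" "C ! i \<noteq> Input"
  obtains j where "j \<in> set (args (C ! i))"
proof (cases "C ! i")
  case (Neg j)
  then show ?thesis using that by simp
next
  case (And js)
  then have "js \<noteq> []" using assms by (auto simp: circuit_def)
  then show ?thesis using that And by (cases js) auto
next
  case (Or js)
  then have "js \<noteq> []" using assms by (auto simp: circuit_def)
  then show ?thesis using that Or by (cases js) auto
qed (use assms in auto)

lemma path_to_snoc:
  assumes "path_to C j ns" "j \<in> set (args (C ! i))" "i < length C"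
  shows "path_to C i (ns @ [i])"
  using assms by (auto simp: path_to_def successively_append_iff)

lemma path_to_cases:
  assumes "path_to C i ns"
  obtains "ns = [i]" "C ! i = Input"
  | j ns' where "ns = ns' @ [i]" "path_to C j ns'" "j \<in> set (args (C ! i))"
proof -
  obtain ns' where ns: "ns = ns' @ [i]"
    using assms unfolding path_to_def by (metis append_butlast_last_id)
  show ?thesis
  proof (cases "ns' = []")
    case True
    then show ?thesis using that(1) ns assms by (simp add: path_to_def)
  next
    case False
    then have "path_to C (last ns') ns'" "last ns' \<in> set (args (C ! i))"
      using assms ns by (auto simp: path_to_def successively_append_iff)
    then show ?thesis using that(2) ns by blast
  qed
qed

text \<open>Rules out that the path conditions hold vacuously at a gate where \<open>shallow\<close>
  fails.\<close>

lemma path_to_exists: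
  assumes "circuit C"
  shows "i < length C \<Longrightarrow> \<exists>ns. path_to C i ns"
proof (induction i rule: less_induct)
  case (less i)
  show ?case
  proof (cases "C ! i = Input")
    case True
    then have "path_to C i [i]" using less.prems by (simp add: path_to_def)
    then show ?thesis ..
  next
    case False
    then obtain j where j: "j \<in> set (args (C ! i))"
      using circuit_args_nonempty assms less.prems by blast
    then have "j < i" using circuit_args_less assms less.prems by blast
    then obtain ns where "path_to C j ns" using less by (meson less_trans)
    then show ?thesis using path_to_snoc j less.prems by blast
  qed
qed

lemma shallow_iff:
  assumes "circuit C" "i < length C"
  shows "shallow C d w i \<longleftrightarrow>
    (\<forall>ns. path_to C i ns \<longrightarrow> length ns - 1 \<le> d \<and> length (filter (\<lambda>i. large (C ! i)) ns) \<le> w)"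
  using assms(2)
proof (induction d arbitrary: w i)
  case 0
  show ?case
  proof
    assume *: "shallow C 0 w i"
    show "\<forall>ns. path_to C i ns \<longrightarrow> length ns - 1 \<le> 0 \<and> length (filter (\<lambda>i. large (C ! i)) ns) \<le> w"
    proof (intro allI impI)
      fix ns
      assume "path_to C i ns"
      then have "ns = [i]" using * by (cases rule: path_to_cases) auto
      then show "length ns - 1 \<le> 0 \<and> length (filter (\<lambda>i. large (C ! i)) ns) \<le> w"
        using * by (simp add: large_def)
    qed
  next
    assume *: "\<forall>ns. path_to C i ns \<longrightarrow> length ns - 1 \<le> 0 \<and> length (filter (\<lambda>i. large (C ! i)) ns) \<le> w"
    obtain ns where ns: "path_to C i ns" using path_to_exists assms(1) 0 by blast
    then show "shallow C 0 w i"
    proof (cases rule: path_to_cases)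
      case (2 j ns')
      then have "ns' \<noteq> []" by (simp add: path_to_def)
      then show ?thesis using * ns 2(1) by (cases ns') auto
    qed simp
  qed
next
  case (Suc d)
  let ?w = "if large (C ! i) then w - 1 else w"
  have less: "j < length C" if "j \<in> set (args (C ! i))" for j
    using circuit_args_less[OF assms(1) Suc.prems that] Suc.prems by simp
  show ?case
  proof
    assume *: "shallow C (Suc d) w i"
    show "\<forall>ns. path_to C i ns \<longrightarrow> length ns - 1 \<le> Suc d \<and> length (filter (\<lambda>i. large (C ! i)) ns) \<le> w"
    proof (intro allI impI)
      fix ns
      assume "path_to C i ns"
      then show "length ns - 1 \<le> Suc d \<and> length (filter (\<lambda>i. large (C ! i)) ns) \<le> w"
      proof (cases rule: path_to_cases)
        case 1
        then show ?thesis by (simp add: large_def)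
      next
        case (2 j ns')
        then have "shallow C d ?w j" using * by simp
        then have "length ns' - 1 \<le> d" "length (filter (\<lambda>i. large (C ! i)) ns') \<le> ?w"
          using Suc.IH[OF less[OF 2(3)]] 2(2) by blast+
        moreover have "large (C ! i) \<Longrightarrow> 0 < w" using * by simp
        ultimately show ?thesis using 2(1) by auto
      qed
    qed
  next
    assume *: "\<forall>ns. path_to C i ns \<longrightarrow> length ns - 1 \<le> Suc d \<and> length (filter (\<lambda>i. large (C ! i)) ns) \<le> w"
    have "0 < w" if "large (C ! i)"
    proof -
      obtain ns where "path_to C i ns" using path_to_exists assms(1) Suc.prems by blast
      moreover from this have "i \<in> set ns" by (auto simp: path_to_def)
      ultimately have "filter (\<lambda>i. large (C ! i)) ns \<noteq> []" "length (filter (\<lambda>i. large (C ! i)) ns) \<le> w"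
        using that * by (auto simp: filter_empty_conv)
      then show ?thesis by (metis gr0I le_zero_eq length_0_conv)
    qed
    moreover have "shallow C d ?w j" if j: "j \<in> set (args (C ! i))" for j
      unfolding Suc.IH[OF less[OF j]]
    proof (intro allI impI)
      fix ns
      assume ns: "path_to C j ns"
      then have "path_to C i (ns @ [i])" by (rule path_to_snoc) (use j Suc.prems in auto)
      then have "length (ns @ [i]) - 1 \<le> Suc d" "length (filter (\<lambda>i. large (C ! i)) (ns @ [i])) \<le> w"
        using * by blast+
      moreover have "ns \<noteq> []" using ns by (simp add: path_to_def)
      ultimately show "length ns - 1 \<le> d \<and> length (filter (\<lambda>i. large (C ! i)) ns) \<le> ?w" by auto
    qed
    ultimately show "shallow C (Suc d) w i" by simp
  qed
qed

lemma shallow_output_iff: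
  assumes "circuit C"
  shows "shallow C d w (length C - 1) \<longleftrightarrow> weft_le C w \<and> depth_le C d"
proof -
  have "C \<noteq> []" using assms by (simp add: circuit_def)
  then have "length C - 1 < length C" by simp
  moreover have "input_output_path C ns \<longleftrightarrow> path_to C (length C - 1) ns" for ns
    by (simp add: input_output_path_def path_to_def)
  ultimately show ?thesis
    using shallow_iff[OF assms] unfolding weft_le_def depth_le_def by (metis (no_types, lifting))
qed

section \<open>Valuations determined by the inputs\<close>

lemma gate_value_cong:
  assumes "\<And>j. j \<in> set (args g) \<Longrightarrow> v j = v' j" "g = Input \<Longrightarrow> v i = v' i"
  shows "gate_value v i g = gate_value v' i g"
  using assms by (cases g) auto

text \<open>In topological order gate \<open>m\<close> depends only on smaller gates, so a valuation
  of the first \<open>m\<close> gates extends without disturbing them.\<close>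

lemma valuation_exists:
  assumes "circuit C"
  shows "\<exists>v. valuation C v \<and> (\<forall>i < length C. C ! i = Input \<longrightarrow> v i = s i)"
proof -
  have "m \<le> length C \<Longrightarrow> \<exists>v. \<forall>i < m. v i = gate_value v i (C ! i) \<and> (C ! i = Input \<longrightarrow> v i = s i)" for m
  proof (induction m)
    case (Suc m)
    then have "m \<le> length C" by simp
    from Suc.IH[OF this] obtain v
      where *: "\<forall>i < m. v i = gate_value v i (C ! i) \<and> (C ! i = Input \<longrightarrow> v i = s i)" ..
    define v' where "v' = v(m := if C ! m = Input then s m else gate_value v m (C ! m))"
    have args: "j < i" if "j \<in> set (args (C ! i))" "i < Suc m" for i j
      using circuit_args_less[OF assms] that Suc.prems by simp
    have "v' i = gate_value v' i (C ! i) \<and> (C ! i = Input \<longrightarrow> v' i = s i)" if "i < Suc m" for i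
    proof (cases "i = m")
      case True
      show ?thesis
      proof (cases "C ! m = Input")
        case False
        then have "gate_value v m (C ! m) = gate_value v' m (C ! m)"
          by (intro gate_value_cong) (use args in \<open>auto simp: v'_def\<close>)
        then show ?thesis using True False by (simp add: v'_def)
      qed (simp add: True v'_def)
    next
      case False
      then have "i < m" using that by simp
      have "gate_value v i (C ! i) = gate_value v' i (C ! i)"
        by (rule gate_value_cong) (use args[OF _ that] \<open>i < m\<close> in \<open>fastforce simp: v'_def\<close>)+
      moreover have "v' i = v i" using False by (simp add: v'_def)
      ultimately show ?thesis using * \<open>i < m\<close> by metis
    qed
    then show ?case by blast
  qed simp
  from this[of "length C"] show ?thesis by (auto simp: valuation_def)
qed

section \<open>Refuting a circuit from partial information\<close>

text \<open>
  A set of pairs \<open>(x, c)\<close> describes a weight-\<open>k\<close> input assignment partially. For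
  \<open>0 \<le> x < k\<close> the pair says that the \<open>x\<close>-th selected input, in increasing order,
  is \<open>c\<close>; the pairs \<open>(-1, -1)\<close> and \<open>(k, length C)\<close> are always known.
  An input is known to be unselected once it lies strictly between two consecutive selected ones.
  A pair \<open>(wvar a, c)\<close> says that \<open>c\<close> is the argument that determines the large gate
  reached at address \<open>a\<close> of the binary tree obtained by unfolding the circuit from its
  output through small gates. Variables \<open>wvar a\<close> are odd and below \<open>-1\<close>, so none is
  adjacent to another variable.
\<close>

definition wvar :: "nat \<Rightarrow> int" where
  "wvar a = - 3 - 2 * int a"

text \<open>Asks only for the absence of a contradiction, so both truth values may pass under
  partial information. The test \<open>0 <= fst p\<close> excludes guesses and the left sentinel;
  the right sentinel carries \<open>length C\<close>, which is no gate number.\<close>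

definition lit :: "(int \<times> int) set \<Rightarrow> bool \<Rightarrow> nat \<Rightarrow> bool" where
  "lit I b i \<longleftrightarrow>
     (if b then \<not> (\<exists>p \<in> I. \<exists>q \<in> I. fst p + 1 = fst q \<and> snd p < int i \<and> int i < snd q)
      else \<not> (\<exists>p \<in> I. 0 \<le> fst p \<and> snd p = int i))"

text \<open>\<open>u\<close> marks a universal demand. A large existential gate is judged by its
  guess alone: a missing guess rules out nothing, whereas a guess that names no argument or a
  refuted one rules the gate out. Small gates have exactly two arguments, addressed like the
  children in a binary heap.\<close>

definition choices :: "(int \<times> int) set \<Rightarrow> bool \<Rightarrow> nat \<Rightarrow> nat list \<Rightarrow> (nat \<Rightarrow> nat \<Rightarrow> bool) \<Rightarrow> bool" where
  "choices I u a js P \<longleftrightarrow>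
     (if 2 < length js
      then if u then \<forall>j \<in> set js. P 0 j
        else \<forall>p \<in> I. fst p = wvar a \<longrightarrow> (\<exists>j \<in> set js. snd p = int j \<and> P 0 j)
      else if u then P (2 * a + 1) (js ! 0) \<and> P (2 * a + 2) (js ! 1)
        else P (2 * a + 1) (js ! 0) \<or> P (2 * a + 2) (js ! 1))"

text \<open>
  \<open>possible C I d b a i\<close>: the information \<open>I\<close> does not rule out that gate \<open>i\<close>,
  reached at address \<open>a\<close>, has the value \<open>b\<close>. Below a large gate of a circuit of weft 1
  no addresses are needed, so they are reset to 0.
\<close>

primrec possible :: "circuit \<Rightarrow> (int \<times> int) set \<Rightarrow> nat \<Rightarrow> bool \<Rightarrow> nat \<Rightarrow> nat \<Rightarrow> bool" where
  "possible C I 0 b a i = lit I b i"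
| "possible C I (Suc d) b a i =
     (case C ! i of
        Input \<Rightarrow> lit I b i
      | Neg j \<Rightarrow> possible C I d (\<not> b) (2 * a + 1) j
      | And js \<Rightarrow> choices I b a js (possible C I d b)
      | Or js \<Rightarrow> choices I (\<not> b) a js (possible C I d b))"

lemma lit_antimono: "I \<subseteq> J \<Longrightarrow> lit J b i \<Longrightarrow> lit I b i"
  unfolding lit_def by (auto split: if_splits; blast)

lemma choices_antimono:
  assumes "I \<subseteq> J" "choices J u a js P" "\<And>a j. P a j \<Longrightarrow> P' a j"
  shows "choices I u a js P'"
  using assms unfolding choices_def by (simp split: if_splits) blast+

text \<open>Knowing more can only rule out more, so refutations of several arguments can be
  united.\<close>

lemma possible_antimono:
  assumes "I \<subseteq> J"
  shows "possible C J d b a i \<Longrightarrow> possible C I d b a i"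
proof (induction d arbitrary: b a i)
  case 0
  then show ?case using lit_antimono[OF assms] by simp
next
  case (Suc d)
  then show ?case
    using lit_antimono[OF assms] choices_antimono[OF assms, of _ _ _ "possible C J d b" "possible C I d b"]
    by (cases "C ! i") auto
qed

lemma small_gate_args:
  assumes "circuit C" "i < length C" "C ! i = And js \<or> C ! i = Or js" "\<not> 2 < length js"
  shows "set js = {js ! 0, js ! 1}"
proof -
  have "length js = 2" using assms by (fastforce simp: circuit_def)
  then obtain x y where "js = [x, y]" by (metis (no_types, opaque_lifting) One_nat_def Suc_1 length_0_conv length_Suc_conv)
  then show ?thesis by auto
qed

text \<open>With weft budget 0 no gate consults a guess, so the address is arbitrary and correct
  literals suffice.\<close>

lemma possible_below_large:
  assumes "circuit C" "valuation C v"
    and "\<And>i. i < length C \<Longrightarrow> C ! i = Input \<Longrightarrow> lit G (v i) i"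
  shows "i < length C \<Longrightarrow> shallow C d 0 i \<Longrightarrow> v i = b \<Longrightarrow> possible C G d b a i"
proof (induction d arbitrary: i b a)
  case 0
  then show ?case using assms(3) by auto
next
  case (Suc d)
  have args: "j < length C" "shallow C d 0 j" if "j \<in> set (args (C ! i))" for j
    using that Suc.prems circuit_args_less[OF assms(1) Suc.prems(1) that] by auto
  have small: "\<not> large (C ! i)" using Suc.prems by auto
  have v: "v i = gate_value v i (C ! i)" using assms(2) Suc.prems(1) by (simp add: valuation_def)
  have IH: "possible C G d b a j" if "j \<in> set (args (C ! i))" "v j = b" for a j b
    using Suc.IH args that by blast
  have two: "set js = {js ! 0, js ! 1}" if "C ! i = And js \<or> C ! i = Or js" for js
    using small_gate_args[OF assms(1) Suc.prems(1) that] small that by (auto simp: large_def)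
  show ?case
  proof (cases "C ! i")
    case Input
    then show ?thesis using assms(3)[OF Suc.prems(1)] Suc.prems(3) by simp
  next
    case (Neg j)
    then show ?thesis using IH v Suc.prems(3) by auto
  next
    case (And js)
    then show ?thesis using IH v Suc.prems(3) small two[of js]
      by (auto simp: choices_def large_def)
  next
    case (Or js)
    then show ?thesis using IH v Suc.prems(3) small two[of js]
      by (auto simp: choices_def large_def)
  qed
qed

text \<open>The gate at an address, with the value that it has to take if the output is true.\<close>

function (sequential) gate_at :: "circuit \<Rightarrow> nat \<Rightarrow> nat \<times> bool" where
  "gate_at C 0 = (length C - 1, True)"
| "gate_at C (Suc m) = (case gate_at C (m div 2) of (i, b) \<Rightarrow>
     (args (C ! i) ! (m mod 2), case C ! i of Neg j \<Rightarrow> \<not> b | _ \<Rightarrow> b))"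
  by pat_completeness auto
termination by (relation "measure snd") (auto intro: le_less_trans[OF div_le_dividend])

text \<open>Correct literals and correct guesses never rule out the actual value of a gate. The
  budget 1 drops to 0 at a large gate, where \<open>possible_below_large\<close> takes over; up to
  there \<open>gate_at\<close> ties the address, and hence its guess, to one gate and one demanded
  value.\<close>

lemma possible_at:
  assumes "circuit C" "valuation C v"
    and "\<And>i. i < length C \<Longrightarrow> C ! i = Input \<Longrightarrow> lit G (v i) i"
    and "\<And>a i b c. gate_at C a = (i, b) \<Longrightarrow> i < length C \<Longrightarrow> large (C ! i) \<Longrightarrow> v i = b \<Longrightarrow> (wvar a, c) \<in> G \<Longrightarrow>
      \<exists>j \<in> set (args (C ! i)). c = int j \<and> v j = b"
  shows "i < length C \<Longrightarrow> shallow C d 1 i \<Longrightarrow> v i = b \<Longrightarrow> gate_at C a = (i, b) \<Longrightarrow> possible C G d b a i"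
proof (induction d arbitrary: i b a)
  case 0
  then show ?case using assms(3) by auto
next
  case (Suc d)
  have args: "j < length C" if "j \<in> set (args (C ! i))" for j
    using that circuit_args_less[OF assms(1) Suc.prems(1) that] Suc.prems by auto
  have v: "v i = gate_value v i (C ! i)" using assms(2) Suc.prems(1) by (simp add: valuation_def)
  \<comment> \<open>Heap numbering: the parent of address m + 1 is m div 2, and m mod 2 selects the
    argument.\<close>
  have at1: "gate_at C (2 * a + 1) = (args (C ! i) ! 0, case C ! i of Neg j \<Rightarrow> \<not> b | _ \<Rightarrow> b)"
    using Suc.prems(4) by simp
  have "(2 * a + 1) div 2 = a" "(2 * a + 1) mod 2 = 1" by simp_all
  then have "gate_at C (Suc (2 * a + 1)) = (args (C ! i) ! 1, case C ! i of Neg j \<Rightarrow> \<not> b | _ \<Rightarrow> b)"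
    using Suc.prems(4) by (simp only: gate_at.simps prod.case)
  then have at2: "gate_at C (2 * a + 2) = (args (C ! i) ! 1, case C ! i of Neg j \<Rightarrow> \<not> b | _ \<Rightarrow> b)"
    by simp
  have gate: "choices G u a js (possible C G d b)"
    if js: "C ! i = And js \<or> C ! i = Or js"
      and u: "u \<Longrightarrow> \<forall>j \<in> set js. v j = b" "\<not> u \<Longrightarrow> \<exists>j \<in> set js. v j = b" for js u
  proof (cases "2 < length js")
    case True
    then have large: "large (C ! i)" using js by (auto simp: large_def)
    then have "possible C G d b 0 j" if "j \<in> set js" "v j = b" for j
      using possible_below_large[OF assms(1-3), of j d b 0] args that js Suc.prems(2) by auto
    moreover have "\<exists>j \<in> set js. c = int j \<and> v j = b" if "(wvar a, c) \<in> G" for c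
      using assms(4)[OF Suc.prems(4,1) large Suc.prems(3) that] js by auto
    ultimately show ?thesis using True u(1) by (auto simp: choices_def) blast
  next
    case False
    have small: "\<not> large (C ! i)" using False js by (auto simp: large_def)
    have two: "set js = {js ! 0, js ! 1}" using small_gate_args[OF assms(1) Suc.prems(1) js False] .
    have sh: "j < length C" "shallow C d 1 j" if "j \<in> set js" for j
      using args that js Suc.prems(2) small by auto
    have mem: "js ! 0 \<in> set js" "js ! 1 \<in> set js" unfolding two by simp_all
    have "(case C ! i of Neg j \<Rightarrow> \<not> b | _ \<Rightarrow> b) = b" "args (C ! i) = js" using js by auto
    then have "gate_at C (2 * a + 1) = (js ! 0, b)" "gate_at C (2 * a + 2) = (js ! 1, b)"
      using at1 at2 by (simp_all only:)
    then have "v (js ! 0) = b \<Longrightarrow> possible C G d b (2 * a + 1) (js ! 0)"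
      and "v (js ! 1) = b \<Longrightarrow> possible C G d b (2 * a + 2) (js ! 1)"
      using Suc.IH sh mem by blast+
    then show ?thesis using False u two by (auto simp: choices_def)
  qed
  show ?case
  proof (cases "C ! i")
    case Input
    then show ?thesis using assms(3)[OF Suc.prems(1)] Suc.prems(3) by simp
  next
    case (Neg j)
    have "possible C G d (\<not> b) (2 * a + 1) j"
    proof (rule Suc.IH)
      show "gate_at C (2 * a + 1) = (j, \<not> b)" unfolding at1 using Neg by simp
    qed (use Neg args v Suc.prems(2,3) in \<open>auto simp: large_def\<close>)
    then show ?thesis using Neg by simp
  next
    case (And js)
    then show ?thesis using gate[of js b] v Suc.prems(3) by auto
  next
    case (Or js)
    then show ?thesis using gate[of js "\<not> b"] v Suc.prems(3) by auto
  qed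
qed

section \<open>Small refutations of a false output\<close>

text \<open>A literal is refuted by at most two neighbouring pairs. A small existential gate needs
  refutations of both arguments, a large one its guess and the refutation of one argument; 2 * r + 1
  covers both.\<close>

fun refutation_size :: "nat \<Rightarrow> nat" where
  "refutation_size 0 = 2"
| "refutation_size (Suc d) = 2 * refutation_size d + 1"

lemma two_le_refutation_size: "2 \<le> refutation_size d"
  by (induction d) auto

lemma refutation_lit:
  assumes "b \<Longrightarrow> \<exists>p \<in> G. \<exists>q \<in> G. fst p + 1 = fst q \<and> snd p < int i \<and> int i < snd q"
    and "\<not> b \<Longrightarrow> \<exists>p \<in> G. 0 \<le> fst p \<and> snd p = int i"
  shows "\<exists>I \<subseteq> G. finite I \<and> card I \<le> 2 \<and> \<not> lit I b i"
proof (cases b)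
  case True
  then obtain p q where *: "p \<in> G" "q \<in> G" "fst p + 1 = fst q" "snd p < int i" "int i < snd q"
    using assms(1) by auto
  then have "\<not> lit {p, q} b i" using True by (auto simp: lit_def)
  moreover have "card {p, q} \<le> 2" by (simp add: card_insert_if)
  ultimately show ?thesis using * by (intro exI[of _ "{p, q}"]) auto
next
  case False
  then obtain p where *: "p \<in> G" "0 \<le> fst p" "snd p = int i"
    using assms(2) by auto
  then have "\<not> lit {p} b i" using False by (auto simp: lit_def)
  then show ?thesis using * by (intro exI[of _ "{p}"]) auto
qed

text \<open>The inequality on \<open>a\<close> and \<open>d\<close> keeps all consulted addresses
  below \<open>2 ^ Suc D\<close>: a child address satisfies a' + 2 <= 2 * (a + 2), and at the root
  \<open>a = 0\<close>, \<open>d = D\<close> equality holds.\<close>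

lemma refutation:
  assumes "circuit C" "valuation C v"
    and "\<And>i. i < length C \<Longrightarrow> C ! i = Input \<Longrightarrow> \<not> v i \<Longrightarrow>
      \<exists>p \<in> G. \<exists>q \<in> G. fst p + 1 = fst q \<and> snd p < int i \<and> int i < snd q"
    and "\<And>i. i < length C \<Longrightarrow> C ! i = Input \<Longrightarrow> v i \<Longrightarrow> \<exists>p \<in> G. 0 \<le> fst p \<and> snd p = int i"
    and "\<And>a. a < 2 ^ Suc D \<Longrightarrow> \<exists>c. (wvar a, c) \<in> G"
  shows "i < length C \<Longrightarrow> shallow C d w i \<Longrightarrow> v i \<noteq> b \<Longrightarrow> (a + 2) * 2 ^ d \<le> 2 ^ Suc D \<Longrightarrow>
    \<exists>I \<subseteq> G. finite I \<and> card I \<le> refutation_size d \<and> \<not> possible C I d b a i"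
proof (induction d arbitrary: i b a w)
  case 0
  then have "C ! i = Input" by simp
  have "\<exists>I \<subseteq> G. finite I \<and> card I \<le> 2 \<and> \<not> lit I b i"
    by (rule refutation_lit) (use assms(3,4)[OF 0(1) \<open>C ! i = Input\<close>] 0 in auto)
  then show ?case by simp
next
  case (Suc d)
  let ?r = "refutation_size d"
  have args: "j < length C" if "j \<in> set (args (C ! i))" for j
    using that circuit_args_less[OF assms(1) Suc.prems(1) that] Suc.prems by auto
  have v: "v i = gate_value v i (C ! i)" using assms(2) Suc.prems(1) by (simp add: valuation_def)
  have IH: "\<exists>I \<subseteq> G. finite I \<and> card I \<le> ?r \<and> \<not> possible C I d b a' j"
    if "j \<in> set (args (C ! i))" "v j \<noteq> b" "a' = 0 \<or> a' \<le> 2 * a + 2" for j a' b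
  proof (rule Suc.IH)
    have "(a' + 2) * 2 ^ d \<le> (a + 2) * 2 ^ Suc d"
    proof -
      have "a' + 2 \<le> (a + 2) * 2" using that(3) by auto
      then have "(a' + 2) * 2 ^ d \<le> (a + 2) * 2 * 2 ^ d" by (rule mult_right_mono) simp
      then show ?thesis by (simp add: mult_ac)
    qed
    then show "(a' + 2) * 2 ^ d \<le> 2 ^ Suc D" using Suc.prems(4) by linarith
  qed (use args that Suc.prems in auto)
  have gate: "\<exists>I \<subseteq> G. finite I \<and> card I \<le> 2 * ?r + 1 \<and> \<not> choices I u a js (possible C I d b)"
    if js: "C ! i = And js \<or> C ! i = Or js"
      and u: "u \<Longrightarrow> \<exists>j \<in> set js. v j \<noteq> b" "\<not> u \<Longrightarrow> \<forall>j \<in> set js. v j \<noteq> b" for js u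
  proof -
    have args_js: "set (args (C ! i)) = set js" using js by auto
    have one: "\<exists>I \<subseteq> G. finite I \<and> card I \<le> ?r \<and> \<not> possible C I d b a' j"
      if "j \<in> set js" "v j \<noteq> b" "a' = 0 \<or> a' \<le> 2 * a + 2" for a' j
      using IH that unfolding args_js by blast
    show ?thesis
    proof (cases "2 < length js")
      case large: True
      show ?thesis
      proof (cases u)
        case True
        then obtain j where "j \<in> set js" "v j \<noteq> b" using u by blast
        then obtain I where "I \<subseteq> G" "finite I" "card I \<le> ?r" "\<not> possible C I d b 0 j"
          using one[of j 0] by blast
        then show ?thesis using large True \<open>j \<in> set js\<close> by (intro exI[of _ I]) (auto simp: choices_def)
      next
        case False
        have "(a + 2) * 1 \<le> (a + 2) * 2 ^ Suc d" by (rule mult_left_mono) auto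
        then have "(a + 2) * 1 \<le> 2 ^ Suc D" using Suc.prems(4) by (rule order_trans)
        then have "a < 2 ^ Suc D" by (simp only: mult_1_right)
        then obtain c where c: "(wvar a, c) \<in> G" using assms(5) by blast
        show ?thesis
        proof (cases "\<exists>j \<in> set js. c = int j")
          case True
          then obtain j where j: "j \<in> set js" "c = int j" by blast
          then obtain I where I: "I \<subseteq> G" "finite I" "card I \<le> ?r" "\<not> possible C I d b 0 j"
            using one[of j 0] u(2) False by blast
          \<comment> \<open>Every argument has the wrong value, in particular the guessed one; its
            refutation together with the guess refutes the gate.\<close>
          let ?I = "insert (wvar a, c) I"
          have "\<not> possible C ?I d b 0 j" using I(4) possible_antimono[of I ?I] by blast
          then have "\<not> choices ?I u a js (possible C ?I d b)"
            using large False j by (auto simp: choices_def)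
          moreover have "card ?I \<le> 2 * ?r + 1" using I by (simp add: card_insert_if)
          ultimately show ?thesis using I c by (intro exI[of _ ?I]) auto
        next
          \<comment> \<open>A guess that names no argument refutes the gate by itself.\<close>
          case no: False
          then have "\<not> choices {(wvar a, c)} u a js (possible C {(wvar a, c)} d b)"
            using large False by (auto simp: choices_def)
          then show ?thesis using c by (intro exI[of _ "{(wvar a, c)}"]) auto
        qed
      qed
    next
      case small: False
      have two: "set js = {js ! 0, js ! 1}" using small_gate_args[OF assms(1) Suc.prems(1) js small] .
      then have mem: "js ! 0 \<in> set js" "js ! 1 \<in> set js" by blast+
      have 1: "\<exists>I \<subseteq> G. finite I \<and> card I \<le> ?r \<and> \<not> possible C I d b (2 * a + 1) (js ! 0)"
        if "v (js ! 0) \<noteq> b" by (rule one) (use mem that in auto)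
      have 2: "\<exists>I \<subseteq> G. finite I \<and> card I \<le> ?r \<and> \<not> possible C I d b (2 * a + 2) (js ! 1)"
        if "v (js ! 1) \<noteq> b" by (rule one) (use mem that in auto)
      show ?thesis
      proof (cases u)
        case True
        then have "v (js ! 0) \<noteq> b \<or> v (js ! 1) \<noteq> b" using u two by auto
        then have "\<exists>I \<subseteq> G. finite I \<and> card I \<le> ?r \<and>
            \<not> (possible C I d b (2 * a + 1) (js ! 0) \<and> possible C I d b (2 * a + 2) (js ! 1))"
          using 1 2 by blast
        then show ?thesis using small True by (fastforce simp: choices_def)
      next
        case False
        then have "v (js ! 0) \<noteq> b" "v (js ! 1) \<noteq> b" using u(2) two by auto
        then obtain I J where I: "I \<subseteq> G" "finite I" "card I \<le> ?r" "\<not> possible C I d b (2 * a + 1) (js ! 0)"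
          and J: "J \<subseteq> G" "finite J" "card J \<le> ?r" "\<not> possible C J d b (2 * a + 2) (js ! 1)"
          using 1 2 by blast
        \<comment> \<open>Both arguments of a small existential gate must be ruled out at once; this
          is where the size doubles.\<close>
        have "\<not> choices (I \<union> J) u a js (possible C (I \<union> J) d b)"
          using I(4) J(4) possible_antimono[of I "I \<union> J"] possible_antimono[of J "I \<union> J"] small False
          by (auto simp: choices_def)
        moreover have "card (I \<union> J) \<le> 2 * ?r + 1"
          using card_Un_le[of I J] I J by linarith
        ultimately show ?thesis using I J by (intro exI[of _ "I \<union> J"]) auto
      qed
  qed
  qed
  show ?case
  proof (cases "C ! i")
    case Input
    have "\<exists>I \<subseteq> G. finite I \<and> card I \<le> 2 \<and> \<not> lit I b i"
      by (rule refutation_lit) (use assms(3,4)[OF Suc.prems(1) Input] Suc.prems in auto)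
    then obtain I where I: "I \<subseteq> G" "finite I" "card I \<le> 2" "\<not> lit I b i" by blast
    then have "card I \<le> refutation_size (Suc d)" using two_le_refutation_size[of "Suc d"] by linarith
    then show ?thesis using I Input by (intro exI[of _ I]) simp
  next
    case (Neg j)
    then have "j \<in> set (args (C ! i))" "v j \<noteq> (\<not> b)" using v Suc.prems(3) by auto
    then obtain I where I: "I \<subseteq> G" "finite I" "card I \<le> ?r" "\<not> possible C I d (\<not> b) (2 * a + 1) j"
      using IH[of j "\<not> b" "2 * a + 1"] by auto
    then show ?thesis using Neg by (intro exI[of _ I]) simp
  next
    case (And js)
    then have "b \<Longrightarrow> \<exists>j \<in> set js. v j \<noteq> b" "\<not> b \<Longrightarrow> \<forall>j \<in> set js. v j \<noteq> b"
      using v Suc.prems(3) by auto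
    then show ?thesis using gate[of js b] And by simp
  next
    case (Or js)
    then have "\<not> b \<Longrightarrow> \<exists>j \<in> set js. v j \<noteq> b" "\<not> \<not> b \<Longrightarrow> \<forall>j \<in> set js. v j \<noteq> b"
      using v Suc.prems(3) by auto
    then show ?thesis using gate[of js "\<not> b"] Or by simp
  qed
qed

section \<open>Satisfiability as a local constraint problem\<close>

text \<open>A binary tree of depth \<open>d\<close> has heap addresses below
  \<open>2 ^ Suc d\<close>. The list is nonempty even for \<open>k = 0\<close>:
  \<open>wvar 0\<close> always belongs to it and later serves as padding and as reference
  variable.\<close>

definition variables :: "nat \<Rightarrow> nat \<Rightarrow> int list" where
  "variables d k = map wvar [0..<2 ^ Suc d] @ map int [0..<k]"

text \<open>With them, inputs before the first or after the last selected one also lie between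
  consecutive positions; for \<open>k = 0\<close> the two sentinels are themselves adjacent.\<close>

definition sentinels :: "circuit \<Rightarrow> nat \<Rightarrow> (int \<times> int) set" where
  "sentinels C k = {(-1, -1), (int k, int (length C))}"

text \<open>Strict increase forces the selected inputs to be distinct, so that the weight is exactly
  \<open>k\<close>.\<close>

definition locally_consistent :: "circuit \<Rightarrow> nat \<Rightarrow> nat \<Rightarrow> (int \<times> int) set \<Rightarrow> bool" where
  "locally_consistent C k d I \<longleftrightarrow>
     (\<forall>p \<in> I \<union> sentinels C k. \<forall>q \<in> I \<union> sentinels C k. fst p + 1 = fst q \<longrightarrow> snd p < snd q) \<and>
     (\<forall>p \<in> I. 0 \<le> fst p \<longrightarrow> C ! nat (snd p) = Input) \<and>
     possible C (I \<union> sentinels C k) d True 0 (length C - 1)"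

lemma locally_consistent_antimono:
  assumes "locally_consistent C k d J" "I \<subseteq> J"
  shows "locally_consistent C k d I"
proof -
  have "possible C (I \<union> sentinels C k) d True 0 (length C - 1)"
    using possible_antimono[of "I \<union> sentinels C k" "J \<union> sentinels C k"] assms
    unfolding locally_consistent_def by blast
  then show ?thesis using assms unfolding locally_consistent_def by blast
qed

lemma distinct_variables: "distinct (variables d k)"
  by (auto simp: variables_def distinct_map wvar_def inj_on_def)

lemma position_variable: "0 \<le> x \<Longrightarrow> x < int k \<Longrightarrow> x \<in> set (variables d k)"
proof -
  assume "0 \<le> x" "x < int k"
  then have "x \<in> int ` {0..<k}" by (intro image_eqI[of _ _ "nat x"]) auto
  then show ?thesis by (simp add: variables_def)
qed

lemma wvar_neq: "wvar a \<noteq> int m" "int m \<noteq> wvar a" "wvar a < 0" "wvar a = wvar b \<longleftrightarrow> a = b"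
  "wvar a + 1 \<noteq> wvar b" "wvar a + 1 \<noteq> int m" "wvar a + 1 \<noteq> -1" "-1 \<noteq> wvar a" "wvar a \<noteq> -1"
  by (auto simp: wvar_def; presburger)+

lemma consecutive_strict_mono:
  fixes e :: "int \<Rightarrow> int"
  assumes "\<And>x. l \<le> x \<Longrightarrow> x < h \<Longrightarrow> e x < e (x + 1)" "l \<le> x" "x < y" "y \<le> h"
  shows "e x < e y"
  using assms(3,4)
proof (induction y rule: int_gr_induct)
  case base
  then show ?case using assms(1,2) by simp
next
  case (step y)
  then show ?case using assms(1)[of y] assms(2) by fastforce
qed

text \<open>\<open>u\<close> extended by the sentinel values, so that all k + 1 gaps between
  neighbours from -1 to \<open>k\<close> are treated alike.\<close>

definition positions :: "circuit \<Rightarrow> nat \<Rightarrow> (int \<Rightarrow> int) \<Rightarrow> int \<Rightarrow> int" where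
  "positions C k u x = (if x < 0 then -1 else if x < int k then u x else int (length C))"

definition total_information :: "circuit \<Rightarrow> nat \<Rightarrow> nat \<Rightarrow> (int \<Rightarrow> int) \<Rightarrow> (int \<times> int) set" where
  "total_information C k d u = (\<lambda>x. (x, u x)) ` set (variables d k) \<union> sentinels C k"

lemma total_information_cases:
  assumes "p \<in> total_information C k d u"
  obtains a where "p = (wvar a, u (wvar a))" "a < 2 ^ Suc d"
  | x where "p = (x, positions C k u x)" "-1 \<le> x" "x \<le> int k"
  using assms unfolding total_information_def sentinels_def variables_def positions_def by fastforce

lemma position_in_total_information:
  "-1 \<le> x \<Longrightarrow> x \<le> int k \<Longrightarrow> (x, positions C k u x) \<in> total_information C k d u"
proof -
  assume x: "-1 \<le> x" "x \<le> int k"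
  consider "x = -1" | "x = int k" | "0 \<le> x" "x < int k" using x by linarith
  then show ?thesis
  proof cases
    case 3
    then have "x \<in> set (variables d k)" by (rule position_variable)
    then show ?thesis using 3 by (auto simp: total_information_def positions_def)
  qed (auto simp: total_information_def positions_def sentinels_def)
qed

text \<open>The selected inputs in sorted order and truthful guesses form information that is
  consistent as a whole, hence on every subset.\<close>

lemma locally_consistent_of_satisfying:
  assumes C: "circuit C" and sh: "shallow C d 1 (length C - 1)"
    and sat: "satisfiable_with_weight C k"
  obtains u where "\<And>x. x \<in> set (variables d k) \<Longrightarrow> 0 \<le> u x \<and> u x < int (length C)"
    and "locally_consistent C k d ((\<lambda>x. (x, u x)) ` set (variables d k))"
proof -
  obtain v where v: "valuation C v" "v (length C - 1)" "weight C v = k"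
    using sat unfolding satisfiable_with_weight_def by blast
  have n: "length C - 1 < length C" using C by (simp add: circuit_def)
  define S where "S = {i. i < length C \<and> C ! i = Input \<and> v i}"
  define sl where "sl = sorted_list_of_set S"
  have "finite S" by (simp add: S_def)
  then have sl: "set sl = S" "sorted_wrt (<) sl" "length sl = k"
    using v(3) by (simp_all add: sl_def weight_def S_def)
  \<comment> \<open>The arguments that justify the value demanded at address
    \<open>a\<close>.\<close>
  define good where "good = (\<lambda>a j. case gate_at C a of (i, b) \<Rightarrow> j \<in> set (args (C ! i)) \<and> v j = b \<and> j < length C)"
  \<comment> \<open>For negative \<open>x\<close>, \<open>(-3 - x) div 2\<close> inverts
    \<open>wvar\<close>. The default 0 keeps guesses without a justifying argument in range, since
    the circuit is nonempty.\<close>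
  define u where "u = (\<lambda>x. if 0 \<le> x then int (sl ! nat x)
    else let a = nat ((-3 - x) div 2) in if \<exists>j. good a j then int (SOME j. good a j) else 0)"
  have u_wvar: "u (wvar a) = (if \<exists>j. good a j then int (SOME j. good a j) else 0)" for a
    by (simp add: u_def wvar_def Let_def)
  have range: "0 \<le> u x \<and> u x < int (length C)" if x: "x \<in> set (variables d k)" for x
  proof (cases "0 \<le> x")
    case True
    then have "nat x < length sl" using x sl wvar_neq(3) by (auto simp: variables_def) (metis not_le)
    then have "sl ! nat x \<in> S" using sl(1) nth_mem by blast
    then show ?thesis using True by (simp add: u_def S_def)
  next
    case False
    then obtain a where a: "x = wvar a" using x by (auto simp: variables_def)
    have "(SOME j. good a j) < length C" if "\<exists>j. good a j"
      using someI_ex[OF that] by (auto simp: good_def)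
    then show ?thesis using n unfolding a u_wvar by auto
  qed
  let ?e = "positions C k u"
  let ?G = "total_information C k d u"
  have in_S: "nat (?e x) \<in> S \<and> ?e x = int (sl ! nat x)" if "0 \<le> x" "x < int k" for x
  proof -
    have "sl ! nat x \<in> S" using that sl by (metis nat_less_iff nth_mem)
    then show ?thesis using that by (simp add: positions_def u_def)
  qed
  have mono: "?e x < ?e y" if "-1 \<le> x" "x < y" "y \<le> int k" for x y
  proof (rule consecutive_strict_mono[OF _ that])
    fix x :: int
    assume x: "-1 \<le> x" "x < int k"
    have "sl ! nat x < sl ! nat (x + 1)" if "0 \<le> x" "x + 1 < int k"
      using sl(2,3) that by (auto simp: sorted_wrt_iff_nth_less)
    then show "?e x < ?e (x + 1)"
      using x in_S[of x] by (auto simp: positions_def u_def S_def)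
  qed
  \<comment> \<open>Guess variables are odd and below -1, hence adjacent neither to each other nor
    to a position, so adjacent pairs are always neighbouring positions.\<close>
  have adjacent: "\<exists>x. p = (x, ?e x) \<and> q = (x + 1, ?e (x + 1)) \<and> -1 \<le> x \<and> x < int k"
    if "p \<in> ?G" "q \<in> ?G" "fst p + 1 = fst q" for p q
    using that(1)
  proof (cases rule: total_information_cases)
    case (1 a)
    from that(2) show ?thesis
    proof (cases rule: total_information_cases)
      case (1 b)
      then show ?thesis using that(3) \<open>p = _\<close> by (auto simp: wvar_neq)
    next
      case (2 x)
      then show ?thesis using that(3) \<open>p = _\<close> by (auto simp: wvar_def)
    qed
  next
    case (2 x)
    from that(2) show ?thesis
    proof (cases rule: total_information_cases)
      case (1 b)
      then show ?thesis using that(3) 2 wvar_neq(3)[of b] by (auto simp: wvar_def)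
    next
      case (2 y)
      then show ?thesis using that(3) \<open>p = _\<close> \<open>-1 \<le> x\<close> by auto
    qed
  qed
  have S_pos: "\<exists>m < k. i = sl ! m" if "i \<in> S" for i
    using that sl by (metis in_set_conv_nth)
  have lit: "lit ?G (v i) i" if i: "i < length C" "C ! i = Input" for i
  proof (cases "v i")
    case True
    then obtain m where m: "m < k" "i = sl ! m" using S_pos[of i] i by (auto simp: S_def)
    then have e: "int i = ?e (int m)" by (simp add: positions_def u_def)
    have "False" if pq: "p \<in> ?G" "q \<in> ?G" "fst p + 1 = fst q" "snd p < int i" "int i < snd q" for p q
    proof -
      obtain x where x: "p = (x, ?e x)" "q = (x + 1, ?e (x + 1))" "-1 \<le> x" "x < int k"
        using adjacent[OF pq(1-3)] by blast
      have "x < int m"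
      proof (rule ccontr)
        assume "\<not> x < int m"
        then have "int m = x \<or> ?e (int m) < ?e x" using mono[of "int m" x] x(4) by force
        then show False using pq(4) x(1) e by auto
      qed
      moreover have "int m < x + 1"
      proof (rule ccontr)
        assume "\<not> int m < x + 1"
        then have "int m = x + 1 \<or> ?e (x + 1) < ?e (int m)" using mono[of "x + 1" "int m"] x(3) m(1) by force
        then show False using pq(5) x(2) e by auto
      qed
      ultimately show False by simp
    qed
    then show ?thesis using True by (auto simp: lit_def)
  next
    case False
    have "snd p \<noteq> int i" if "p \<in> ?G" "0 \<le> fst p" for p
      using that(1)
    proof (cases rule: total_information_cases)
      case (1 a)
      then show ?thesis using that(2) wvar_neq(3)[of a] by simp
    next
      case (2 x)
      show ?thesis
      proof (cases "x < int k")
        case True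
        moreover have "0 \<le> x" using 2 that(2) by simp
        ultimately have "nat (?e x) \<in> S" using in_S[of x] by blast
        then show ?thesis using False 2 by (auto simp: S_def)
      next
        case False
        then show ?thesis using 2 that(2) i by (simp add: positions_def)
      qed
    qed
    then show ?thesis using False by (auto simp: lit_def)
  qed
  have witness: "\<exists>j \<in> set (args (C ! i)). c = int j \<and> v j = b"
    if at: "gate_at C a = (i, b)" "i < length C" "large (C ! i)" "v i = b" "(wvar a, c) \<in> ?G" for a i b c
  proof -
    have vi: "v i = gate_value v i (C ! i)" using v(1) at(2) by (simp add: valuation_def)
    have "\<exists>j \<in> set (args (C ! i)). v j = b"
    proof -
      have nonempty: "\<exists>j. j \<in> set (args (C ! i))" using at(3) by (cases "args (C ! i)") (auto simp: large_def)
      show ?thesis using vi at(3,4) nonempty by (cases "C ! i") (auto simp: large_def)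
    qed
    then obtain j where "good a j" using at(1,2) circuit_args_less[OF C at(2)] by (force simp: good_def)
    then have "good a (SOME j. good a j)" "u (wvar a) = int (SOME j. good a j)"
      unfolding u_wvar by (auto intro: someI)
    moreover have "c = u (wvar a)"
      using at(5)
    proof (cases rule: total_information_cases)
      case (1 b)
      then show ?thesis by (simp add: wvar_neq)
    next
      case (2 x)
      then show ?thesis using wvar_neq(3)[of a] by (auto simp: wvar_def)
    qed
    ultimately show ?thesis using at(1) by (auto simp: good_def)
  qed
  have "possible C ?G d True 0 (length C - 1)"
    by (rule possible_at[OF C v(1) lit witness n sh]) (use v(2) in auto)
  moreover have "snd p < snd q" if "p \<in> ?G" "q \<in> ?G" "fst p + 1 = fst q" for p q
    using adjacent[OF that] mono by fastforce
  moreover have "C ! nat (u x) = Input" if "x \<in> set (variables d k)" "0 \<le> x" for x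
  proof -
    have "x < int k" using that wvar_neq(3) by (auto simp: variables_def) (metis not_le)
    then have "nat (?e x) \<in> S" "?e x = u x" using in_S[OF that(2)] that(2) by (auto simp: positions_def)
    then show ?thesis by (simp add: S_def)
  qed
  ultimately have "locally_consistent C k d ((\<lambda>x. (x, u x)) ` set (variables d k))"
    unfolding locally_consistent_def total_information_def[symmetric] by auto
  then show ?thesis using that range by blast
qed

text \<open>Consistency on one and two variables already yields \<open>k\<close> increasing input
  gates. Were the output false for them, a refutation would involve at most
  \<open>refutation_size d\<close> variables, against consistency there.\<close>

lemma satisfying_of_locally_consistent:
  assumes C: "circuit C" and sh: "shallow C d 1 (length C - 1)"
    and range: "\<And>x. x \<in> set (variables d k) \<Longrightarrow> 0 \<le> u x \<and> u x < int (length C)"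
    and local: "\<And>X. X \<subseteq> set (variables d k) \<Longrightarrow> card X \<le> refutation_size d \<Longrightarrow>
      locally_consistent C k d ((\<lambda>x. (x, u x)) ` X)"
  shows "satisfiable_with_weight C k"
proof -
  let ?e = "positions C k u"
  let ?G = "total_information C k d u"
  have n: "length C - 1 < length C" using C by (simp add: circuit_def)
  have var: "x \<in> set (variables d k)" if "0 \<le> x" "x < int k" for x
    using that by (rule position_variable)
  have step: "?e x < ?e (x + 1)" if x: "-1 \<le> x" "x < int k" for x
  proof -
    \<comment> \<open>The intersection drops -1 and \<open>k\<close>, whose values come from the
      sentinels instead.\<close>
    let ?X = "{x, x + 1} \<inter> set (variables d k)"
    have "card ?X \<le> card {x, x + 1}" by (rule card_mono) auto
    then have "locally_consistent C k d ((\<lambda>x. (x, u x)) ` ?X)"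
      using two_le_refutation_size[of d] by (intro local) (auto simp: card_insert_if)
    then have *: "\<forall>p \<in> (\<lambda>x. (x, u x)) ` ?X \<union> sentinels C k. \<forall>q \<in> (\<lambda>x. (x, u x)) ` ?X \<union> sentinels C k.
        fst p + 1 = fst q \<longrightarrow> snd p < snd q"
      unfolding locally_consistent_def by blast
    have mem: "(y, ?e y) \<in> (\<lambda>x. (x, u x)) ` ?X \<union> sentinels C k" if "y \<in> {x, x + 1}" for y
      using that x var[of y] by (force simp: positions_def sentinels_def)
    show ?thesis using bspec[OF bspec[OF * mem[of x]] mem[of "x + 1"]] by simp
  qed
  have mono: "?e x < ?e y" if "-1 \<le> x" "x < y" "y \<le> int k" for x y
    by (rule consecutive_strict_mono[OF _ that]) (rule step)
  define S where "S = (\<lambda>x. nat (?e x)) ` {0..<int k}"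
  have e_range: "0 \<le> ?e x" "?e x < int (length C)" if "0 \<le> x" "x < int k" for x
    using range[OF var[OF that]] that by (auto simp: positions_def)
  have "inj_on (\<lambda>x. nat (?e x)) {0..<int k}"
  proof (rule linorder_inj_onI)
    fix x y
    assume "x < y" "x \<in> {0..<int k}" "y \<in> {0..<int k}"
    then show "nat (?e x) \<noteq> nat (?e y)" using mono[of x y] e_range(1)[of x] by auto
  qed auto
  then have card_S: "card S = k" by (simp add: S_def card_image)
  have input: "C ! nat (?e x) = Input" if "0 \<le> x" "x < int k" for x
  proof -
    have "locally_consistent C k d ((\<lambda>x. (x, u x)) ` {x})"
      using var[OF that] two_le_refutation_size[of d] by (intro local) auto
    then show ?thesis using that by (auto simp: locally_consistent_def positions_def)
  qed
  have S_Input: "i < length C \<and> C ! i = Input" if "i \<in> S" for i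
    using that input e_range by (force simp: S_def nat_less_iff)
  obtain v where v: "valuation C v" "\<And>i. i < length C \<Longrightarrow> C ! i = Input \<Longrightarrow> v i = (i \<in> S)"
    using valuation_exists[OF C, of "\<lambda>i. i \<in> S"] by blast
  have "{i. i < length C \<and> C ! i = Input \<and> v i} = S"
    using v(2) S_Input by blast
  then have "weight C v = k" using card_S by (simp add: weight_def)
  moreover have "v (length C - 1)"
  proof (rule ccontr)
    assume "\<not> v (length C - 1)"
    have "\<exists>I \<subseteq> ?G. finite I \<and> card I \<le> refutation_size d \<and> \<not> possible C I d True 0 (length C - 1)"
    proof (rule refutation[OF C v(1) _ _ _ n sh])
      fix i
      assume i: "i < length C" "C ! i = Input" "\<not> v i"
      then have "i \<notin> S" using v(2) by simp
      \<comment> \<open>The first position at or beyond \<open>i\<close>. It lies strictly beyond,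
        as \<open>i\<close> is unselected, and its predecessor lies strictly before
        \<open>i\<close>; these two pairs certify that \<open>i\<close> is unselected.\<close>
      define m where "m = (LEAST m. int i \<le> ?e (int m))"
      have k: "int i \<le> ?e (int k)" using i(1) by (simp add: positions_def)
      have m: "int i \<le> ?e (int m)" unfolding m_def by (rule LeastI[of _ k]) (rule k)
      have "m \<le> k" unfolding m_def by (rule Least_le) (rule k)
      have "?e (int m - 1) < int i"
      proof (cases m)
        case 0
        then show ?thesis by (simp add: positions_def)
      next
        case (Suc m')
        then have "\<not> int i \<le> ?e (int m')" using not_less_Least[of m' "\<lambda>m. int i \<le> ?e (int m)"] m_def by simp
        then show ?thesis using Suc by simp
      qed
      moreover have "int i < ?e (int m)"
      proof (cases "m < k")
        case True
        then have "nat (?e (int m)) \<in> S" by (simp add: S_def)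
        then have "int i \<noteq> ?e (int m)" using \<open>i \<notin> S\<close> by (metis nat_int)
        then show ?thesis using m by simp
      next
        case False
        then show ?thesis using \<open>m \<le> k\<close> i(1) by (simp add: positions_def)
      qed
      moreover have "(int m - 1, ?e (int m - 1)) \<in> ?G" "(int m, ?e (int m)) \<in> ?G"
        using \<open>m \<le> k\<close> by (auto intro!: position_in_total_information)
      ultimately show "\<exists>p \<in> ?G. \<exists>q \<in> ?G. fst p + 1 = fst q \<and> snd p < int i \<and> int i < snd q"
        by (intro bexI[of _ "(int m - 1, ?e (int m - 1))"] bexI[of _ "(int m, ?e (int m))"]) auto
    next
      fix i
      assume i: "i < length C" "C ! i = Input" "v i"
      then have "i \<in> S" using v(2) by simp
      then obtain x where x: "0 \<le> x" "x < int k" "i = nat (?e x)" by (auto simp: S_def)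
      then have "(x, int i) \<in> ?G"
        using position_in_total_information[of x k C u d] e_range(1)[of x] by simp
      then show "\<exists>p \<in> ?G. 0 \<le> fst p \<and> snd p = int i" using x(1) by force
    next
      fix a :: nat
      assume "a < 2 ^ Suc d"
      then have "wvar a \<in> set (variables d k)" by (simp add: variables_def)
      then show "\<exists>c. (wvar a, c) \<in> ?G" by (auto simp: total_information_def)
    qed (use \<open>\<not> v (length C - 1)\<close> in auto)
    then obtain I where I: "I \<subseteq> ?G" "finite I" "card I \<le> refutation_size d"
      "\<not> possible C I d True 0 (length C - 1)" by blast
    \<comment> \<open>The sentinels in \<open>I\<close> are known anyway, so only its genuine
      variables count towards the size.\<close>
    let ?X = "fst ` I \<inter> set (variables d k)"
    have "card ?X \<le> card (fst ` I)" by (rule card_mono) (use I(2) in auto)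
    also have "\<dots> \<le> card I" by (rule card_image_le[OF I(2)])
    finally have "locally_consistent C k d ((\<lambda>x. (x, u x)) ` ?X)"
      using I(3) by (intro local) auto
    then have "possible C ((\<lambda>x. (x, u x)) ` ?X \<union> sentinels C k) d True 0 (length C - 1)"
      by (simp add: locally_consistent_def)
    moreover have "I \<subseteq> (\<lambda>x. (x, u x)) ` ?X \<union> sentinels C k"
    proof
      fix p
      assume "p \<in> I"
      then have "p \<in> sentinels C k \<or> (\<exists>x \<in> set (variables d k). p = (x, u x))"
        using I(1) by (auto simp: total_information_def)
      then show "p \<in> (\<lambda>x. (x, u x)) ` ?X \<union> sentinels C k"
        using \<open>p \<in> I\<close> by force
    qed
    ultimately show False using possible_antimono I(4) by blast
  qed
  ultimately show ?thesis using v(1) unfolding satisfiable_with_weight_def by blast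
qed

lemma satisfiable_iff_tuples:
  assumes C: "circuit C" and sh: "shallow C d 1 (length C - 1)"
  shows "satisfiable_with_weight C k \<longleftrightarrow>
    (\<exists>u. (\<forall>x \<in> set (variables d k). u x \<in> {0..<int (length C)}) \<and>
      (\<forall>xs \<in> set (List.n_lists (refutation_size d) (variables d k)).
        locally_consistent C k d (set (map (\<lambda>x. (x, u x)) xs))))" (is "?L \<longleftrightarrow> ?R")
proof
  assume ?L
  then obtain u where u: "\<And>x. x \<in> set (variables d k) \<Longrightarrow> 0 \<le> u x \<and> u x < int (length C)"
    "locally_consistent C k d ((\<lambda>x. (x, u x)) ` set (variables d k))"
    using locally_consistent_of_satisfying[OF C sh] by blast
  have "locally_consistent C k d (set (map (\<lambda>x. (x, u x)) xs))"
    if "xs \<in> set (List.n_lists (refutation_size d) (variables d k))" for xs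
    by (rule locally_consistent_antimono[OF u(2)]) (use that in \<open>auto simp: set_n_lists\<close>)
  then show ?R using u(1) by auto
next
  assume ?R
  then obtain u where u: "\<And>x. x \<in> set (variables d k) \<Longrightarrow> 0 \<le> u x \<and> u x < int (length C)"
    "\<And>xs. xs \<in> set (List.n_lists (refutation_size d) (variables d k)) \<Longrightarrow>
        locally_consistent C k d (set (map (\<lambda>x. (x, u x)) xs))" by auto
  show ?L
  proof (rule satisfying_of_locally_consistent[OF C sh u(1)])
    fix X
    assume X: "X \<subseteq> set (variables d k)" "card X \<le> refutation_size d"
    have fin: "finite X" using X(1) finite_subset by blast
    obtain ys where ys: "set ys = X" "length ys = card X" using finite_distinct_list[OF fin] distinct_card by metis
    \<comment> \<open>Tuples have fixed length, so a smaller set is padded; the additional variable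
      is harmless by antimonotonicity.\<close>
    define xs where "xs = ys @ replicate (refutation_size d - card X) (wvar 0)"
    have "wvar 0 \<in> set (variables d k)" by (auto simp: variables_def)
    then have "xs \<in> set (List.n_lists (refutation_size d) (variables d k))"
      using X ys by (auto simp: set_n_lists xs_def)
    from locally_consistent_antimono[OF u(2)[OF this]]
    show "locally_consistent C k d ((\<lambda>x. (x, u x)) ` X)" using ys by (auto simp: xs_def)
  qed
qed

section \<open>From constraints to products\<close>

text \<open>Moving negative exponents to the other side gives an equation of integers. A base with
  positive exponent would divide one side and be coprime to the other; applying this to the
  exponents and to their negatives leaves only zero.\<close>

lemma prod_powi_eq_1_iff:
  fixes \<beta> :: "'i \<Rightarrow> int" and e :: "'i \<Rightarrow> int"
  assumes "finite J" and gt: "\<And>i. i \<in> J \<Longrightarrow> 1 < \<beta> i"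
    and coprime: "\<And>i j. i \<in> J \<Longrightarrow> j \<in> J \<Longrightarrow> i \<noteq> j \<Longrightarrow> coprime (\<beta> i) (\<beta> j)"
  shows "(\<Prod>i\<in>J. (of_int (\<beta> i) :: rat) powi e i) = 1 \<longleftrightarrow> (\<forall>i \<in> J. e i = 0)"
proof
  assume eq: "(\<Prod>i\<in>J. (of_int (\<beta> i) :: rat) powi e i) = 1"
  define a where "a = (\<Prod>i\<in>J. \<beta> i ^ nat (e i))"
  define b where "b = (\<Prod>i\<in>J. \<beta> i ^ nat (- e i))"
  have "(of_int (\<beta> i) :: rat) powi e i = of_int (\<beta> i ^ nat (e i)) / of_int (\<beta> i ^ nat (- e i))" for i
    by (cases "0 \<le> e i") (simp_all add: power_int_def field_simps)
  then have "(of_int a :: rat) / of_int b = 1"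
    using eq by (simp add: a_def b_def prod_dividef)
  then have "(of_int a :: rat) = of_int b" by (simp add: divide_eq_1_iff)
  then have ab: "a = b" by simp
  have no_pos: "\<not> 0 < s i"
    if i: "i \<in> J" and s: "(\<Prod>i\<in>J. \<beta> i ^ nat (s i)) = (\<Prod>i\<in>J. \<beta> i ^ nat (- s i))" for i and s :: "'i \<Rightarrow> int"
  proof
    assume pos: "0 < s i"
    have "\<beta> i dvd \<beta> i ^ nat (s i)" using pos by (intro dvd_power) auto
    also have "\<dots> dvd (\<Prod>i\<in>J. \<beta> i ^ nat (s i))" by (rule dvd_prodI[OF assms(1) i])
    finally have dvd: "\<beta> i dvd (\<Prod>i\<in>J. \<beta> i ^ nat (- s i))" using s by simp
    have "coprime (\<beta> i) (\<Prod>i\<in>J. \<beta> i ^ nat (- s i))"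
    proof (rule prod_coprime_right)
      fix j
      assume "j \<in> J"
      then show "coprime (\<beta> i) (\<beta> j ^ nat (- s j))"
        using pos coprime[OF i] by (cases "j = i") auto
    qed
    from coprime_common_divisor[OF this dvd_refl dvd] have "is_unit (\<beta> i)" .
    then show False using gt[OF i] by simp
  qed
  show "\<forall>i \<in> J. e i = 0"
    using no_pos[of _ e] no_pos[of _ "\<lambda>i. - e i"] ab unfolding a_def b_def by fastforce
qed simp

text \<open>A common divisor is coprime to \<open>fact L\<close>. It divides the difference (j - i)
  * L!, hence j - i, which itself divides L!; so it is a unit.\<close>

lemma coprime_Suc_mult_fact:
  fixes i j L :: nat
  assumes "i < L" "j < L" "i \<noteq> j"
  shows "coprime (int (Suc i) * fact L + 1) (int (Suc j) * fact L + 1)"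
proof (rule coprimeI)
  have aux: "is_unit c" if ij: "i < j" "j < L" "c dvd int (Suc i) * fact L + 1" "c dvd int (Suc j) * fact L + 1"
    for c :: int and i j
  proof -
    have c_fact: "coprime c (fact L)"
    proof (rule coprimeI)
      fix d assume "d dvd c" "d dvd (fact L :: int)"
      then have "d dvd int (Suc i) * fact L + 1" "d dvd int (Suc i) * fact L"
        using ij(3) dvd_trans by blast (simp add: \<open>d dvd fact L\<close>)
      then show "is_unit d" by (simp add: dvd_add_right_iff)
    qed
    have "c dvd (int (Suc j) * fact L + 1) - (int (Suc i) * fact L + 1)"
      using ij(3,4) dvd_diff by blast
    then have "c dvd int (j - i) * fact L"
      using ij(1) by (simp add: algebra_simps of_nat_diff)
    then have "c dvd int (j - i)" using c_fact by (simp add: coprime_dvd_mult_left_iff)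
    moreover have "j - i dvd fact L" using ij by (intro dvd_fact) auto
    then have "int (j - i) dvd fact L" by (metis int_dvd_int_iff of_nat_fact)
    ultimately have "c dvd fact L" by (rule dvd_trans)
    then show ?thesis using c_fact coprime_common_divisor[of c "fact L" c] by simp
  qed
  fix c :: int
  assume "c dvd int (Suc i) * fact L + 1" "c dvd int (Suc j) * fact L + 1"
  then show "is_unit c" using aux[of i j c] aux[of j i c] assms by (cases "i < j") auto
qed

lemma distinct_filter_eq:
  "distinct xs \<Longrightarrow> x \<in> set xs \<Longrightarrow> filter (\<lambda>y. y = x) xs = [x]"
  by (induction xs) (auto simp: filter_empty_conv)

text \<open>
  A constraint problem on the variables \<open>V\<close> with values below \<open>N\<close>: every
  \<open>q\<close>-tuple of variables has to satisfy \<open>R\<close> together with its values. The element of a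
  list \<open>z\<close> of variable-value pairs belongs to the class of the underlying tuple. The bases
  \<open>base j 0\<close> force one element of every class to be chosen, and the bases
  \<open>base j (m + 1)\<close> force the value at position \<open>m\<close> of tuple \<open>j\<close> to agree with
  the value in the constant tuple of the variable at that position.
\<close>

locale constraint_encoding =
  fixes V :: "int list" and r :: int and q :: nat and N :: int and R :: "(int \<times> int) list \<Rightarrow> bool"
  assumes distinct_V: "distinct V" and r_in_V: "r \<in> set V" and q_pos: "0 < q"
begin

definition tuples :: "int list list" where
  "tuples = List.n_lists q V"

definition assignments :: "(int \<times> int) list set" where
  "assignments = {z. length z = q \<and> fst ` set z \<subseteq> set V \<and> snd ` set z \<subseteq> {0..<N} \<and> R z}"

text \<open>The constant tuple of \<open>r\<close> is the reference class: the sums vanish iff every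
  class is used as often as it is.\<close>

definition class_exponent :: "int list \<Rightarrow> (int \<times> int) list \<Rightarrow> int" where
  "class_exponent \<tau> z = (if map fst z = \<tau> then 1 else 0) - (if map fst z = replicate q r then 1 else 0)"

text \<open>The comparison is meaningful once each class is used once. For a constant tuple it ties
  its own positions to position 0, whose value becomes the value of the variable.\<close>

definition link_exponent :: "int list \<Rightarrow> nat \<Rightarrow> (int \<times> int) list \<Rightarrow> int" where
  "link_exponent \<tau> m z = (if map fst z = replicate q (\<tau> ! m) then snd (z ! 0) else 0) -
     (if map fst z = \<tau> then snd (z ! m) else 0)"

definition exponent :: "nat \<Rightarrow> nat \<Rightarrow> (int \<times> int) list \<Rightarrow> int" where
  "exponent j l z = (case l of 0 \<Rightarrow> class_exponent (tuples ! j) z | Suc m \<Rightarrow> link_exponent (tuples ! j) m z)"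

text \<open>Row-major numbering of the pairs (j, l) with l <= q; the factorial is taken of their
  total number, as \<open>coprime_Suc_mult_fact\<close> requires.\<close>

definition base :: "nat \<Rightarrow> nat \<Rightarrow> int" where
  "base j l = int (Suc (j * Suc q + l)) * fact (length tuples * Suc q) + 1"

text \<open>Splitting by the sign of the exponent puts each base into at most one of numerator and
  denominator. The fraction is thus already reduced, as \<open>enc_rat\<close> demands, and no gcd
  has to be computed.\<close>

definition numerator :: "(int \<times> int) list \<Rightarrow> int" where
  "numerator z = (\<Prod>j<length tuples. \<Prod>l<Suc q. base j l ^ nat (exponent j l z))"

definition denominator :: "(int \<times> int) list \<Rightarrow> int" where
  "denominator z = (\<Prod>j<length tuples. \<Prod>l<Suc q. base j l ^ nat (- exponent j l z))"

definition number :: "(int \<times> int) list \<Rightarrow> rat" where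
  "number z = of_int (numerator z) / of_int (denominator z)"

abbreviation indices :: "(nat \<times> nat) set" where
  "indices \<equiv> {..<length tuples} \<times> {..<Suc q}"

section \<open>Product 1 as vanishing of all exponent sums\<close>

lemma base_gt_1: "1 < base j l"
proof -
  have "0 < int (Suc (j * Suc q + l)) * fact (length tuples * Suc q)" 
    by (intro mult_pos_pos) (simp_all only: of_nat_0_less_iff zero_less_Suc fact_gt_zero)
  then show ?thesis unfolding base_def by linarith
qed

lemma coprime_base:
  assumes "i \<in> indices" "i' \<in> indices" "i \<noteq> i'"
  shows "coprime (base (fst i) (snd i)) (base (fst i') (snd i'))"
proof -
  obtain j l j' l' where i: "i = (j, l)" "i' = (j', l')" by (meson surj_pair)
  have less: "a * Suc q + b < length tuples * Suc q" if "a < length tuples" "b < Suc q" for a b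
  proof -
    have "a * Suc q + b < Suc a * Suc q" using that(2) by simp
    also have "\<dots> \<le> length tuples * Suc q" using that(1) by (intro mult_right_mono) auto
    finally show ?thesis .
  qed
  have "j * Suc q + l \<noteq> j' * Suc q + l'"
  proof
    assume eq: "j * Suc q + l = j' * Suc q + l'"
    have "(j * Suc q + l) div Suc q = j" "(j' * Suc q + l') div Suc q = j'"
      using assms i by (auto simp: div_mult_self3 simp del: mult_Suc_right)
    then show False using eq assms(3) i by auto
  qed
  then show ?thesis
    unfolding base_def i fst_conv snd_conv
    using assms i by (intro coprime_Suc_mult_fact less) auto
qed

lemma numerator_alt: "numerator z = (\<Prod>i\<in>indices. base (fst i) (snd i) ^ nat (exponent (fst i) (snd i) z))"
  and denominator_alt: "denominator z = (\<Prod>i\<in>indices. base (fst i) (snd i) ^ nat (- exponent (fst i) (snd i) z))"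
  unfolding numerator_def denominator_def by (simp_all only: prod.cartesian_product case_prod_unfold)

lemma denominator_pos: "0 < denominator z"
  unfolding denominator_def by (intro prod_pos ballI zero_less_power less_trans[OF zero_less_one base_gt_1])

lemma coprime_numerator_denominator: "coprime (numerator z) (denominator z)"
  unfolding numerator_alt denominator_alt
proof (intro prod_coprime_left prod_coprime_right)
  fix i i'
  assume "i \<in> indices" "i' \<in> indices"
  then show "coprime (base (fst i) (snd i) ^ nat (exponent (fst i) (snd i) z))
      (base (fst i') (snd i') ^ nat (- exponent (fst i') (snd i') z))"
    using coprime_base[of i i'] by (cases "i = i'"; cases "0 \<le> exponent (fst i) (snd i) z") auto
qed

lemma enc_rat_number: "enc_rat (number z) = Node (Atom (numerator z)) (Atom (denominator z))"
proof -
  have "quotient_of (number z) = (numerator z, denominator z)"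
    unfolding number_def Fract_of_int_quotient[symmetric]
    using denominator_pos coprime_numerator_denominator
    by (simp add: quotient_of_Fract normalize_stable)
  then show ?thesis by (simp add: enc_rat_def)
qed

lemma number_powi: "number z = (\<Prod>i\<in>indices. of_int (base (fst i) (snd i)) powi exponent (fst i) (snd i) z)"
proof -
  have "(of_int b :: rat) powi e = of_int (b ^ nat e) / of_int (b ^ nat (- e))" for b e :: int
    by (cases "0 \<le> e") (simp_all add: power_int_def field_simps)
  then show ?thesis
    unfolding number_def numerator_alt denominator_alt by (simp add: prod_dividef)
qed

lemma prod_list_number_eq_1_iff:
  "prod_list (map number zs) = 1 \<longleftrightarrow>
    (\<forall>j < length tuples. \<forall>l \<le> q. (\<Sum>z\<leftarrow>zs. exponent j l z) = 0)"
proof -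
  have "prod_list (map number zs) =
      (\<Prod>i\<in>indices. of_int (base (fst i) (snd i)) powi (\<Sum>z\<leftarrow>zs. exponent (fst i) (snd i) z))"
  proof (induction zs)
    case (Cons z zs)
    have "(of_int (base j l) :: rat) \<noteq> 0" for j l using base_gt_1[of j l] by simp
    then show ?case using Cons by (simp add: number_powi power_int_add prod.distrib)
  qed simp
  then show ?thesis
    using prod_powi_eq_1_iff[of indices "\<lambda>i. base (fst i) (snd i)" "\<lambda>i. \<Sum>z\<leftarrow>zs. exponent (fst i) (snd i) z"]
      base_gt_1 coprime_base by (auto simp: less_Suc_eq_le)
qed

lemma distinct_tuples: "distinct tuples"
  unfolding tuples_def by (rule distinct_n_lists[OF distinct_V])

lemma in_tuples_iff: "\<tau> \<in> set tuples \<longleftrightarrow> length \<tau> = q \<and> set \<tau> \<subseteq> set V"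
  by (auto simp: tuples_def set_n_lists)

lemma replicate_in_tuples: "x \<in> set V \<Longrightarrow> replicate q x \<in> set tuples"
  by (auto simp: in_tuples_iff)

lemma sum_class_exponent:
  "(\<Sum>z\<leftarrow>zs. class_exponent \<tau> z) =
    int (length (filter (\<lambda>z. map fst z = \<tau>) zs)) - int (length (filter (\<lambda>z. map fst z = replicate q r) zs))"
  unfolding class_exponent_def by (induction zs) auto

lemma sum_link_exponent:
  "(\<Sum>z\<leftarrow>zs. link_exponent \<tau> m z) =
    (\<Sum>z\<leftarrow>filter (\<lambda>z. map fst z = replicate q (\<tau> ! m)) zs. snd (z ! 0)) -
    (\<Sum>z\<leftarrow>filter (\<lambda>z. map fst z = \<tau>) zs. snd (z ! m))"
  unfolding link_exponent_def by (induction zs) auto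

text \<open>With one element per class, class exponents sum to 1 - 1, and link exponents to u x - u
  x for the variable x at the position.\<close>

lemma exponents_balanced_of_assignment:
  assumes "j < length tuples" "l \<le> q"
  shows "(\<Sum>z\<leftarrow>map (map (\<lambda>x. (x, u x))) tuples. exponent j l z) = 0"
proof -
  let ?z = "map (\<lambda>x. (x, u x))"
  have fst_z: "map fst (?z \<tau>) = \<tau>" for \<tau> by (simp add: comp_def)
  have j: "tuples ! j \<in> set tuples" using assms(1) by simp
  have filter_eq: "filter (\<lambda>z. map fst z = \<tau>) (map ?z tuples) = [?z \<tau>]" if "\<tau> \<in> set tuples" for \<tau>
  proof -
    have "filter (\<lambda>z. map fst z = \<tau>) (map ?z tuples) = map ?z (filter (\<lambda>\<sigma>. \<sigma> = \<tau>) tuples)"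
      by (simp add: filter_map comp_def)
    also have "filter (\<lambda>\<sigma>. \<sigma> = \<tau>) tuples = [\<tau>]"
      using distinct_tuples that by (rule distinct_filter_eq)
    finally show ?thesis by simp
  qed
  show ?thesis
  proof (cases l)
    case 0
    then show ?thesis
      using filter_eq[OF j] filter_eq[OF replicate_in_tuples[OF r_in_V]]
      by (simp only: exponent_def nat.case sum_class_exponent list.size)
  next
    case (Suc m)
    have "m < length (tuples ! j)" using assms(2) Suc j by (simp add: in_tuples_iff)
    then have "tuples ! j ! m \<in> set V" using j in_tuples_iff nth_mem by blast
    from filter_eq[OF replicate_in_tuples[OF this]] show ?thesis
      using filter_eq[OF j] Suc \<open>m < length (tuples ! j)\<close> q_pos
      by (simp only: exponent_def nat.case sum_link_exponent) simp
  qed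
qed

text \<open>Class exponents give every class the same multiplicity \<open>c\<close>. The number of
  factors equals the number of classes, so \<open>c = 1\<close>, and the link exponents then force
  the representatives to agree.\<close>

lemma assignment_of_exponents_balanced:
  assumes zs: "set zs \<subseteq> assignments" "length zs = length tuples"
    and balanced: "\<And>j l. j < length tuples \<Longrightarrow> l \<le> q \<Longrightarrow> (\<Sum>z\<leftarrow>zs. exponent j l z) = 0"
  obtains u where "\<And>x. x \<in> set V \<Longrightarrow> u x \<in> {0..<N}" "\<And>\<tau>. \<tau> \<in> set tuples \<Longrightarrow> R (map (\<lambda>x. (x, u x)) \<tau>)"
proof -
  let ?cls = "\<lambda>\<tau>. filter (\<lambda>z. map fst z = \<tau>) zs"
  define c where "c = length (?cls (replicate q r))"
  have cls: "map fst z \<in> set tuples" if "z \<in> set zs" for z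
    using that zs(1) by (force simp: in_tuples_iff assignments_def)
  have count: "length (?cls \<tau>) = c" if \<tau>: "\<tau> \<in> set tuples" for \<tau>
  proof -
    obtain j where "j < length tuples" "\<tau> = tuples ! j" using \<tau> by (metis in_set_conv_nth)
    then have "(\<Sum>z\<leftarrow>zs. class_exponent \<tau> z) = 0" using balanced[of j 0] by (simp add: exponent_def)
    then show ?thesis by (simp add: sum_class_exponent c_def)
  qed
  \<comment> \<open>Counting the chosen elements class by class.\<close>
  have "length zs = (\<Sum>\<tau>\<in>set tuples. length (?cls \<tau>))"
    using cls
  proof (induction zs)
    case (Cons z zs)
    have "(\<Sum>\<tau>\<in>set tuples. length (filter (\<lambda>z. map fst z = \<tau>) (z # zs))) =
        (\<Sum>\<tau>\<in>set tuples. (if \<tau> = map fst z then 1 else 0) + length (filter (\<lambda>z. map fst z = \<tau>) zs))"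
      by (rule sum.cong) auto
    then show ?case using Cons by (simp add: sum.distrib)
  qed simp
  also have "\<dots> = length tuples * c"
    using count by (simp add: distinct_card[OF distinct_tuples])
  finally have "length tuples = length tuples * c" using zs(2) by simp
  moreover have "0 < length tuples"
    using replicate_in_tuples[OF r_in_V] by (auto simp: length_pos_if_in_set)
  ultimately have "c = 1" by simp
  have "\<exists>z. ?cls \<tau> = [z]" if "\<tau> \<in> set tuples" for \<tau>
    using count[OF that] \<open>c = 1\<close> by (metis One_nat_def length_0_conv length_Suc_conv)
  then obtain rep where rep: "\<And>\<tau>. \<tau> \<in> set tuples \<Longrightarrow> ?cls \<tau> = [rep \<tau>]" by metis
  have rep_props: "rep \<tau> \<in> assignments" "map fst (rep \<tau>) = \<tau>" if "\<tau> \<in> set tuples" for \<tau>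
  proof -
    have "rep \<tau> \<in> set (?cls \<tau>)" using rep[OF that] by simp
    then show "rep \<tau> \<in> assignments" "map fst (rep \<tau>) = \<tau>" using zs(1) by auto
  qed
  \<comment> \<open>The representative of the constant tuple decides the value of its
    variable.\<close>
  define u where "u x = snd (rep (replicate q x) ! 0)" for x
  have "u x \<in> {0..<N}" if "x \<in> set V" for x
  proof -
    let ?z = "rep (replicate q x)"
    have "length ?z = q" "snd ` set ?z \<subseteq> {0..<N}"
      using rep_props(1)[OF replicate_in_tuples[OF that]] by (simp_all add: assignments_def)
    moreover from this q_pos have "?z ! 0 \<in> set ?z" by simp
    ultimately show ?thesis unfolding u_def by (meson image_subset_iff)
  qed
  moreover have "R (map (\<lambda>x. (x, u x)) \<tau>)" if \<tau>: "\<tau> \<in> set tuples" for \<tau>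
  proof -
    obtain j where j: "j < length tuples" "\<tau> = tuples ! j" using \<tau> by (metis in_set_conv_nth)
    have len: "length \<tau> = q" "length (rep \<tau>) = q"
      using \<tau> rep_props[OF \<tau>] by (auto simp: in_tuples_iff assignments_def)
    have "snd (rep \<tau> ! m) = u (\<tau> ! m)" if m: "m < q" for m
    proof -
      have "replicate q (\<tau> ! m) \<in> set tuples"
        using \<tau> m len nth_mem by (intro replicate_in_tuples) (auto simp: in_tuples_iff)
      then have cls_m: "?cls (replicate q (\<tau> ! m)) = [rep (replicate q (\<tau> ! m))]" by (rule rep)
      have "(\<Sum>z\<leftarrow>zs. link_exponent \<tau> m z) = 0"
        using balanced[OF j(1), of "Suc m"] m j(2) by (simp add: exponent_def)
      then show ?thesis
        unfolding sum_link_exponent cls_m rep[OF \<tau>] u_def by simp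
    qed
    moreover have "fst (rep \<tau> ! m) = \<tau> ! m" if "m < q" for m
      using rep_props(2)[OF \<tau>] len that by (metis nth_map)
    ultimately have "rep \<tau> = map (\<lambda>x. (x, u x)) \<tau>"
      using len by (intro nth_equalityI) (auto simp: prod_eq_iff)
    then show ?thesis using rep_props(1)[OF \<tau>] by (simp add: assignments_def)
  qed
  ultimately show thesis by (rule that)
qed

lemma has_product_iff:
  "has_product_with_repetitions (number ` assignments) (length tuples) \<longleftrightarrow>
    (\<exists>u. (\<forall>x \<in> set V. u x \<in> {0..<N}) \<and> (\<forall>\<tau> \<in> set tuples. R (map (\<lambda>x. (x, u x)) \<tau>)))"
proof
  assume "has_product_with_repetitions (number ` assignments) (length tuples)"
  then obtain bs where bs: "length bs = length tuples" "bs \<in> lists (number ` assignments)" "prod_list bs = 1"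
    unfolding has_product_with_repetitions_def by blast
  then obtain zs where "set zs \<subseteq> assignments" "bs = map number zs"
    unfolding lists_image by auto
  with bs show "\<exists>u. (\<forall>x \<in> set V. u x \<in> {0..<N}) \<and> (\<forall>\<tau> \<in> set tuples. R (map (\<lambda>x. (x, u x)) \<tau>))"
    using assignment_of_exponents_balanced[of zs] prod_list_number_eq_1_iff[of zs] by (metis length_map)
next
  assume "\<exists>u. (\<forall>x \<in> set V. u x \<in> {0..<N}) \<and> (\<forall>\<tau> \<in> set tuples. R (map (\<lambda>x. (x, u x)) \<tau>))"
  then obtain u where u: "\<And>x. x \<in> set V \<Longrightarrow> u x \<in> {0..<N}"
    "\<And>\<tau>. \<tau> \<in> set tuples \<Longrightarrow> R (map (\<lambda>x. (x, u x)) \<tau>)" by blast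
  let ?zs = "map (map (\<lambda>x. (x, u x))) tuples"
  have "prod_list (map number ?zs) = 1"
    using exponents_balanced_of_assignment unfolding prod_list_number_eq_1_iff by blast
  moreover have "set ?zs \<subseteq> assignments"
    using u by (fastforce simp: assignments_def in_tuples_iff)
  ultimately show "has_product_with_repetitions (number ` assignments) (length tuples)"
    unfolding has_product_with_repetitions_def by (intro exI[of _ "map number ?zs"]) auto
qed

end

section \<open>The reduction as a polynomial-time function\<close>

text \<open>Lets a two-argument predicate be treated once, on pairs, before arbitrary arguments are
  substituted.\<close>

lemma pdec2:
  assumes "pdec (\<lambda>p. F (vleft p) (vright p))" "ptime f" "ptime g"
  shows "pdec (\<lambda>x. F (f x) (g x))"
  using pdec_comp[OF assms(1) ptime_Node[OF assms(2,3)]] by simp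

lemma pint2:
  assumes "pint (\<lambda>p. F (vleft p) (vright p))" "ptime f" "ptime g"
  shows "pint (\<lambda>x. F (f x) (g x))"
  using pint_comp[OF assms(1) ptime_Node[OF assms(2,3)]] by simp

lemma plist_replicate: "ptime f \<Longrightarrow> plist (\<lambda>x. replicate n (f x))"
  by (induction n) (auto intro: plist_const plist_Cons)

lemma ptime_vright_funpow: "ptime f \<Longrightarrow> ptime (\<lambda>x. (vright ^^ m) (f x))"
  by (induction m) (auto intro: ptime_vright)

subsection \<open>Recognizing circuits\<close>

definition valid_index :: "val \<Rightarrow> val \<Rightarrow> bool" where
  "valid_index i j \<longleftrightarrow> j = Atom (ival j) \<and> 0 \<le> ival j \<and> ival j < ival i"

text \<open>Distinctness is phrased as "equal entries have equal indices", which bounded quantifiers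
  over \<open>indexed\<close> can express.\<close>

definition valid_gate :: "val \<Rightarrow> val \<Rightarrow> bool" where
  "valid_gate i g \<longleftrightarrow> g = Node (Atom 0) (Atom 0) \<or>
     (vleft g = Atom 1 \<and> valid_index i (vright g)) \<or>
     ((vleft g = Atom 2 \<or> vleft g = Atom 3) \<and> elist (dlist (vright g)) = vright g \<and>
      2 \<le> int (length (dlist (vright g))) \<and> (\<forall>j \<in> set (dlist (vright g)). valid_index i j) \<and>
      (\<forall>e \<in> set (indexed (dlist (vright g))). \<forall>e' \<in> set (indexed (dlist (vright g))).
         vright e = vright e' \<longrightarrow> vleft e = vleft e'))"

text \<open>Every value is an instance, so values that encode no circuit have to be recognized and
  rejected.\<close>

definition valid_circuit :: "val \<Rightarrow> bool" where
  "valid_circuit x \<longleftrightarrow> elist (dlist x) = x \<and> \<not> is_atom x \<and>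
     (\<forall>e \<in> set (indexed (dlist x)). valid_gate (vleft e) (vright e))"

lemma pdec_valid_index: "ptime f \<Longrightarrow> ptime g \<Longrightarrow> pdec (\<lambda>x. valid_index (f x) (g x))"
  by (rule pdec2) (auto simp: valid_index_def intro!: ptime_intros)

lemma pdec_valid_gate: "ptime f \<Longrightarrow> ptime g \<Longrightarrow> pdec (\<lambda>x. valid_gate (f x) (g x))"
  by (rule pdec2) (unfold valid_gate_def, (intro ptime_intros pdec_valid_index)+)

lemma pdec_valid_circuit: "ptime f \<Longrightarrow> pdec (\<lambda>x. valid_circuit (f x))"
  by (rule pdec_comp[of valid_circuit]) (unfold valid_circuit_def, (intro ptime_intros pdec_valid_gate)+)

abbreviation enc_nat :: "nat \<Rightarrow> val" where "enc_nat \<equiv> \<lambda>j. Atom (int j)"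

lemma valid_index_iff: "valid_index (Atom (int i)) j \<longleftrightarrow> (\<exists>m < i. j = enc_nat m)"
proof -
  have "0 \<le> n \<and> n < int i \<longleftrightarrow> (\<exists>m < i. n = int m)" for n
    by (auto intro: exI[of _ "nat n"])
  then show ?thesis by (cases j) (auto simp: valid_index_def)
qed

lemma all_valid_index_iff:
  "(\<forall>j \<in> set js. valid_index (Atom (int i)) j) \<longleftrightarrow> (\<exists>ms. js = map enc_nat ms \<and> (\<forall>m \<in> set ms. m < i))"
proof (induction js)
  case (Cons j js)
  show ?case
  proof
    assume "\<forall>j \<in> set (j # js). valid_index (Atom (int i)) j"
    then obtain m ms where "j = enc_nat m" "m < i" "js = map enc_nat ms" "\<forall>m \<in> set ms. m < i"
      using Cons by (auto simp: valid_index_iff)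
    then show "\<exists>ms. j # js = map enc_nat ms \<and> (\<forall>m \<in> set ms. m < i)"
      by (intro exI[of _ "m # ms"]) simp
  qed (auto simp: valid_index_iff)
qed simp

lemma distinct_indexed_iff:
  "(\<forall>e \<in> set (indexed l). \<forall>e' \<in> set (indexed l). vright e = vright e' \<longrightarrow> vleft e = vleft e') \<longleftrightarrow> distinct l"
  unfolding Ball_indexed distinct_conv_nth by auto

lemma valid_gate_iff:
  "valid_gate (Atom (int i)) g \<longleftrightarrow> (\<exists>G. g = enc_gate G \<and> fan_in_ok G \<and> (\<forall>j \<in> set (args G). j < i))"
proof
  have list: "\<exists>js. vright g = enc_list enc_nat js \<and> 2 \<le> length js \<and> distinct js \<and> (\<forall>j \<in> set js. j < i)"
    if g: "elist (dlist (vright g)) = vright g" "2 \<le> int (length (dlist (vright g)))"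
      "\<forall>j \<in> set (dlist (vright g)). valid_index (Atom (int i)) j" "distinct (dlist (vright g))"
  proof -
    obtain ms where ms: "dlist (vright g) = map enc_nat ms" "\<forall>m \<in> set ms. m < i"
      using g(3) all_valid_index_iff by blast
    then have "vright g = enc_list enc_nat ms" using g(1) by (metis elist_map)
    then show ?thesis using ms g(2,4) by (intro exI[of _ ms]) (auto simp: distinct_map)
  qed
  have gate: "g = Node (vleft g) (vright g)" if "vleft g \<noteq> Atom 0"
    using that by (cases g) auto
  assume "valid_gate (Atom (int i)) g"
  then consider "g = Node (Atom 0) (Atom 0)"
    | "vleft g = Atom 1" "valid_index (Atom (int i)) (vright g)"
    | js where "vleft g = Atom 2 \<or> vleft g = Atom 3" "vright g = enc_list enc_nat js" "2 \<le> length js"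
      "distinct js" "\<forall>j \<in> set js. j < i"
    unfolding valid_gate_def distinct_indexed_iff using list by blast
  then show "\<exists>G. g = enc_gate G \<and> fan_in_ok G \<and> (\<forall>j \<in> set (args G). j < i)"
  proof cases
    case 1
    then show ?thesis by (intro exI[of _ Input]) simp
  next
    case 2
    then obtain m where "m < i" "vright g = enc_nat m" by (auto simp: valid_index_iff)
    then show ?thesis using 2 gate by (intro exI[of _ "Neg m"]) simp
  next
    case 3
    from 3(1) show ?thesis
    proof
      assume "vleft g = Atom 2"
      then show ?thesis using 3 gate by (intro exI[of _ "And js"]) simp
    next
      assume "vleft g = Atom 3"
      then show ?thesis using 3 gate by (intro exI[of _ "Or js"]) simp
    qed
  qed
next
  assume "\<exists>G. g = enc_gate G \<and> fan_in_ok G \<and> (\<forall>j \<in> set (args G). j < i)"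
  then obtain G where "g = enc_gate G" "fan_in_ok G" "\<forall>j \<in> set (args G). j < i" by blast
  then show "valid_gate (Atom (int i)) g"
    unfolding valid_gate_def distinct_indexed_iff
    by (cases G) (auto simp: valid_index_iff distinct_map inj_on_def elist_map)
qed

lemma valid_circuit_iff: "valid_circuit x \<longleftrightarrow> (\<exists>C. circuit C \<and> x = enc_list enc_gate C)"
proof
  assume "\<exists>C. circuit C \<and> x = enc_list enc_gate C"
  then obtain C where C: "circuit C" "x = enc_list enc_gate C" by blast
  have "\<not> is_atom x" using C by (cases C) (auto simp: circuit_def)
  moreover have "valid_gate (Atom (int i)) (enc_gate (C ! i))" if "i < length C" for i
    unfolding valid_gate_iff using C(1) that by (auto simp: circuit_def)
  ultimately show "valid_circuit x"
    by (simp add: valid_circuit_def Ball_indexed C(2) elist_map)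
next
  assume x: "valid_circuit x"
  let ?l = "dlist x"
  have "\<exists>G. ?l ! i = enc_gate G \<and> fan_in_ok G \<and> (\<forall>j \<in> set (args G). j < i)" if "i < length ?l" for i
    using x that unfolding valid_circuit_def Ball_indexed valid_gate_iff[symmetric] by simp
  then obtain G where G: "\<And>i. i < length ?l \<Longrightarrow> ?l ! i = enc_gate (G i) \<and> fan_in_ok (G i) \<and> (\<forall>j \<in> set (args (G i)). j < i)"
    by metis
  define C where "C = map G [0..<length ?l]"
  have "?l = map enc_gate C" using G by (intro nth_equalityI) (auto simp: C_def)
  then have "elist ?l = enc_list enc_gate C" by (simp only: elist_map)
  then have x_eq: "x = enc_list enc_gate C" using x by (simp only: valid_circuit_def)
  have "C \<noteq> []"
  proof
    assume "C = []"
    then have "is_atom x" using x_eq by simp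
    then show False using x by (simp add: valid_circuit_def)
  qed
  then have "circuit C" using G by (auto simp: circuit_def C_def)
  then show "\<exists>C. circuit C \<and> x = enc_list enc_gate C" using x_eq by blast
qed

subsection \<open>Evaluating gates\<close>

text \<open>Exactly one pair carries the index \<open>i\<close>, so the guarded universal quantifier
  acts as a lookup.\<close>

lemma Ball_indexed_gate:
  assumes "i < length C"
  shows "(\<forall>e \<in> set (indexed (dlist (enc_list enc_gate C))). vleft e = Atom (int i) \<longrightarrow> P (vright e)) \<longleftrightarrow>
    P (enc_gate (C ! i))"
  using assms by (auto simp: Ball_indexed)

text \<open>The argument of \<open>vshallow\<close> is a pair of a gate number and a circuit.\<close>

primrec vshallow :: "nat \<Rightarrow> nat \<Rightarrow> val \<Rightarrow> bool" where
  "vshallow 0 w p \<longleftrightarrow> (\<forall>e \<in> set (indexed (dlist (vright p))). vleft e = vleft p \<longrightarrow> vleft (vright e) = Atom 0)"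
| "vshallow (Suc d) w p \<longleftrightarrow>
     (\<forall>e \<in> set (indexed (dlist (vright p))). vleft e = vleft p \<longrightarrow>
        (vleft (vright e) = Atom 1 \<longrightarrow> vshallow d w (Node (vright (vright e)) (vright p))) \<and>
        (vleft (vright e) = Atom 2 \<or> vleft (vright e) = Atom 3 \<longrightarrow>
          (if 2 < int (length (dlist (vright (vright e))))
           then 0 < w \<and> (\<forall>j \<in> set (dlist (vright (vright e))). vshallow d (w - 1) (Node j (vright p)))
           else \<forall>j \<in> set (dlist (vright (vright e))). vshallow d w (Node j (vright p)))))"

text \<open>\<open>d\<close> and \<open>w\<close> are fixed outside the program. Induction on
  \<open>d\<close> builds a separate program for each, with a nesting of bounded quantifiers that is
  independent of the input; \<open>pdec_vpossible\<close> works likewise.\<close>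

lemma pdec_vshallow: "pdec (vshallow d w)"
proof (induction d arbitrary: w)
  case 0
  show ?case unfolding vshallow.simps by (intro ptime_intros)
next
  case (Suc d)
  show ?case unfolding vshallow.simps by (intro ptime_intros pdec_comp[OF Suc])
qed

lemma vshallow_iff:
  assumes "circuit C"
  shows "i < length C \<Longrightarrow> vshallow d w (Node (Atom (int i)) (enc_list enc_gate C)) \<longleftrightarrow> shallow C d w i"
proof (induction d arbitrary: w i)
  case 0
  then show ?case
    using Ball_indexed_gate[OF 0, of "\<lambda>g. vleft g = Atom 0"] by (cases "C ! i") simp_all
next
  case (Suc d)
  have IH: "vshallow d w (Node (Atom (int j)) (enc_list enc_gate C)) \<longleftrightarrow> shallow C d w j"
    if "j \<in> set (args (C ! i))" for j w
    using circuit_args_less[OF assms Suc.prems that] Suc.prems by (intro Suc.IH) simp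
  show ?case
    unfolding vshallow.simps vleft_simps vright_simps
    unfolding Ball_indexed_gate[OF Suc.prems, of "\<lambda>g. (vleft g = Atom 1 \<longrightarrow> vshallow d w (Node (vright g) (enc_list enc_gate C))) \<and>
        (vleft g = Atom 2 \<or> vleft g = Atom 3 \<longrightarrow>
          (if 2 < int (length (dlist (vright g)))
           then 0 < w \<and> (\<forall>j \<in> set (dlist (vright g)). vshallow d (w - 1) (Node j (enc_list enc_gate C)))
           else \<forall>j \<in> set (dlist (vright g)). vshallow d w (Node j (enc_list enc_gate C))))"]
    using IH by (cases "C ! i") (simp_all add: large_def)
qed

fun enc_pair :: "int \<times> int \<Rightarrow> val" where
  "enc_pair (x, c) = Node (Atom x) (Atom c)"

lemma enc_pair_simps [simp]: "vleft (enc_pair p) = Atom (fst p)" "vright (enc_pair p) = Atom (snd p)"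
  by (cases p; simp)+

text \<open>
  The argument of \<open>vlit\<close> and \<open>vpossible\<close> consists of a gate number, a circuit and a list
  of known pairs.
\<close>

definition vlit :: "bool \<Rightarrow> val \<Rightarrow> bool" where
  "vlit b p \<longleftrightarrow>
     (if b then \<not> (\<exists>s \<in> set (dlist (vright (vright p))). \<exists>t \<in> set (dlist (vright (vright p))).
         ival (vleft s) + 1 = ival (vleft t) \<and> ival (vright s) < ival (vleft p) \<and> ival (vleft p) < ival (vright t))
      else \<not> (\<exists>s \<in> set (dlist (vright (vright p))). 0 \<le> ival (vleft s) \<and> ival (vright s) = ival (vleft p)))"

lemma pdec_vlit: "pdec (vlit b)"
  unfolding vlit_def by (cases b) (simp_all only: if_True if_False, (intro ptime_intros)+)

lemma vlit_iff: "vlit b (Node (Atom (int i)) (Node x (enc_list enc_pair zs))) \<longleftrightarrow> lit (set zs) b i"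
  by (simp add: vlit_def lit_def)

definition vchoices :: "val \<Rightarrow> bool \<Rightarrow> nat \<Rightarrow> val \<Rightarrow> (nat \<Rightarrow> val \<Rightarrow> bool) \<Rightarrow> bool" where
  "vchoices I u a js P \<longleftrightarrow>
     (if 2 < int (length (dlist js))
      then if u then \<forall>j \<in> set (dlist js). P 0 j
        else \<forall>p \<in> set (dlist I). ival (vleft p) = wvar a \<longrightarrow> (\<exists>j \<in> set (dlist js). ival (vright p) = ival j \<and> P 0 j)
      else if u then P (2 * a + 1) (vleft js) \<and> P (2 * a + 2) (vleft (vright js))
        else P (2 * a + 1) (vleft js) \<or> P (2 * a + 2) (vleft (vright js)))"

lemma vchoices_iff:
  assumes "2 \<le> length js" "\<And>j a. j \<in> set js \<Longrightarrow> P a (Atom (int j)) \<longleftrightarrow> P' a j"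
  shows "vchoices (enc_list enc_pair zs) u a (enc_list enc_nat js) P \<longleftrightarrow> choices (set zs) u a js P'"
proof -
  obtain j j' js' where "js = j # j' # js'" using assms(1) by (cases js rule: remdups_adj.cases) auto
  then show ?thesis using assms(2) by (auto simp: vchoices_def choices_def)
qed

primrec vpossible :: "nat \<Rightarrow> bool \<Rightarrow> nat \<Rightarrow> val \<Rightarrow> bool" where
  "vpossible 0 b a p \<longleftrightarrow> vlit b p"
| "vpossible (Suc d) b a p \<longleftrightarrow>
     (\<forall>e \<in> set (indexed (dlist (vleft (vright p)))). vleft e = vleft p \<longrightarrow>
        (vleft (vright e) = Atom 0 \<longrightarrow> vlit b p) \<and>
        (vleft (vright e) = Atom 1 \<longrightarrow> vpossible d (\<not> b) (2 * a + 1) (Node (vright (vright e)) (vright p))) \<and>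
        (vleft (vright e) = Atom 2 \<longrightarrow>
           vchoices (vright (vright p)) b a (vright (vright e)) (\<lambda>a j. vpossible d b a (Node j (vright p)))) \<and>
        (vleft (vright e) = Atom 3 \<longrightarrow>
           vchoices (vright (vright p)) (\<not> b) a (vright (vright e)) (\<lambda>a j. vpossible d b a (Node j (vright p)))))"

lemma pdec_vchoices:
  assumes "\<And>a. pdec (P a)" "ptime I" "ptime js" "ptime c"
  shows "pdec (\<lambda>x. vchoices (I x) u a (js x) (\<lambda>a j. P a (Node j (c x))))"
proof -
  let ?F = "\<lambda>y. vchoices (vleft y) u a (vleft (vright y)) (\<lambda>a j. P a (Node j (vright (vright y))))"
  have "pdec ?F"
    unfolding vchoices_def
    by (cases u) (simp_all only: if_True if_False, (intro ptime_intros pdec_comp[OF assms(1)])+)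
  from pdec_comp[OF this, of "\<lambda>x. Node (I x) (Node (js x) (c x))"]
  show ?thesis by (simp add: ptime_Node assms)
qed

lemma pdec_vpossible: "pdec (vpossible d b a)"
proof (induction d arbitrary: b a)
  case 0
  show ?case unfolding vpossible.simps by (rule pdec_vlit)
next
  case (Suc d)
  show ?case
    unfolding vpossible.simps
    by (intro ptime_intros pdec_vchoices[OF Suc] pdec_comp[OF Suc] pdec_comp[OF pdec_vlit])
qed

lemma vpossible_iff:
  assumes "circuit C"
  shows "i < length C \<Longrightarrow>
    vpossible d b a (Node (Atom (int i)) (Node (enc_list enc_gate C) (enc_list enc_pair zs))) \<longleftrightarrow>
    possible C (set zs) d b a i"
proof (induction d arbitrary: b a i)
  case 0
  then show ?case by (simp add: vlit_iff)
next
  case (Suc d)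
  let ?y = "Node (enc_list enc_gate C) (enc_list enc_pair zs)"
  have IH: "vpossible d b a (Node (Atom (int j)) ?y) \<longleftrightarrow> possible C (set zs) d b a j"
    if "j \<in> set (args (C ! i))" for b a j
    using circuit_args_less[OF assms Suc.prems that] Suc.prems by (intro Suc.IH) simp
  have two: "2 \<le> length js" if "C ! i = And js \<or> C ! i = Or js" for js
    using assms Suc.prems that by (fastforce simp: circuit_def)
  have choice: "vchoices (enc_list enc_pair zs) u a (enc_list enc_nat js) (\<lambda>a j. vpossible d b a (Node j ?y)) \<longleftrightarrow>
      choices (set zs) u a js (possible C (set zs) d b)" if "C ! i = And js \<or> C ! i = Or js" for u js
    by (rule vchoices_iff[OF two[OF that]]) (use IH that in auto)
  show ?case
    unfolding vpossible.simps vleft_simps vright_simps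
    unfolding Ball_indexed_gate[OF Suc.prems, of "\<lambda>g.
        (vleft g = Atom 0 \<longrightarrow> vlit b (Node (Atom (int i)) ?y)) \<and>
        (vleft g = Atom 1 \<longrightarrow> vpossible d (\<not> b) (2 * a + 1) (Node (vright g) ?y)) \<and>
        (vleft g = Atom 2 \<longrightarrow>
           vchoices (enc_list enc_pair zs) b a (vright g) (\<lambda>a j. vpossible d b a (Node j ?y))) \<and>
        (vleft g = Atom 3 \<longrightarrow>
           vchoices (enc_list enc_pair zs) (\<not> b) a (vright g) (\<lambda>a j. vpossible d b a (Node j ?y)))"]
    using IH choice by (cases "C ! i") (simp_all add: vlit_iff)
qed

subsection \<open>Computing the numbers\<close>

text \<open>Inputs \<open>y\<close> below are pairs of a circuit and a parameter.\<close>

definition vinfo :: "val \<Rightarrow> val \<Rightarrow> val" where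
  "vinfo z y = Node (Node (Atom (- 1)) (Atom (- 1)))
     (Node (Node (vright y) (Atom (int (length (dlist (vleft y)))))) z)"

definition vlocal :: "nat \<Rightarrow> val \<Rightarrow> val \<Rightarrow> bool" where
  "vlocal d z y \<longleftrightarrow>
     (\<forall>s \<in> set (dlist (vinfo z y)). \<forall>t \<in> set (dlist (vinfo z y)).
        ival (vleft s) + 1 = ival (vleft t) \<longrightarrow> ival (vright s) < ival (vright t)) \<and>
     (\<forall>s \<in> set (dlist z). 0 \<le> ival (vleft s) \<longrightarrow>
        (\<forall>e \<in> set (indexed (dlist (vleft y))). vleft e = vright s \<longrightarrow> vleft (vright e) = Atom 0)) \<and>
     vpossible d True 0 (Node (Atom (int (length (dlist (vleft y))) - 1)) (Node (vleft y) (vinfo z y)))"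

text \<open>Doubles as a loop range: for k <= \<open>length C\<close> the positions below
  \<open>k\<close> occur among these atoms, and exponents up to \<open>length C\<close> can be
  counted by them.\<close>

definition vvalues :: "val \<Rightarrow> val list" where
  "vvalues y = map (\<lambda>e. vleft e) (indexed (dlist (vleft y)))"

definition vvariables :: "nat \<Rightarrow> val \<Rightarrow> val list" where
  "vvariables d y = map (\<lambda>a. Atom (wvar a)) [0..<2 ^ Suc d] @ filter (\<lambda>v. ival v < ival (vright y)) (vvalues y)"

definition vtuples :: "nat \<Rightarrow> val \<Rightarrow> val list" where
  "vtuples d y = map elist (List.n_lists (refutation_size d) (vvariables d y))"

definition vassignments :: "nat \<Rightarrow> val \<Rightarrow> val list" where
  "vassignments d y = filter (\<lambda>z. vlocal d z y) (map elist (List.n_lists (refutation_size d)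
     (concat (map (\<lambda>v. map (\<lambda>c. Node v c) (vvalues y)) (vvariables d y)))))"

text \<open>Exponentiation without a counter: one factor \<open>b\<close> per value below
  \<open>e\<close>. A negative exponent gives 1, in accordance with \<open>nat e\<close>.\<close>

definition vpow :: "int \<Rightarrow> int \<Rightarrow> val \<Rightarrow> int" where
  "vpow b e y = (\<Prod>c\<leftarrow>vvalues y. if ival c < e then b else 1)"

definition vexponent :: "nat \<Rightarrow> nat \<Rightarrow> val \<Rightarrow> val \<Rightarrow> int" where
  "vexponent q l \<tau> z = (case l of
      0 \<Rightarrow> (if elist (map (\<lambda>s. vleft s) (dlist z)) = \<tau> then 1 else 0) -
        (if elist (map (\<lambda>s. vleft s) (dlist z)) = elist (replicate q (Atom (wvar 0))) then 1 else 0)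
    | Suc m \<Rightarrow> (if elist (map (\<lambda>s. vleft s) (dlist z)) = elist (replicate q (vleft ((vright ^^ m) \<tau>)))
          then ival (vright (vleft z)) else 0) -
        (if elist (map (\<lambda>s. vleft s) (dlist z)) = \<tau> then ival (vright (vleft ((vright ^^ m) z))) else 0))"

text \<open>Repeating each tuple produces a list with exactly as many entries as there are bases, so
  the product of index plus one is the required factorial.\<close>

definition vfact :: "nat \<Rightarrow> val \<Rightarrow> int" where
  "vfact d y = (\<Prod>e\<leftarrow>indexed (concat (map (\<lambda>\<tau>. replicate (Suc (refutation_size d)) \<tau>) (vtuples d y))). ival (vleft e) + 1)"

definition vbase :: "nat \<Rightarrow> nat \<Rightarrow> val \<Rightarrow> val \<Rightarrow> int" where
  "vbase d l j y = (ival j * int (Suc (refutation_size d)) + int l + 1) * vfact d y + 1"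

text \<open>The sign \<open>s\<close> selects the numerator (1) or the denominator (-1).\<close>

definition vproduct :: "nat \<Rightarrow> int \<Rightarrow> val \<Rightarrow> val \<Rightarrow> int" where
  "vproduct d s z y = (\<Prod>e\<leftarrow>indexed (vtuples d y). \<Prod>l<Suc (refutation_size d).
     vpow (vbase d l (vleft e) y) (s * vexponent (refutation_size d) l (vright e) z) y)"

text \<open>The fallback is the empty set of numbers with parameter 1. Parameter 0 would not do,
  since the empty product is 1.\<close>

definition vreduce :: "nat \<Rightarrow> val \<Rightarrow> val" where
  "vreduce d y =
     (if valid_circuit (vleft y) \<and> vshallow d 1 (Node (Atom (int (length (dlist (vleft y))) - 1)) (vleft y)) \<and>
         ival (vright y) \<le> int (length (dlist (vleft y)))
      then Node (elist (map (\<lambda>z. Node (Atom (vproduct d 1 z y)) (Atom (vproduct d (- 1) z y))) (vassignments d y)))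
        (Atom (int (length (vtuples d y))))
      else Node (Atom 0) (Atom 1))"

lemma ptime_vinfo: "ptime f \<Longrightarrow> ptime g \<Longrightarrow> ptime (\<lambda>x. vinfo (f x) (g x))"
  unfolding vinfo_def by (intro ptime_intros)

lemma pdec_vlocal: "ptime f \<Longrightarrow> ptime g \<Longrightarrow> pdec (\<lambda>x. vlocal d (f x) (g x))"
  by (rule pdec2) (unfold vlocal_def, (intro ptime_intros ptime_vinfo pdec_comp[OF pdec_vpossible])+)

lemma plist_vvalues: "ptime f \<Longrightarrow> plist (\<lambda>x. vvalues (f x))"
  by (rule plist_comp[of vvalues]) (unfold vvalues_def, (intro ptime_intros)+)

lemma plist_vvariables: "ptime f \<Longrightarrow> plist (\<lambda>x. vvariables d (f x))"
  by (rule plist_comp[of "vvariables d"]) (unfold vvariables_def, (intro ptime_intros plist_vvalues)+)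

lemma plist_vtuples: "ptime f \<Longrightarrow> plist (\<lambda>x. vtuples d (f x))"
  by (rule plist_comp[of "vtuples d"]) (unfold vtuples_def, (intro ptime_intros plist_vvariables)+)

lemma plist_vassignments: "ptime f \<Longrightarrow> plist (\<lambda>x. vassignments d (f x))"
  by (rule plist_comp[of "vassignments d"])
     (unfold vassignments_def, (intro ptime_intros plist_vvariables plist_vvalues plist_concat_map pdec_vlocal)+)

lemma pint_vpow:
  assumes "pint b" "pint e" "ptime f"
  shows "pint (\<lambda>x. vpow (b x) (e x) (f x))"
proof -
  have "pint (\<lambda>p. vpow (ival (vleft p)) (ival (vleft (vright p))) (vright (vright p)))"
    unfolding vpow_def by (intro ptime_intros plist_vvalues)
  from pint_comp[OF this, of "\<lambda>x. Node (Atom (b x)) (Node (Atom (e x)) (f x))"]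
  show ?thesis by (simp add: ptime_Node ptime_Atom assms)
qed

lemma pint_vexponent: "ptime f \<Longrightarrow> ptime g \<Longrightarrow> pint (\<lambda>x. vexponent q l (f x) (g x))"
proof (rule pint2)
  show "pint (\<lambda>p. vexponent q l (vleft p) (vright p))"
    unfolding vexponent_def
    by (cases l) (simp_all only: nat.case, (intro ptime_intros plist_replicate ptime_vright_funpow)+)
qed

lemma pint_vfact: "ptime f \<Longrightarrow> pint (\<lambda>x. vfact d (f x))"
  by (rule pint_comp[of "vfact d"])
     (unfold vfact_def, (intro ptime_intros plist_vtuples plist_concat_map plist_replicate)+)

lemma pint_vbase: "ptime f \<Longrightarrow> ptime g \<Longrightarrow> pint (\<lambda>x. vbase d l (f x) (g x))"
  by (rule pint2) (unfold vbase_def, (intro ptime_intros pint_vfact)+)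

lemma pint_vproduct: "ptime f \<Longrightarrow> ptime g \<Longrightarrow> pint (\<lambda>x. vproduct d s (f x) (g x))"
  by (rule pint2)
     (unfold vproduct_def, (intro pint_prod ptime_intros pint_vpow pint_vbase pint_vexponent plist_vtuples)+)

lemma ptime_vreduce: "ptime (vreduce d)"
  unfolding vreduce_def
  by (intro ptime_intros pdec_valid_circuit pdec_comp[OF pdec_vshallow] pint_vproduct plist_vassignments plist_vtuples)

section \<open>Agreement of the computed values with the constraint encoding\<close>

lemma n_lists_map: "List.n_lists n (map f xs) = map (map f) (List.n_lists n xs)"
  by (induction n) (simp_all add: map_concat comp_def)

lemma prod_list_indexed: "(\<Prod>e\<leftarrow>indexed l. f e) = (\<Prod>i<length l. f (Node (Atom (int i)) (l ! i)))"
  unfolding indexed_def by (simp add: comp_def prod.list_conv_set_nth atLeast0LessThan)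

lemma funpow_vright_enc_list: "(vright ^^ m) (enc_list e xs) = enc_list e (drop m xs)"
proof (induction m)
  case (Suc m)
  have "vright (enc_list e ys) = enc_list e (tl ys)" for ys by (cases ys) auto
  then show ?case using Suc by (simp add: tl_drop drop_Suc)
qed simp

lemma vleft_funpow_vright: "m < length xs \<Longrightarrow> vleft ((vright ^^ m) (enc_list e xs)) = e (xs ! m)"
  by (simp add: funpow_vright_enc_list Cons_nth_drop_Suc[symmetric])

lemma vvalues_eq: "vvalues (Node (enc_list enc_gate C) (Atom k)) = map enc_nat [0..<length C]"
  by (simp add: vvalues_def indexed_def)

lemma vpow_eq:
  assumes "e \<le> int (length C)"
  shows "vpow b e (Node (enc_list enc_gate C) (Atom k)) = b ^ nat e"
proof -
  have "vpow b e (Node (enc_list enc_gate C) (Atom k)) = (\<Prod>i<length C. if int i < e then b else 1)"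
    unfolding vpow_def vvalues_eq by (simp add: comp_def prod.list_conv_set_nth atLeast0LessThan)
  also have "\<dots> = (\<Prod>i\<in>{i \<in> {..<length C}. int i < e}. b)"
    by (rule prod.inter_filter[symmetric]) simp
  also have "{i \<in> {..<length C}. int i < e} = {..<nat e}" using assms by auto
  finally show ?thesis by simp
qed

lemma enc_list_map: "enc_list e (map f xs) = enc_list (\<lambda>x. e (f x)) xs"
  by (induction xs) auto

lemma enc_list_eq_iff: "inj e \<Longrightarrow> enc_list e xs = enc_list e ys \<longleftrightarrow> xs = ys"
  using inj_enc_list by (blast dest: injD)

context
  fixes C :: circuit and k d :: nat and y :: val
  assumes C: "circuit C" and k: "k \<le> length C" and y: "y = Node (enc_list enc_gate C) (Atom (int k))"
begin

interpretation constraint_encoding "variables d k" "wvar 0" "refutation_size d" "int (length C)"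
  "\<lambda>zs. locally_consistent C k d (set zs)"
proof
  show "distinct (variables d k)" by (rule distinct_variables)
  show "wvar 0 \<in> set (variables d k)" by (simp add: variables_def)
  show "0 < refutation_size d" using two_le_refutation_size[of d] by simp
qed

lemma vvariables_eq: "vvariables d y = map Atom (variables d k)"
proof -
  have "[0..<length C] = [0..<k] @ [k..<length C]"
    using upt_add_eq_append[of 0 k "length C - k"] k by simp
  then have "filter (\<lambda>i. int i < int k) [0..<length C] = [0..<k]" by simp
  then show ?thesis
    by (simp add: vvariables_def y vvalues_eq variables_def filter_map comp_def)
qed

lemma vtuples_eq: "vtuples d y = map (enc_list Atom) tuples"
  unfolding vtuples_def vvariables_eq n_lists_map tuples_def by (simp add: elist_map)

text \<open>The range hypothesis makes each \<open>snd p\<close> a gate number; outside the range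
  the lookup by a guarded quantifier would hold vacuously.\<close>

lemma vlocal_iff:
  assumes "snd ` set zs \<subseteq> {0..<int (length C)}"
  shows "vlocal d (enc_list enc_pair zs) y \<longleftrightarrow> locally_consistent C k d (set zs)"
proof -
  have info: "vinfo (enc_list enc_pair zs) y = enc_list enc_pair ((-1, -1) # (int k, int (length C)) # zs)"
    by (simp add: vinfo_def y)
  have set_info: "set ((-1, -1) # (int k, int (length C)) # zs) = set zs \<union> sentinels C k"
    by (auto simp: sentinels_def)
  have last: "length C - 1 < length C" "int (length C) - 1 = int (length C - 1)"
    using C by (auto simp: circuit_def Suc_le_eq of_nat_diff)
  have "vpossible d True 0 (Node (Atom (int (length C) - 1)) (Node (enc_list enc_gate C)
      (enc_list enc_pair ((-1, -1) # (int k, int (length C)) # zs)))) \<longleftrightarrow>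
      possible C (set zs \<union> sentinels C k) d True 0 (length C - 1)"
    unfolding last(2) by (simp only: vpossible_iff[OF C last(1)] set_info)
  moreover have "(\<forall>e \<in> set (indexed (dlist (enc_list enc_gate C))). vleft e = vright (enc_pair p) \<longrightarrow> vleft (vright e) = Atom 0) \<longleftrightarrow>
      C ! nat (snd p) = Input" if "p \<in> set zs" for p
  proof -
    have "0 \<le> snd p" "nat (snd p) < length C" using assms that by (auto simp: nat_less_iff)
    moreover from this have "vright (enc_pair p) = Atom (int (nat (snd p)))" by simp
    moreover have "vleft (enc_gate G) = Atom 0 \<longleftrightarrow> G = Input" for G by (cases G) auto
    ultimately show ?thesis using Ball_indexed_gate[of "nat (snd p)" C "\<lambda>g. vleft g = Atom 0"] by metis
  qed
  then have "(\<forall>s \<in> set (dlist (enc_list enc_pair zs)). 0 \<le> ival (vleft s) \<longrightarrow>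
      (\<forall>e \<in> set (indexed (dlist (enc_list enc_gate C))). vleft e = vright s \<longrightarrow> vleft (vright e) = Atom 0)) \<longleftrightarrow>
      (\<forall>p \<in> set zs. 0 \<le> fst p \<longrightarrow> C ! nat (snd p) = Input)"
    by simp
  moreover have "(\<forall>s \<in> set (dlist (enc_list enc_pair zs')). \<forall>t \<in> set (dlist (enc_list enc_pair zs')).
        ival (vleft s) + 1 = ival (vleft t) \<longrightarrow> ival (vright s) < ival (vright t)) \<longleftrightarrow>
      (\<forall>p \<in> set zs'. \<forall>q \<in> set zs'. fst p + 1 = fst q \<longrightarrow> snd p < snd q)" for zs'
    by simp
  ultimately show ?thesis
    unfolding vlocal_def info locally_consistent_def set_info[symmetric]
    by (simp only: y vleft_simps vright_simps dlist_enc_list length_map)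
qed

lemma set_vassignments: "set (vassignments d y) = enc_list enc_pair ` assignments"
proof -
  let ?V = "variables d k" and ?N = "[0..<length C]"
  let ?P = "concat (map (\<lambda>v. map (\<lambda>c. (v, int c)) ?N) ?V)"
  have "concat (map (\<lambda>v. map (\<lambda>c. Node v c) (vvalues y)) (vvariables d y)) = map enc_pair ?P"
    unfolding vvariables_eq unfolding y vvalues_eq by (simp add: map_concat comp_def)
  then have "set (vassignments d y) =
      {z \<in> enc_list enc_pair ` set (List.n_lists (refutation_size d) ?P). vlocal d z y}"
    unfolding vassignments_def by (simp add: n_lists_map elist_map image_image)
  also have "\<dots> = enc_list enc_pair ` {zs \<in> set (List.n_lists (refutation_size d) ?P). vlocal d (enc_list enc_pair zs) y}"
    by blast
  also have "set ?P = set ?V \<times> int ` {0..<length C}" by auto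
  then have "set ?P = set ?V \<times> {0..<int (length C)}" by (simp add: image_int_atLeastLessThan)
  then have "{zs \<in> set (List.n_lists (refutation_size d) ?P). vlocal d (enc_list enc_pair zs) y} =
      {zs. length zs = refutation_size d \<and> set zs \<subseteq> set ?V \<times> {0..<int (length C)} \<and> vlocal d (enc_list enc_pair zs) y}"
    by (auto simp: set_n_lists)
  also have "\<dots> = assignments"
  proof -
    have *: "set zs \<subseteq> set ?V \<times> {0..<int (length C)} \<longleftrightarrow> fst ` set zs \<subseteq> set ?V \<and> snd ` set zs \<subseteq> {0..<int (length C)}"
      for zs :: "(int \<times> int) list"
      by (auto simp: image_subset_iff subset_iff)
    show ?thesis
      unfolding assignments_def * by (simp only: vlocal_iff conj_assoc cong: conj_cong)
  qed
  finally show ?thesis .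
qed

lemma vbase_eq: "vbase d l (Atom (int j)) y = base j l"
proof -
  have length_concat_replicate: "length (concat (map (\<lambda>\<tau>. replicate n \<tau>) ts)) = length ts * n" for n and ts :: "val list"
    by (induction ts) auto
  have "vfact d y = (\<Prod>i<length tuples * Suc (refutation_size d). int i + 1)"
    unfolding vfact_def prod_list_indexed length_concat_replicate vtuples_eq length_map by simp
  also have "\<dots> = fact (length tuples * Suc (refutation_size d))"
    unfolding fact_prod_Suc by (simp add: atLeast0LessThan add.commute)
  finally show ?thesis unfolding vbase_def base_def by (simp add: algebra_simps)
qed

lemma vexponent_eq:
  assumes zs: "zs \<in> assignments" and j: "j < length tuples" and l: "l \<le> refutation_size d"
  shows "vexponent (refutation_size d) l (enc_list Atom (tuples ! j)) (enc_list enc_pair zs) = exponent j l zs"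
proof -
  have cls: "elist (map (\<lambda>s. vleft s) (dlist (enc_list enc_pair zs))) = enc_list Atom (map fst zs)"
    by (simp add: enc_list_map)
  have repl: "elist (replicate q (Atom x)) = enc_list Atom (replicate q x)" for q x
    by (induction q) auto
  have eq: "enc_list Atom xs = enc_list Atom ys \<longleftrightarrow> xs = ys" for xs ys
    by (rule enc_list_eq_iff) (simp add: inj_def)
  have len: "length zs = refutation_size d" "length (tuples ! j) = refutation_size d"
    using zs nth_mem[OF j] by (auto simp: assignments_def in_tuples_iff)
  have zs0: "vleft (enc_list enc_pair zs) = enc_pair (zs ! 0)"
    using len two_le_refutation_size[of d] by (cases zs) auto
  show ?thesis
  proof (cases l)
    case 0
    then show ?thesis unfolding vexponent_def exponent_def class_exponent_def cls repl eq by simp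
  next
    case (Suc m)
    then have "m < refutation_size d" using l by simp
    then have "vleft ((vright ^^ m) (enc_list Atom (tuples ! j))) = Atom (tuples ! j ! m)"
      "vleft ((vright ^^ m) (enc_list enc_pair zs)) = enc_pair (zs ! m)"
      using len by (simp_all add: vleft_funpow_vright)
    then show ?thesis
      unfolding vexponent_def exponent_def link_exponent_def cls Suc nat.case
      by (simp add: repl eq zs0)
  qed
qed

text \<open>Provides the hypothesis of \<open>vpow_eq\<close>. Link exponents are differences of
  values in the range; class exponents are covered because the circuit is nonempty.\<close>

lemma exponent_le:
  assumes zs: "zs \<in> assignments" and l: "l \<le> refutation_size d"
  shows "\<bar>exponent j l zs\<bar> \<le> int (length C)"
proof -
  have "1 \<le> length C" using C by (simp add: circuit_def Suc_le_eq)
  moreover have "0 \<le> snd (zs ! m) \<and> snd (zs ! m) < int (length C)" if "m < refutation_size d" for m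
  proof -
    have "zs ! m \<in> set zs" using zs that by (simp add: assignments_def)
    then have "snd (zs ! m) \<in> {0..<int (length C)}" using zs unfolding assignments_def by blast
    then show ?thesis by simp
  qed
  ultimately show ?thesis
  proof (cases l)
    case (Suc m)
    then have "m < refutation_size d" "0 < refutation_size d" using l by auto
    with \<open>\<And>m. m < _ \<Longrightarrow> _\<close>[of m] \<open>\<And>m. m < _ \<Longrightarrow> _\<close>[of 0] \<open>1 \<le> length C\<close> show ?thesis
      unfolding exponent_def Suc nat.case link_exponent_def by auto
  qed (auto simp: exponent_def class_exponent_def)
qed

lemma vproduct_eq:
  assumes zs: "zs \<in> assignments" and s: "s = 1 \<or> s = - 1"
  shows "vproduct d s (enc_list enc_pair zs) y =
    (\<Prod>j<length tuples. \<Prod>l<Suc (refutation_size d). base j l ^ nat (s * exponent j l zs))"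
  unfolding vproduct_def prod_list_indexed vtuples_eq length_map
proof (intro prod.cong refl)
  fix j l
  assume "j \<in> {..<length tuples}" and l: "l \<in> {..<Suc (refutation_size d)}"
  then have j: "j < length tuples" "l \<le> refutation_size d" by auto
  have "s * exponent j l zs \<le> int (length C)" using exponent_le[OF zs j(2), of j] s by auto
  then show "vpow (vbase d l (vleft (Node (Atom (int j)) (map (enc_list Atom) tuples ! j))) y)
      (s * vexponent (refutation_size d) l (vright (Node (Atom (int j)) (map (enc_list Atom) tuples ! j))) (enc_list enc_pair zs)) y =
      base j l ^ nat (s * exponent j l zs)"
    using vexponent_eq[OF zs j] j(1) by (simp add: vbase_eq vpow_eq[where C = C and k = "int k", folded y])
qed

lemma vproduct_number:
  assumes "zs \<in> assignments"
  shows "Node (Atom (vproduct d 1 (enc_list enc_pair zs) y)) (Atom (vproduct d (- 1) (enc_list enc_pair zs) y)) =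
    enc_rat (number zs)"
  unfolding enc_rat_number by (simp add: vproduct_eq[OF assms] numerator_def denominator_def)

lemma vreduce_valid:
  assumes "shallow C d 1 (length C - 1)"
  shows "\<exists>as. vreduce d y = Node (enc_list enc_rat as) (Atom (int (length (variables d k) ^ refutation_size d))) \<and>
    (has_product_with_repetitions (set as) (length (variables d k) ^ refutation_size d) \<longleftrightarrow> satisfiable_with_weight C k)"
proof -
  have last: "length C - 1 < length C" "int (length C) - 1 = int (length C - 1)"
    using C by (auto simp: circuit_def Suc_le_eq of_nat_diff)
  have "vshallow d 1 (Node (Atom (int (length C) - 1)) (enc_list enc_gate C))"
    unfolding last(2) using vshallow_iff[OF C last(1)] assms by blast
  moreover have "valid_circuit (enc_list enc_gate C)" using C valid_circuit_iff by blast
  ultimately have valid: "valid_circuit (vleft y) \<and>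
      vshallow d 1 (Node (Atom (int (length (dlist (vleft y))) - 1)) (vleft y)) \<and>
      ival (vright y) \<le> int (length (dlist (vleft y)))"
    using k by (simp add: y)
  have len: "length tuples = length (variables d k) ^ refutation_size d"
    by (simp add: tuples_def length_n_lists)
  have "vassignments d y \<in> lists (enc_list enc_pair ` assignments)"
    using set_vassignments by blast
  then obtain zss where zss: "vassignments d y = map (enc_list enc_pair) zss" "set zss \<subseteq> assignments"
    unfolding lists_image by auto
  have "map (\<lambda>z. Node (Atom (vproduct d 1 z y)) (Atom (vproduct d (- 1) z y))) (vassignments d y) =
      map (\<lambda>zs. enc_rat (number zs)) zss"
    unfolding zss(1) map_map using zss(2) vproduct_number by (intro map_cong) auto
  then have "vreduce d y = Node (elist (map (\<lambda>z. enc_rat (number z)) zss)) (Atom (int (length (variables d k) ^ refutation_size d)))"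
    unfolding vreduce_def if_P[OF valid] by (simp only: vtuples_eq length_map len)
  then have "vreduce d y = Node (enc_list enc_rat (map number zss)) (Atom (int (length (variables d k) ^ refutation_size d)))"
    by (simp add: enc_list_map)
  moreover have "inj (enc_list enc_pair)"
    by (rule inj_enc_list) (auto intro: injI)
  then have "set zss = assignments"
    using set_vassignments zss by (metis image_set inj_image_eq_iff)
  then have "has_product_with_repetitions (set (map number zss)) (length tuples) \<longleftrightarrow> satisfiable_with_weight C k"
    using has_product_iff satisfiable_iff_tuples[OF C assms] by (simp add: tuples_def)
  ultimately show ?thesis unfolding len by blast
qed

end

section \<open>Correctness on arbitrary inputs\<close>

lemma weight_le_length: "weight C v \<le> length C"
proof -
  have "weight C v \<le> card {..<length C}" unfolding weight_def by (rule card_mono) auto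
  then show ?thesis by simp
qed

lemma weighted_circuit_sat_iff:
  "(enc_list enc_gate C, k) \<in> weighted_circuit_sat w d \<longleftrightarrow>
     circuit C \<and> weft_le C w \<and> depth_le C d \<and> satisfiable_with_weight C k"
  by (auto simp: weighted_circuit_sat_def enc_list_eq_iff[OF inj_enc_gate])

lemma k_product_with_repetitions_iff:
  "(enc_list enc_rat as, k) \<in> k_product_with_repetitions \<longleftrightarrow> has_product_with_repetitions (set as) k"
  by (auto simp: k_product_with_repetitions_def enc_list_eq_iff[OF inj_enc_rat])

text \<open>Whatever fails the tests is a no-instance; for \<open>k > length C\<close> this is
  because the weight cannot exceed the number of gates.\<close>

lemma vreduce_correct:
  "\<exists>x' k'. vreduce d (Node x (Atom (int k))) = Node x' (Atom (int k')) \<and>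
     k' \<le> (2 ^ Suc d + k) ^ refutation_size d \<and>
     ((x, k) \<in> weighted_circuit_sat 1 d \<longleftrightarrow> (x', k') \<in> k_product_with_repetitions)"
proof (cases "\<exists>C. circuit C \<and> x = enc_list enc_gate C \<and> shallow C d 1 (length C - 1) \<and> k \<le> length C")
  case True
  then obtain C where C: "circuit C" "x = enc_list enc_gate C" "shallow C d 1 (length C - 1)" "k \<le> length C"
    by blast
  obtain as where as: "vreduce d (Node x (Atom (int k))) =
      Node (enc_list enc_rat as) (Atom (int (length (variables d k) ^ refutation_size d)))"
    "has_product_with_repetitions (set as) (length (variables d k) ^ refutation_size d) \<longleftrightarrow> satisfiable_with_weight C k"
    using vreduce_valid[OF C(1,4) refl C(3)] C(2) by blast
  have "length (variables d k) = 2 ^ Suc d + k" by (simp add: variables_def)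
  moreover have "(x, k) \<in> weighted_circuit_sat 1 d \<longleftrightarrow> satisfiable_with_weight C k"
    using C shallow_output_iff[OF C(1)] by (simp add: weighted_circuit_sat_iff)
  ultimately show ?thesis using as k_product_with_repetitions_iff by (metis order_refl)
next
  case False
  have "(x, k) \<notin> weighted_circuit_sat 1 d"
  proof
    assume "(x, k) \<in> weighted_circuit_sat 1 d"
    then obtain C where C: "x = enc_list enc_gate C" "circuit C" "weft_le C 1" "depth_le C d" "satisfiable_with_weight C k"
      unfolding weighted_circuit_sat_def by blast
    then have "shallow C d 1 (length C - 1)" using shallow_output_iff by blast
    moreover have "k \<le> length C"
      using C(5) weight_le_length unfolding satisfiable_with_weight_def by blast
    ultimately show False using False C by blast
  qed
  \<comment> \<open>\<open>Atom 0\<close> encodes the empty list, from which no factor can be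
    chosen.\<close>
  moreover have "(Atom 0, 1) \<notin> k_product_with_repetitions"
    using k_product_with_repetitions_iff[of "[]" 1] by (auto simp: has_product_with_repetitions_def)
  moreover have "\<not> (valid_circuit x \<and> vshallow d 1 (Node (Atom (int (length (dlist x)) - 1)) x) \<and> int k \<le> int (length (dlist x)))"
  proof
    assume *: "valid_circuit x \<and> vshallow d 1 (Node (Atom (int (length (dlist x)) - 1)) x) \<and> int k \<le> int (length (dlist x))"
    then obtain C where C: "circuit C" "x = enc_list enc_gate C" using valid_circuit_iff by blast
    then have "length C - 1 < length C" "int (length (dlist x)) - 1 = int (length C - 1)"
      by (auto simp: circuit_def Suc_le_eq of_nat_diff)
    then have "shallow C d 1 (length C - 1)" using * C vshallow_iff by metis
    moreover have "k \<le> length C" using * C by simp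
    ultimately show False using False C by blast
  qed
  then have "vreduce d (Node x (Atom (int k))) = Node (Atom 0) (Atom (int 1))"
    unfolding vreduce_def by (simp only: vleft_simps vright_simps ival.simps if_False of_nat_1)
  moreover have "1 \<le> (2 ^ Suc d + k) ^ refutation_size d" 
    by (rule one_le_power) (simp add: Suc_le_eq)
  ultimately show ?thesis by blast
qed

section \<open>Composition of reductions\<close>

lemma computable_const: "computable (\<lambda>_. c)"
  unfolding computable_def by (intro exI[of _ "Prim (Const (Atom (int c)))"] allI exI) (use run.prim[of "Const (Atom (int c))"] in simp)

lemma computable_id: "computable (\<lambda>n. n)"
  unfolding computable_def by (intro exI[of _ "Prim Ident"] allI exI) (use run.prim[of Ident] in simp)

lemma computable_comp:
  assumes "computable f" "computable g"
  shows "computable (\<lambda>n. f (g n))"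
proof -
  obtain p q where p: "\<And>n. \<exists>t. run p (Atom (int n)) t (Atom (int (f n)))"
    and q: "\<And>n. \<exists>t. run q (Atom (int n)) t (Atom (int (g n)))"
    using assms unfolding computable_def by blast
  have "\<exists>t. run (Seq q p) (Atom (int n)) t (Atom (int (f (g n))))" for n
    using p[of "g n"] q[of n] run.seq by blast
  then show ?thesis unfolding computable_def by blast
qed

lemma computable_arith:
  assumes "computable f" "computable g"
    and "\<And>m n. apply_prim P (Node (Atom (int m)) (Atom (int n))) = Atom (int (h m n))"
  shows "computable (\<lambda>n. h (f n) (g n))"
proof -
  obtain p q where p: "\<And>n. \<exists>t. run p (Atom (int n)) t (Atom (int (f n)))"
    and q: "\<And>n. \<exists>t. run q (Atom (int n)) t (Atom (int (g n)))"
    using assms unfolding computable_def by blast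
  have "\<exists>t. run (Seq (Fork p q) (Prim P)) (Atom (int n)) t (Atom (int (h (f n) (g n))))" for n
  proof -
    obtain s t where "run p (Atom (int n)) s (Atom (int (f n)))" "run q (Atom (int n)) t (Atom (int (g n)))"
      using p q by blast
    from run.seq[OF run.fork[OF this] run.prim[of P]] show ?thesis
      unfolding assms(3) by blast
  qed
  then show ?thesis unfolding computable_def by blast
qed

lemma computable_add: "computable f \<Longrightarrow> computable g \<Longrightarrow> computable (\<lambda>n. f n + g n)"
  by (rule computable_arith[of f g Add]) auto

lemma computable_mult: "computable f \<Longrightarrow> computable g \<Longrightarrow> computable (\<lambda>n. f n * g n)"
  by (rule computable_arith[of f g Mul]) auto

lemma computable_power: "computable f \<Longrightarrow> computable (\<lambda>n. f n ^ c)"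
  by (induction c) (auto intro: computable_const computable_mult)

lemma vsize_ge_1: "1 \<le> vsize x"
  using vsize_pos[of x] by linarith

text \<open>The second stage is polynomial in instance and parameter together, and the first stage
  leaves both bounded in terms of \<open>k\<close> and a power of the input size. Monotonicity of
  \<open>h\<close> is used because only \<open>k1 <= g k\<close> is known.\<close>

lemma fpt_reducible_ptime:
  assumes "fpt_reducible P Q" and F: "ptime F" and h: "computable h" "mono h"
    and red: "\<And>x k. \<exists>x' k'. F (Node x (Atom (int k))) = Node x' (Atom (int k')) \<and> k' \<le> h k \<and>
      ((x, k) \<in> Q \<longleftrightarrow> (x', k') \<in> R)"
  shows "fpt_reducible P R"
proof -
  obtain p f g c where f: "computable f" and g: "computable g"
    and p: "\<And>x k. \<exists>t x' k'. run p (Node x (Atom (int k))) t (Node x' (Atom (int k'))) \<and>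
          t \<le> f k * vsize x ^ c \<and> k' \<le> g k \<and> ((x, k) \<in> P \<longleftrightarrow> (x', k') \<in> Q)"
    using assms(1) unfolding fpt_reducible_def by blast
  obtain q t e where q: "\<And>x. run q x (t x) (F x)" and e: "\<And>x. t x \<le> (vsize x + 2) ^ e"
    using F unfolding ptime_def poly_bounded_def by blast
  \<comment> \<open>With v = \<open>vsize x\<close>, the intermediate value y satisfies
    \<open>vsize y + 2\<close> <= v + (k + 4) + f k * v ^ c <= (f k + k + 5) * v ^ (c + 1). Raising
    this to the power \<open>e\<close> yields the second summand; exponent c + 1 covers the term v
    even if c = 0.\<close>
  define f' where "f' = (\<lambda>k. f k + (f k + k + 5) ^ e)"
  define c' where "c' = c + (c + 1) * e"
  have f': "computable f'"
    unfolding f'_def by (intro computable_add computable_power computable_const computable_id f)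
  have "\<exists>t x' k'. run (Seq p q) (Node x (Atom (int k))) t (Node x' (Atom (int k'))) \<and>
      t \<le> f' k * vsize x ^ c' \<and> k' \<le> h (g k) \<and> ((x, k) \<in> P \<longleftrightarrow> (x', k') \<in> R)" for x k
  proof -
    obtain s x1 k1 where 1: "run p (Node x (Atom (int k))) s (Node x1 (Atom (int k1)))"
      "s \<le> f k * vsize x ^ c" "k1 \<le> g k" "(x, k) \<in> P \<longleftrightarrow> (x1, k1) \<in> Q"
      using p by blast
    obtain x2 k2 where 2: "F (Node x1 (Atom (int k1))) = Node x2 (Atom (int k2))" "k2 \<le> h k1"
      "(x1, k1) \<in> Q \<longleftrightarrow> (x2, k2) \<in> R"
      using red by blast
    let ?y = "Node x1 (Atom (int k1))" and ?v = "vsize x"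
    have v: "1 \<le> ?v" by (rule vsize_ge_1)
    have "vsize (Node x (Atom (int k))) \<le> ?v + (k + 2)"
      using vsize_Atom_le[of "int k"] by (simp del: vsize.simps(1))
    then have "vsize ?y + 2 \<le> ?v + (k + 4) + f k * ?v ^ c"
      using run_vsize[OF 1(1)] 1(2) by linarith
    also have "\<dots> \<le> ?v ^ (c + 1) + (k + 4) * ?v ^ (c + 1) + f k * ?v ^ (c + 1)"
    proof (intro add_mono)
      show "?v \<le> ?v ^ (c + 1)" using v self_le_power[of ?v "c + 1"] by simp
      have "1 \<le> ?v ^ (c + 1)" using v by (rule one_le_power)
      then show "k + 4 \<le> (k + 4) * ?v ^ (c + 1)" using mult_le_mono2 by fastforce
      show "f k * ?v ^ c \<le> f k * ?v ^ (c + 1)" using v by (intro mult_le_mono2 power_increasing) auto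
    qed
    also have "\<dots> = (f k + k + 5) * ?v ^ (c + 1)" by (simp add: algebra_simps)
    finally have "(vsize ?y + 2) ^ e \<le> ((f k + k + 5) * ?v ^ (c + 1)) ^ e" by (rule power_mono) simp
    then have "t ?y \<le> (f k + k + 5) ^ e * ?v ^ ((c + 1) * e)"
      unfolding power_mult_distrib power_mult by (rule order_trans[OF e])
    also have "\<dots> \<le> (f k + k + 5) ^ e * ?v ^ c'"
      using v by (intro mult_le_mono2 power_increasing) (auto simp: c'_def)
    finally have "t ?y \<le> (f k + k + 5) ^ e * ?v ^ c'" .
    moreover have "?v ^ c \<le> ?v ^ c'" using v by (intro power_increasing) (auto simp: c'_def)
    then have "s \<le> f k * ?v ^ c'" using order_trans[OF 1(2) mult_le_mono2] by blast
    ultimately have "s + t ?y \<le> f' k * ?v ^ c'" unfolding f'_def add_mult_distrib by (rule add_mono[rotated])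
    moreover have "run (Seq p q) (Node x (Atom (int k))) (s + t ?y) (Node x2 (Atom (int k2)))"
      using run.seq[OF 1(1) q[of ?y]] 2(1) by simp
    moreover have "k2 \<le> h (g k)" using 2(2) monoD[OF h(2) 1(3)] by (rule order_trans)
    moreover have "(x, k) \<in> P \<longleftrightarrow> (x2, k2) \<in> R" using 1(4) 2(3) by simp
    ultimately show ?thesis by blast
  qed
  moreover have "computable (\<lambda>k. h (g k))" by (rule computable_comp[OF h(1) g])
  ultimately show ?thesis unfolding fpt_reducible_def using f' by blast
qed

theorem theorem6:
  shows "W_hard 1 k_product_with_repetitions"
  unfolding W_hard_def
proof
  fix P
  assume "P \<in> W 1"
  then obtain d where P: "fpt_reducible P (weighted_circuit_sat 1 d)" unfolding W_def by blast
  \<comment> \<open>The depth \<open>d\<close> depends on \<open>P\<close> only, so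
    \<open>2 ^ Suc d\<close> and \<open>refutation_size d\<close> are constants and
    \<open>?h\<close> is a polynomial in \<open>k\<close>.\<close>
  let ?h = "\<lambda>k :: nat. (2 ^ Suc d + k) ^ refutation_size d"
  have "computable ?h" by (intro computable_power computable_add computable_const computable_id)
  moreover have "mono ?h" by (intro monoI power_mono) auto
  ultimately show "fpt_reducible P k_product_with_repetitions"
    using fpt_reducible_ptime[OF P ptime_vreduce] vreduce_correct by blast
qed

end
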